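(* Suppose $\sigma\in L^{\infty}(\mathbb{C},\frac{1}{\pi}e^{-|z|^{2}}dz)$ is real-valued and has a radial limit $\tilde\sigma$. Then for every continuous $\psi:[\inf\sigma,\sup\sigma]\to\mathbb{C}$, $$\lim_{N\to\infty}\frac{1}{N+1}\operatorname{tr}\bigl(\psi(P_{N}T_{\sigma}P_{N})\bigr)=\int_{0}^{2\pi}\psi\bigl(\tilde{\sigma}(\theta)\bigr)\frac{d\theta}{2\pi},$$ where $T_\sigma$ is the Toeplitz operator on the Segal-Bargmann-Fock space $\mathcal{F}^2(\mathbb{C})$.
   Context: Let $d\nu(z)=\frac1\pi e^{-|z|^2}dz$ on $\mathbb{C}$, where $dz$ is area measure. The Segal-Bargmann-Fock space $\mathcal{F}^2(\mathbb{C})$ is the closed subspace of $L^2(\mathbb{C},\nu)$ consisting of entire functions; it has orthonormal basis $z^n/\sqrt{n!}$, $n\ge0$. Let $P:L^2(\mathbb{C},\nu)\to\mathcal{F}^2(\mathbb{C})$ be the orthogonal projection; the Toeplitz operator with symbol $\sigma\in L^\infty(\mathbb{C})$ is $T_\sigma f=P(\sigma f)$ on $\mathcal{F}^2(\mathbb{C})$. Let $\mathcal{K}_N=\operatorname{span}\{z^n:n=0,1,\dots,N\}$ and let $P_N$ be the orthogonal projection onto $\mathcal{K}_N$. The operator $P_NT_\sigma P_N$ is regarded as an operator on the $(N+1)$-dimensional space $\mathcal{K}_N$; it is self-adjoint for real $\sigma$, and $\psi(P_NT_\sigma P_N)$ (functional calculus) and its trace are taken on $\mathcal{K}_N$. Symbols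 $\sigma$ are understood as bounded measurable functions, so that pointwise limits, $\inf\sigma$ and $\sup\sigma$ make sense. A real-valued $\sigma\in L^\infty(\mathbb{C})$ has a radial limit if $\tilde\sigma(\theta):=\lim_{r\to\infty}\sigma(re^{i\theta})$ exists for almost every $\theta\in[0,2\pi)$. *)

theory Defs
  imports "HOL-Complex_Analysis.Complex_Analysis"
begin

definition gauss :: "complex measure" where
  "gauss = density lebesgue (\<lambda>z. ennreal (exp (- (cmod z)\<^sup>2) / pi))"

text \<open>
  Elements of \<open>L\<^sup>2(\<complex>, gauss)\<close> are represented by functions rather than by classes modulo
  null sets. Every subspace projected onto below consists of entire functions, for which equality
  almost everywhere and equality coincide.
\<close>

definition L2_gauss :: "(complex \<Rightarrow> complex) set" where
  "L2_gauss = {f \<in> borel_measurable gauss. integrable gauss (\<lambda>z. (cmod (f z))\<^sup>2)}"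

definition inner_gauss :: "(complex \<Rightarrow> complex) \<Rightarrow> (complex \<Rightarrow> complex) \<Rightarrow> complex" where
  "inner_gauss f g = (LINT z|gauss. f z * cnj (g z))"

definition fock :: "(complex \<Rightarrow> complex) set" where
  "fock = {f \<in> L2_gauss. f holomorphic_on UNIV}"

text \<open>
  The orthogonal projection of \<open>f\<close> onto a closed subspace \<open>V\<close> is the unique \<open>g \<in> V\<close> with
  \<open>f - g\<close> orthogonal to \<open>V\<close>.
\<close>

definition orth_proj ::
    "(complex \<Rightarrow> complex) set \<Rightarrow> (complex \<Rightarrow> complex) \<Rightarrow> (complex \<Rightarrow> complex)" where
  "orth_proj V f = (THE g. g \<in> V \<and> (\<forall>h\<in>V. inner_gauss (\<lambda>z. f z - g z) h = 0))"

definition toeplitz ::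
    "(complex \<Rightarrow> complex) \<Rightarrow> (complex \<Rightarrow> complex) \<Rightarrow> (complex \<Rightarrow> complex)" where
  "toeplitz \<sigma> f = orth_proj fock (\<lambda>z. \<sigma> z * f z)"

definition poly_space :: "nat \<Rightarrow> (complex \<Rightarrow> complex) set" where
  "poly_space N = range (\<lambda>(c :: nat \<Rightarrow> complex) z. \<Sum>n\<le>N. c n * z ^ n)"

definition compression ::
    "nat \<Rightarrow> ((complex \<Rightarrow> complex) \<Rightarrow> (complex \<Rightarrow> complex)) \<Rightarrow> (complex \<Rightarrow> complex) \<Rightarrow> (complex \<Rightarrow> complex)"
  where "compression N A f = orth_proj (poly_space N) (A (orth_proj (poly_space N) f))"

text \<open>
  Functional calculus of an operator \<open>A\<close> that is self-adjoint on the finite-dimensional space \<open>V\<close>: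
  \<open>\<psi>(A) = (\<Sum>\<mu>. \<psi> \<mu> E\<^sub>\<mu>)\<close>, summed over the spectrum, where \<open>E\<^sub>\<mu>\<close> is the
  orthogonal projection onto the eigenspace of \<open>\<mu>\<close>. Self-adjointness makes the spectrum real,
  so \<open>\<psi>\<close> is a function of a real argument.
\<close>

definition eigenspace_on ::
    "(complex \<Rightarrow> complex) set \<Rightarrow> ((complex \<Rightarrow> complex) \<Rightarrow> (complex \<Rightarrow> complex)) \<Rightarrow> real
      \<Rightarrow> (complex \<Rightarrow> complex) set" where
  "eigenspace_on V A \<mu> = {f \<in> V. A f = (\<lambda>z. complex_of_real \<mu> * f z)}"

definition spectrum_on ::
    "(complex \<Rightarrow> complex) set \<Rightarrow> ((complex \<Rightarrow> complex) \<Rightarrow> (complex \<Rightarrow> complex)) \<Rightarrow> real set" where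
  "spectrum_on V A = {\<mu>. \<exists>f \<in> eigenspace_on V A \<mu>. f \<noteq> (\<lambda>z. 0)}"

definition fun_calc_on ::
    "(complex \<Rightarrow> complex) set \<Rightarrow> (real \<Rightarrow> complex) \<Rightarrow> ((complex \<Rightarrow> complex) \<Rightarrow> (complex \<Rightarrow> complex))
      \<Rightarrow> (complex \<Rightarrow> complex) \<Rightarrow> (complex \<Rightarrow> complex)" where
  "fun_calc_on V \<psi> A f =
     (\<lambda>z. \<Sum>\<mu>\<in>spectrum_on V A. \<psi> \<mu> * orth_proj (eigenspace_on V A \<mu>) f z)"

definition fock_basis :: "nat \<Rightarrow> complex \<Rightarrow> complex" where
  "fock_basis n z = z ^ n / complex_of_real (sqrt (fact n))"

text \<open>
  The trace on \<open>poly_space N\<close>, computed in its orthonormal basis \<open>fock_basis 0, \<dots>, fock_basis N\<close>.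
\<close>

definition trace_on_poly_space ::
    "nat \<Rightarrow> ((complex \<Rightarrow> complex) \<Rightarrow> (complex \<Rightarrow> complex)) \<Rightarrow> complex" where
  "trace_on_poly_space N A = (\<Sum>n\<le>N. inner_gauss (A (fock_basis n)) (fock_basis n))"

text \<open>
  The limit is required for almost every angle only, so it determines \<open>\<sigma>'\<close> up to a null set.
\<close>

definition has_radial_limit :: "(complex \<Rightarrow> real) \<Rightarrow> (real \<Rightarrow> real) \<Rightarrow> bool" where
  "has_radial_limit \<sigma> \<sigma>' \<longleftrightarrow>
     (AE \<theta> in lebesgue_on {0..<2*pi}.
        ((\<lambda>r::real. \<sigma> (complex_of_real r * cis \<theta>)) \<longlongrightarrow> \<sigma>' \<theta>) at_top)"

end

theory Submission
  imports Defs "HOL-Probability.Distributions"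
begin

text \<open>
  Let \<open>\<nu>\<close> be the Gaussian measure, \<open>e\<^sub>n\<close> the orthonormal monomials \<open>fock_basis n\<close>, and
  \<open>K(z, w) = (\<Sum>n\<le>N. e\<^sub>n(z) * cnj (e\<^sub>n(w)))\<close> the reproducing kernel of the polynomials of degree
  at most \<open>N\<close>.

  On these polynomials the compressed Toeplitz operator multiplies by \<open>\<sigma>\<close> and then projects back
  (\<open>compression_toeplitz\<close>). It is a Hermitian matrix in the basis \<open>e\<^sub>n\<close>, so there are orthonormal
  eigenfunctions \<open>F\<^sub>j\<close> with real eigenvalues \<open>l\<^sub>j\<close>, and the trace in question is \<open>\<Sum>j\<le>N. \<psi>(l\<^sub>j)\<close>
  (\<open>toeplitz_compression_eigenbasis\<close>). Each \<open>|F\<^sub>j|\<^sup>2\<close> is a probability density for \<open>\<nu>\<close> under which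
  \<open>\<sigma>\<close> has mean \<open>l\<^sub>j\<close>, and the sum of these densities is \<open>K(z, z)\<close>. A continuous \<open>\<psi>\<close> on a compact
  interval satisfies \<open>|\<psi>(x) - \<psi>(y)| \<le> e + M * (x - y)\<^sup>2\<close> for every \<open>e > 0\<close> and a suitable \<open>M\<close>.
  Therefore \<open>\<Sum>j\<le>N. \<psi>(l\<^sub>j)\<close> differs from \<open>\<integral>\<psi>(\<sigma>(z)) K(z, z) d\<nu>\<close> by at most \<open>e * (N + 1)\<close> plus
  \<open>M\<close> times the sum of the variances of \<open>\<sigma>\<close> under the densities \<open>|F\<^sub>j|\<^sup>2\<close>. That sum does not depend
  on the eigenfunctions: it is half of \<open>\<integral>\<integral>(\<sigma>(z) - \<sigma>(w))\<^sup>2 |K(z, w)|\<^sup>2 d\<nu> d\<nu>\<close>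
  (\<open>eigenvalue_variance\<close>).

  This double integral is \<open>o(N)\<close> (\<open>kernel_oscillation_tendsto_0\<close>) because \<open>|K(z, w)|\<^sup>2\<close>, of total
  mass \<open>N + 1\<close>, has most of its mass at bounded distance from the diagonal:
  \<open>\<integral>\<integral>|z - w|\<^sup>2 |K(z, w)|\<^sup>2 d\<nu> d\<nu>\<close> is exactly \<open>2 * (N + 1)\<close> (\<open>integral_kernel_dist\<close>). Over a bounded
  distance and far from the origin a continuous function of the direction \<open>z / |z|\<close> hardly varies,
  and a disc around the origin carries only a bounded part of the mass. Continuous functions of the
  direction approximate the radial limit in \<open>L\<^sup>2\<close>, and the error of the approximation enters through
  integrals against the diagonal \<open>K(z, z)\<close>.

  The diagonal is controlled by \<open>radial_limit_average\<close>: under \<open>\<nu>\<close> the direction of \<open>z\<close> is uniform and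
  independent of the modulus, and \<open>K(z, z) / (N + 1)\<close> is a radial probability density that leaves
  every disc, because \<open>K(z, z) \<le> exp (|z|\<^sup>2)\<close>. Hence the integral of a bounded function with a
  radial limit against it tends to the mean of that limit. For \<open>\<psi> \<circ> \<sigma>\<close> this mean is the right-hand side of the theorem.
\<close>

section \<open>Rotation invariance and moments of the Gaussian measure\<close>

lemma borel_measurable_Complex: "(\<lambda>(x, y). Complex x y) \<in> borel_measurable (lborel \<Otimes>\<^sub>M lborel)"
proof -
  have "(\<lambda>(x, y). Complex x y) = (\<lambda>p. complex_of_real (fst p) + \<i> * complex_of_real (snd p))"
    by (auto simp: complex_eq_iff)
  also have "\<dots> \<in> borel_measurable (lborel \<Otimes>\<^sub>M lborel)" by measurable
  finally show ?thesis .
qed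

lemma lborel_complex_eq_distr: "lborel = distr (lborel \<Otimes>\<^sub>M lborel) borel (\<lambda>(x, y). Complex x y)"
proof (rule lborel_eqI)
  note borel_measurable_Complex [measurable]
  fix l u :: complex
  assume le: "\<And>b. b \<in> Basis \<Longrightarrow> l \<bullet> b \<le> u \<bullet> b"
  have [simp]: "Re l \<le> Re u" "Im l \<le> Im u"
    using le[of 1] le[of \<i>] by (simp_all add: Basis_complex_def)
  have "(\<lambda>(x, y). Complex x y) -` box l u \<inter> space (lborel \<Otimes>\<^sub>M lborel)
      = {Re l<..<Re u} \<times> {Im l<..<Im u}"
    by (auto simp: space_pair_measure in_box_complex_iff)
  then show "emeasure (distr (lborel \<Otimes>\<^sub>M lborel) borel (\<lambda>(x, y). Complex x y)) (box l u)
      = ennreal (\<Prod>b\<in>Basis. (u - l) \<bullet> b)"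
    by (simp add: emeasure_distr sigma_finite_measure.emeasure_pair_measure_Times
        sigma_finite_lborel Basis_complex_def flip: ennreal_mult)
qed simp

lemma nn_integral_complex_iterated:
  assumes [measurable]: "f \<in> borel_measurable borel"
  shows "(\<integral>\<^sup>+z. f z \<partial>lborel) = (\<integral>\<^sup>+x. \<integral>\<^sup>+y. f (Complex x y) \<partial>lborel \<partial>lborel)"
    and "(\<integral>\<^sup>+z. f z \<partial>lborel) = (\<integral>\<^sup>+y. \<integral>\<^sup>+x. f (Complex x y) \<partial>lborel \<partial>lborel)"
proof -
  note borel_measurable_Complex [measurable]
  have m: "(\<lambda>p. f (Complex (fst p) (snd p))) \<in> borel_measurable (lborel \<Otimes>\<^sub>M lborel)"
    using measurable_compose[OF borel_measurable_Complex assms] by (simp add: case_prod_beta')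
  have "(\<integral>\<^sup>+z. f z \<partial>lborel) = (\<integral>\<^sup>+p. f (Complex (fst p) (snd p)) \<partial>(lborel \<Otimes>\<^sub>M lborel))"
    by (subst lborel_complex_eq_distr) (simp add: nn_integral_distr case_prod_beta')
  with lborel.nn_integral_fst[OF m] lborel_pair.nn_integral_snd[OF m]
  show "(\<integral>\<^sup>+z. f z \<partial>lborel) = (\<integral>\<^sup>+x. \<integral>\<^sup>+y. f (Complex x y) \<partial>lborel \<partial>lborel)"
    and "(\<integral>\<^sup>+z. f z \<partial>lborel) = (\<integral>\<^sup>+y. \<integral>\<^sup>+x. f (Complex x y) \<partial>lborel \<partial>lborel)"
    by simp_all
qed

lemma nn_integral_lborel_shift:
  fixes f :: "real \<Rightarrow> ennreal"
  assumes "f \<in> borel_measurable borel"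
  shows "(\<integral>\<^sup>+x. f (x + a) \<partial>lborel) = (\<integral>\<^sup>+x. f x \<partial>lborel)"
  using nn_integral_real_affine[OF assms, of 1 a] by (simp add: add.commute)

text \<open>
  A shear translates each line parallel to its axis, so it preserves area by Tonelli's theorem and
  the translation invariance of Lebesgue measure on the line.
\<close>

lemma nn_integral_shear:
  assumes [measurable]: "f \<in> borel_measurable borel"
  shows "(\<integral>\<^sup>+z. f (z + complex_of_real (a * Im z)) \<partial>lborel) = (\<integral>\<^sup>+z. f z \<partial>lborel)"
    and "(\<integral>\<^sup>+z. f (z + \<i> * complex_of_real (a * Re z)) \<partial>lborel) = (\<integral>\<^sup>+z. f z \<partial>lborel)"
proof -
  have mx: "(\<lambda>x. f (Complex x y)) \<in> borel_measurable borel" for y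
    unfolding Complex_eq by measurable
  have my: "(\<lambda>y. f (Complex x y)) \<in> borel_measurable borel" for x
    unfolding Complex_eq by measurable
  have "(\<integral>\<^sup>+z. f (z + complex_of_real (a * Im z)) \<partial>lborel)
      = (\<integral>\<^sup>+y. \<integral>\<^sup>+x. f (Complex (x + a * y) y) \<partial>lborel \<partial>lborel)"
    by (subst nn_integral_complex_iterated(2)) (simp_all add: Complex_eq algebra_simps)
  also have "\<dots> = (\<integral>\<^sup>+z. f z \<partial>lborel)"
    by (simp add: nn_integral_lborel_shift[OF mx] nn_integral_complex_iterated(2))
  finally show "(\<integral>\<^sup>+z. f (z + complex_of_real (a * Im z)) \<partial>lborel) = (\<integral>\<^sup>+z. f z \<partial>lborel)" .
  have "(\<integral>\<^sup>+z. f (z + \<i> * complex_of_real (a * Re z)) \<partial>lborel)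
      = (\<integral>\<^sup>+x. \<integral>\<^sup>+y. f (Complex x (y + a * x)) \<partial>lborel \<partial>lborel)"
    by (subst nn_integral_complex_iterated(1)) (simp_all add: Complex_eq algebra_simps)
  also have "\<dots> = (\<integral>\<^sup>+z. f z \<partial>lborel)"
    by (simp add: nn_integral_lborel_shift[OF my] nn_integral_complex_iterated(1))
  finally show "(\<integral>\<^sup>+z. f (z + \<i> * complex_of_real (a * Re z)) \<partial>lborel) = (\<integral>\<^sup>+z. f z \<partial>lborel)" .
qed

text \<open>
  A rotation other than the half turn is a product of three shears. This reduces rotation invariance
  to translation invariance on the line.
\<close>

lemma nn_integral_rotate_by_shears:
  assumes [measurable]: "f \<in> borel_measurable borel" and c: "cmod c = 1" "c \<noteq> -1"
  shows "(\<integral>\<^sup>+z. f (c * z) \<partial>lborel) = (\<integral>\<^sup>+z. f z \<partial>lborel)"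
proof -
  define a b where "a = Re c" and "b = Im c"
  have ab: "a\<^sup>2 + b\<^sup>2 = 1" using c(1) by (simp add: cmod_def a_def b_def)
  have "a \<noteq> -1"
  proof
    assume "a = -1"
    with ab have "b = 0" by simp
    with \<open>a = -1\<close> c(2) show False by (simp add: a_def b_def complex_eq_iff)
  qed
  \<comment> \<open>If \<open>c = cis \<alpha>\<close>, then \<open>t = - tan (\<alpha> / 2)\<close>: horizontal shears by \<open>t\<close> surround a vertical one by \<open>sin \<alpha>\<close>.\<close>
  define t where "t = - b / (1 + a)"
  have t1: "1 + t * b = a" using \<open>a \<noteq> -1\<close> ab unfolding t_def
    by (simp add: field_simps power2_eq_square)
  have t2: "t * (1 + a) = - b" using \<open>a \<noteq> -1\<close> unfolding t_def by (simp add: field_simps)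
  define S1 where "S1 z = z + complex_of_real (t * Im z)" for z
  define S2 where "S2 z = z + \<i> * complex_of_real (b * Re z)" for z
  have [measurable]: "S1 \<in> borel_measurable borel" "S2 \<in> borel_measurable borel"
    by (simp_all add: S1_def[abs_def] S2_def[abs_def])
  have "S1 (S2 (S1 z)) = c * z" for z
  proof -
    have "Re (S1 (S2 (S1 z))) = (1 + t * b) * Re z + (t * (1 + (1 + t * b))) * Im z"
      by (simp add: S1_def S2_def algebra_simps)
    moreover have "Im (S1 (S2 (S1 z))) = b * Re z + (1 + t * b) * Im z"
      by (simp add: S1_def S2_def algebra_simps)
    ultimately show ?thesis unfolding t1 t2
      by (simp add: complex_eq_iff a_def b_def)
  qed
  then have "(\<integral>\<^sup>+z. f (c * z) \<partial>lborel) = (\<integral>\<^sup>+z. f (S1 (S2 (S1 z))) \<partial>lborel)" by simp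
  also have "\<dots> = (\<integral>\<^sup>+z. f (S1 (S2 z)) \<partial>lborel)"
    using nn_integral_shear(1)[of "\<lambda>z. f (S1 (S2 z))" t] by (simp add: S1_def)
  also have "\<dots> = (\<integral>\<^sup>+z. f (S1 z) \<partial>lborel)"
    using nn_integral_shear(2)[of "\<lambda>z. f (S1 z)" b] by (simp add: S2_def)
  also have "\<dots> = (\<integral>\<^sup>+z. f z \<partial>lborel)"
    using nn_integral_shear(1)[of f t] by (simp add: S1_def)
  finally show ?thesis .
qed

lemma nn_integral_rotate:
  assumes [measurable]: "f \<in> borel_measurable borel" and c: "cmod c = 1"
  shows "(\<integral>\<^sup>+z. f (c * z) \<partial>lborel) = (\<integral>\<^sup>+z. f z \<partial>lborel)"
proof (cases "c = -1")
  case True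
  have "(\<integral>\<^sup>+z. f (c * z) \<partial>lborel) = (\<integral>\<^sup>+z. f (\<i> * (\<i> * z)) \<partial>lborel)"
    using True by (simp flip: mult.assoc)
  also have "\<dots> = (\<integral>\<^sup>+z. f (\<i> * z) \<partial>lborel)"
    by (rule nn_integral_rotate_by_shears[where f="\<lambda>z. f (\<i> * z)"]) (simp_all add: complex_eq_iff)
  also have "\<dots> = (\<integral>\<^sup>+z. f z \<partial>lborel)"
    by (rule nn_integral_rotate_by_shears) (simp_all add: complex_eq_iff)
  finally show ?thesis .
qed (use nn_integral_rotate_by_shears assms in blast)

text \<open>
  The disc of radius \<open>sqrt x\<close> has area \<open>pi * x\<close>, so the squared modulus carries \<open>pi\<close> times Lebesgue
  measure on the half line. Gaussian moments of \<open>z\<close> thereby become Gamma integrals.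
\<close>

lemma distr_norm_square_lborel:
  "distr lborel borel (\<lambda>z::complex. (cmod z)\<^sup>2)
     = density lborel (\<lambda>t. ennreal pi * indicator {0..} t)" (is "?D = ?E")
proof (rule measure_eqI_generator_eq[where E = "range lessThan" and \<Omega> = UNIV and A = "\<lambda>n. {..<real n}"])
  show "Int_stable (range lessThan :: real set set)"
  proof -
    have "{..<a} \<inter> {..<b} = {..<min a b}" for a b :: real by auto
    then show ?thesis by (auto simp: Int_stable_def)
  qed
  show "sets ?D = sigma_sets UNIV (range lessThan)" "sets ?E = sigma_sets UNIV (range lessThan)"
    by (simp_all add: borel_Iio)
  have D: "emeasure ?D {..<x} = ennreal (pi * max 0 x)" for x :: real
  proof (cases "x \<le> 0")
    case True
    have "\<not> (cmod z)\<^sup>2 < x" for z using zero_le_power2[of "cmod z"] True by linarith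
    then have "(\<lambda>z::complex. (cmod z)\<^sup>2) -` {..<x} = {}" by auto
    then show ?thesis using True by (simp add: emeasure_distr)
  next
    case False
    have "(cmod z)\<^sup>2 < x \<longleftrightarrow> cmod z < sqrt x" for z
      using real_sqrt_less_iff[of "(cmod z)\<^sup>2" x] by simp
    then have "(\<lambda>z::complex. (cmod z)\<^sup>2) -` {..<x} = ball 0 (sqrt x)" by auto
    then show ?thesis using False by (simp add: emeasure_distr emeasure_ball unit_ball_vol_2)
  qed
  have E: "emeasure ?E {..<x} = ennreal (pi * max 0 x)" for x :: real
  proof -
    have "emeasure ?E {..<x} = (\<integral>\<^sup>+t. ennreal pi * indicator {0..<x} t \<partial>lborel)"
      by (subst emeasure_density) (auto intro!: nn_integral_cong simp: indicator_def)
    also have "\<dots> = ennreal (pi * max 0 x)"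
      by (subst nn_integral_cmult_indicator) (auto simp: max_def ennreal_mult)
    finally show ?thesis .
  qed
  show "emeasure ?D X = emeasure ?E X" if "X \<in> range lessThan" for X
    using that by (auto simp: D E)
  show "emeasure ?D {..<real n} \<noteq> \<infinity>" for n by (simp add: D)
  show "(\<Union>n. {..<real n}) = UNIV" by (auto intro: reals_Archimedean2)
qed auto

lemma nn_integral_norm_square:
  assumes [measurable]: "g \<in> borel_measurable borel"
  shows "(\<integral>\<^sup>+z. g ((cmod z)\<^sup>2) \<partial>lborel) = (\<integral>\<^sup>+t. ennreal pi * indicator {0..} t * g t \<partial>lborel)"
proof -
  have "(\<integral>\<^sup>+z. g ((cmod z)\<^sup>2) \<partial>lborel) = (\<integral>\<^sup>+t. g t \<partial>distr lborel borel (\<lambda>z::complex. (cmod z)\<^sup>2))"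
    by (subst nn_integral_distr) auto
  also have "\<dots> = (\<integral>\<^sup>+t. ennreal pi * indicator {0..} t * g t \<partial>lborel)"
    unfolding distr_norm_square_lborel by (subst nn_integral_density) auto
  finally show ?thesis .
qed

lemma sets_gauss [measurable_cong]: "sets gauss = sets lebesgue"
  by (simp add: gauss_def)

lemma space_gauss [simp]: "space gauss = UNIV"
  by (simp add: gauss_def)

lemma borel_imp_gauss_measurable: "f \<in> borel_measurable borel \<Longrightarrow> f \<in> borel_measurable gauss"
  by (simp add: gauss_def measurable_completion)

lemma nn_integral_gauss:
  fixes f :: "complex \<Rightarrow> ennreal"
  assumes [measurable]: "f \<in> borel_measurable borel"
  shows "(\<integral>\<^sup>+z. f z \<partial>gauss) = (\<integral>\<^sup>+z. ennreal (exp (- (cmod z)\<^sup>2) / pi) * f z \<partial>lborel)"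
  unfolding gauss_def
  by (subst nn_integral_density) (auto simp: nn_integral_completion intro!: measurable_completion)

lemma nn_integral_gauss_rotate:
  fixes f :: "complex \<Rightarrow> ennreal"
  assumes [measurable]: "f \<in> borel_measurable borel" and "cmod c = 1"
  shows "(\<integral>\<^sup>+z. f (c * z) \<partial>gauss) = (\<integral>\<^sup>+z. f z \<partial>gauss)"
  using nn_integral_rotate[of "\<lambda>z. ennreal (exp (- (cmod z)\<^sup>2) / pi) * f z" c] assms
  by (simp add: nn_integral_gauss norm_mult)

lemma nn_integral_gauss_power:
  "(\<integral>\<^sup>+z. ennreal (cmod z ^ (2 * n)) \<partial>gauss) = ennreal (fact n)"
proof -
  have "(\<integral>\<^sup>+z. ennreal (cmod z ^ (2 * n)) \<partial>gauss)
      = (\<integral>\<^sup>+z. ennreal (exp (- ((cmod z)\<^sup>2)) / pi * ((cmod z)\<^sup>2) ^ n) \<partial>lborel)"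
    by (subst nn_integral_gauss) (simp_all add: power_mult ennreal_mult'[symmetric] del: times_divide_eq_left)
  also have "\<dots> = (\<integral>\<^sup>+t. ennreal pi * indicator {0..} t * ennreal (exp (- t) / pi * t ^ n) \<partial>lborel)"
    by (rule nn_integral_norm_square) measurable
  also have "\<dots> = (\<integral>\<^sup>+t. ennreal (t ^ n * exp (- t)) * indicator {0..} t \<partial>lborel)"
    by (intro nn_integral_cong) (auto simp: indicator_def mult_ac simp flip: ennreal_mult)
  also have "\<dots> = ennreal (fact n)" by (simp add: nn_intergal_power_times_exp_Ici)
  finally show ?thesis .
qed

lemma prob_space_gauss: "prob_space gauss"
  using nn_integral_gauss_power[of 0] by (intro prob_spaceI) simp

interpretation gauss: prob_space gauss by (rule prob_space_gauss)

text \<open>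
  The right-hand side is the Gaussian measure restricted to the Borel sets.
\<close>

lemma distr_gauss_rotate:
  assumes "cmod c = 1"
  shows "distr gauss borel (\<lambda>z. c * z) = distr gauss borel (\<lambda>z. z)"
proof (rule measure_eqI)
  fix A :: "complex set" assume "A \<in> sets (distr gauss borel (\<lambda>z. c * z))"
  then have [measurable]: "A \<in> sets borel" by simp
  have "emeasure (distr gauss borel (\<lambda>z. d * z)) A = (\<integral>\<^sup>+z. indicator A (d * z) \<partial>gauss)" for d
  proof -
    have "(\<lambda>z. d * z) \<in> measurable gauss borel" by (auto intro: borel_imp_gauss_measurable)
    then show ?thesis
      using nn_integral_distr[of "\<lambda>z. d * z" gauss borel "indicator A"] by simp
  qed
  from this[of c] this[of 1] nn_integral_gauss_rotate[of "indicator A" c] assms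
  show "emeasure (distr gauss borel (\<lambda>z. c * z)) A = emeasure (distr gauss borel (\<lambda>z. z)) A" by simp
qed simp

lemma integral_gauss_rotate:
  fixes f :: "complex \<Rightarrow> 'a::{banach, second_countable_topology}"
  assumes "f \<in> borel_measurable borel" and "cmod c = 1"
  shows "(LINT z|gauss. f (c * z)) = (LINT z|gauss. f z)"
proof -
  have *: "(LINT z|gauss. f (d * z)) = (LINT z|distr gauss borel (\<lambda>z. d * z). f z)" for d
    by (rule integral_distr[symmetric]) (auto intro: borel_imp_gauss_measurable assms)
  show ?thesis using *[of c] *[of 1] distr_gauss_rotate[OF assms(2)] by simp
qed

section \<open>Square integrable functions and orthogonal projections\<close>

lemma borel_measurable_cnj [measurable (raw)]:
  "f \<in> borel_measurable M \<Longrightarrow> (\<lambda>x. cnj (f x)) \<in> borel_measurable M"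
  by (rule measurable_compose[of f M borel cnj])
    (auto intro: borel_measurable_continuous_onI continuous_intros)

definition l2sq :: "(complex \<Rightarrow> complex) \<Rightarrow> real" where
  "l2sq f = (LINT z|gauss. (cmod (f z))\<^sup>2)"

lemma L2_gaussD [dest]:
  assumes "f \<in> L2_gauss"
  shows "f \<in> borel_measurable gauss" "integrable gauss (\<lambda>z. (cmod (f z))\<^sup>2)"
  using assms by (auto simp: L2_gauss_def)

lemma L2_integrable_mult:
  assumes "f \<in> L2_gauss" "g \<in> L2_gauss"
  shows "integrable gauss (\<lambda>z. f z * cnj (g z))"
proof (rule Bochner_Integration.integrable_bound)
  note [measurable] = L2_gaussD(1)[OF assms(1)] L2_gaussD(1)[OF assms(2)]
  show "integrable gauss (\<lambda>z. (cmod (f z))\<^sup>2 + (cmod (g z))\<^sup>2)"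
    using assms by auto
  show "(\<lambda>z. f z * cnj (g z)) \<in> borel_measurable gauss" by measurable
  have "a * b \<le> a\<^sup>2 + b\<^sup>2" if "0 \<le> a" "0 \<le> b" for a b :: real
    using sum_squares_bound[of a b] mult_nonneg_nonneg[OF that] by linarith
  then show "AE z in gauss. norm (f z * cnj (g z)) \<le> norm ((cmod (f z))\<^sup>2 + (cmod (g z))\<^sup>2)"
    by (auto simp: norm_mult)
qed

text \<open>
  The criterion behind all closure properties below: domination by a multiple of the sum of two
  square integrable moduli.
\<close>

lemma L2_gaussI_bound:
  assumes "f \<in> borel_measurable gauss" "g \<in> L2_gauss" "h \<in> L2_gauss"
    "\<And>z. cmod (f z) \<le> C * (cmod (g z) + cmod (h z))"
  shows "f \<in> L2_gauss"
proof -
  have "integrable gauss (\<lambda>z. (cmod (f z))\<^sup>2)"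
  proof (rule Bochner_Integration.integrable_bound)
    show "integrable gauss (\<lambda>z. C\<^sup>2 * (2 * ((cmod (g z))\<^sup>2 + (cmod (h z))\<^sup>2)))"
      by (intro integrable_mult_right Bochner_Integration.integrable_add L2_gaussD assms)
    show "(\<lambda>z. (cmod (f z))\<^sup>2) \<in> borel_measurable gauss" using assms(1) by measurable
    have "(cmod (f z))\<^sup>2 \<le> C\<^sup>2 * (2 * ((cmod (g z))\<^sup>2 + (cmod (h z))\<^sup>2))" for z
    proof -
      have "(cmod (f z))\<^sup>2 \<le> (C * (cmod (g z) + cmod (h z)))\<^sup>2"
        using assms(4) by (intro power_mono) auto
      also have "\<dots> \<le> C\<^sup>2 * (2 * ((cmod (g z))\<^sup>2 + (cmod (h z))\<^sup>2))"
        unfolding power_mult_distrib using sum_squares_bound[of "cmod (g z)" "cmod (h z)"]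
        by (intro mult_left_mono) (auto simp: power2_sum)
      finally show ?thesis .
    qed
    then show "AE z in gauss. norm ((cmod (f z))\<^sup>2) \<le> norm (C\<^sup>2 * (2 * ((cmod (g z))\<^sup>2 + (cmod (h z))\<^sup>2)))"
      by auto
  qed
  with assms(1) show ?thesis by (simp add: L2_gauss_def)
qed

lemma L2_gauss_0: "(\<lambda>z. 0) \<in> L2_gauss"
  by (simp add: L2_gauss_def)

lemma L2_add: "f \<in> L2_gauss \<Longrightarrow> g \<in> L2_gauss \<Longrightarrow> (\<lambda>z. f z + g z) \<in> L2_gauss"
  by (rule L2_gaussI_bound[of _ f g 1]) (auto intro: norm_triangle_ineq borel_measurable_add)

lemma L2_diff: "f \<in> L2_gauss \<Longrightarrow> g \<in> L2_gauss \<Longrightarrow> (\<lambda>z. f z - g z) \<in> L2_gauss"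
  by (rule L2_gaussI_bound[of _ f g 1]) (auto intro: norm_triangle_ineq4 borel_measurable_diff)

lemma L2_mult_bounded:
  assumes "f \<in> L2_gauss" "s \<in> borel_measurable gauss" "\<And>z. cmod (s z) \<le> B"
  shows "(\<lambda>z. s z * f z) \<in> L2_gauss"
proof (rule L2_gaussI_bound[of _ f "\<lambda>z. 0" B])
  note [measurable] = assms(2) L2_gaussD(1)[OF assms(1)]
  show "(\<lambda>z. s z * f z) \<in> borel_measurable gauss" by measurable
qed (use assms in \<open>auto simp: norm_mult L2_gauss_0 intro: mult_right_mono\<close>)

lemma L2_scale: "f \<in> L2_gauss \<Longrightarrow> (\<lambda>z. c * f z) \<in> L2_gauss"
  by (rule L2_mult_bounded[where B="cmod c"]) auto

lemma L2_sum: "(\<And>j. j \<in> J \<Longrightarrow> f j \<in> L2_gauss) \<Longrightarrow> (\<lambda>z. \<Sum>j\<in>J. f j z) \<in> L2_gauss"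
  by (induction J rule: infinite_finite_induct) (auto simp: L2_gauss_0 intro: L2_add)

lemma inner_gauss_diff:
  assumes "f \<in> L2_gauss" "g \<in> L2_gauss" "h \<in> L2_gauss"
  shows "inner_gauss (\<lambda>z. f z - g z) h = inner_gauss f h - inner_gauss g h"
  unfolding inner_gauss_def using L2_integrable_mult assms by (simp add: ring_distribs)

lemma inner_gauss_scale: "inner_gauss (\<lambda>z. c * f z) h = c * inner_gauss f h"
  unfolding inner_gauss_def by (simp add: mult.assoc)

lemma inner_gauss_cnj: "cnj (inner_gauss f g) = inner_gauss g f"
proof -
  have "cnj (inner_gauss f g) = (LINT z|gauss. cnj (f z * cnj (g z)))"
    unfolding inner_gauss_def by (rule Bochner_Integration.integral_cnj[symmetric])
  then show ?thesis unfolding inner_gauss_def by (simp add: mult.commute)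
qed

lemma inner_gauss_diff_right:
  assumes "f \<in> L2_gauss" "g \<in> L2_gauss" "h \<in> L2_gauss"
  shows "inner_gauss h (\<lambda>z. f z - g z) = inner_gauss h f - inner_gauss h g"
  using arg_cong[where f=cnj, OF inner_gauss_diff[OF assms]] by (simp add: inner_gauss_cnj)

lemma inner_gauss_0 [simp]: "inner_gauss (\<lambda>z. 0) h = 0" "inner_gauss f (\<lambda>z. 0) = 0"
  by (simp_all add: inner_gauss_def)

lemma inner_gauss_sum:
  assumes "\<And>j. j \<in> J \<Longrightarrow> f j \<in> L2_gauss" "h \<in> L2_gauss"
  shows "inner_gauss (\<lambda>z. \<Sum>j\<in>J. c j * f j z) h = (\<Sum>j\<in>J. c j * inner_gauss (f j) h)"
  unfolding inner_gauss_def sum_distrib_right mult.assoc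
  using L2_integrable_mult assms by (subst Bochner_Integration.integral_sum) auto

lemma inner_gauss_sum_right:
  assumes "\<And>j. j \<in> J \<Longrightarrow> f j \<in> L2_gauss" "h \<in> L2_gauss"
  shows "inner_gauss h (\<lambda>z. \<Sum>j\<in>J. c j * f j z) = (\<Sum>j\<in>J. cnj (c j) * inner_gauss h (f j))"
  using arg_cong[where f=cnj, OF inner_gauss_sum[OF assms]] by (simp add: inner_gauss_cnj)

lemma inner_gauss_self: "inner_gauss f f = complex_of_real (l2sq f)"
  unfolding inner_gauss_def l2sq_def
  by (simp only: complex_norm_square[symmetric] integral_complex_of_real of_real_power[symmetric])

lemma l2sq_nonneg: "l2sq f \<ge> 0"
  by (simp add: l2sq_def)

text \<open>
  A weighted form of the Cauchy-Schwarz inequality. It suffices for limits, where the weight \<open>t\<close> is chosen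
  after the tolerance, and it is pointwise the inequality \<open>2 a b \<le> t a\<^sup>2 + b\<^sup>2 / t\<close>.
\<close>

lemma inner_gauss_le:
  assumes "f \<in> L2_gauss" "g \<in> L2_gauss" "t > 0"
  shows "2 * cmod (inner_gauss f g) \<le> t * l2sq f + l2sq g / t"
proof -
  have "cmod (inner_gauss f g) \<le> (LINT z|gauss. cmod (f z * cnj (g z)))"
    unfolding inner_gauss_def by (rule integral_norm_bound)
  also have "2 * \<dots> = (LINT z|gauss. 2 * (cmod (f z) * cmod (g z)))"
    by (simp add: norm_mult)
  also have "\<dots> \<le> (LINT z|gauss. t * (cmod (f z))\<^sup>2 + (cmod (g z))\<^sup>2 / t)"
  proof (rule integral_mono)
    show "integrable gauss (\<lambda>z. 2 * (cmod (f z) * cmod (g z)))"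
      using integrable_norm[OF L2_integrable_mult[OF assms(1,2)]] by (simp add: norm_mult)
    show "integrable gauss (\<lambda>z. t * (cmod (f z))\<^sup>2 + (cmod (g z))\<^sup>2 / t)"
      by (intro integrable_mult_right Bochner_Integration.integrable_add integrable_divide L2_gaussD assms)
    show "2 * (cmod (f z) * cmod (g z)) \<le> t * (cmod (f z))\<^sup>2 + (cmod (g z))\<^sup>2 / t" for z
    proof -
      have "2 * (t * cmod (f z)) * cmod (g z) \<le> (t * cmod (f z))\<^sup>2 + (cmod (g z))\<^sup>2"
        by (rule sum_squares_bound)
      then show ?thesis using \<open>t > 0\<close> by (simp add: field_simps power2_eq_square)
    qed
  qed
  also have "\<dots> = t * l2sq f + l2sq g / t"
    unfolding l2sq_def using L2_gaussD(2)[OF assms(1)] L2_gaussD(2)[OF assms(2)]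
    by (subst Bochner_Integration.integral_add) auto
  finally show ?thesis by simp
qed

lemma inner_gauss_tendsto_0:
  assumes "f \<in> L2_gauss" "\<And>n. r n \<in> L2_gauss" "(\<lambda>n. l2sq (r n)) \<longlonglongrightarrow> 0"
  shows "(\<lambda>n. inner_gauss f (r n)) \<longlonglongrightarrow> 0"
proof (rule tendstoI)
  fix e :: real assume "e > 0"
  define t where "t = e / (l2sq f + 1)"
  have "l2sq f + 1 > 0" using l2sq_nonneg[of f] by linarith
  then have "t > 0" using \<open>e > 0\<close> by (simp add: t_def)
  have "\<forall>\<^sub>F n in sequentially. dist (l2sq (r n)) 0 < t * e"
    using assms(3) \<open>t > 0\<close> \<open>e > 0\<close> by (intro tendstoD) auto
  then show "\<forall>\<^sub>F n in sequentially. dist (inner_gauss f (r n)) 0 < e"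
  proof eventually_elim
    case (elim n)
    have "t * l2sq f \<le> e" using \<open>e > 0\<close> l2sq_nonneg[of f] unfolding t_def
      by (simp add: field_simps)
    moreover have "l2sq (r n) / t < e" using elim \<open>t > 0\<close> by (simp add: field_simps)
    ultimately show ?case using inner_gauss_le[OF assms(1) assms(2)[of n] \<open>t > 0\<close>] by simp
  qed
qed

definition orthonormal_on :: "'i set \<Rightarrow> ('i \<Rightarrow> complex \<Rightarrow> complex) \<Rightarrow> bool" where
  "orthonormal_on J G \<longleftrightarrow> (\<forall>j\<in>J. G j \<in> L2_gauss) \<and>
     (\<forall>i\<in>J. \<forall>j\<in>J. inner_gauss (G i) (G j) = (if i = j then 1 else 0))"

definition span_of :: "'i set \<Rightarrow> ('i \<Rightarrow> complex \<Rightarrow> complex) \<Rightarrow> (complex \<Rightarrow> complex) set" where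
  "span_of J G = range (\<lambda>c z. \<Sum>j\<in>J. c j * G j z)"

lemma orthonormal_onD:
  assumes "orthonormal_on J G"
  shows "\<And>j. j \<in> J \<Longrightarrow> G j \<in> L2_gauss"
    "\<And>i j. i \<in> J \<Longrightarrow> j \<in> J \<Longrightarrow> inner_gauss (G i) (G j) = (if i = j then 1 else 0)"
  using assms by (auto simp: orthonormal_on_def)

lemma orthonormal_on_l2sq:
  assumes "orthonormal_on J G" "j \<in> J" shows "l2sq (G j) = 1"
  using inner_gauss_self[of "G j"] orthonormal_onD(2)[OF assms(1,2,2)] by (simp flip: of_real_eq_iff)

lemma span_of_L2:
  assumes "orthonormal_on J G" "f \<in> span_of J G" shows "f \<in> L2_gauss"
  using assms by (auto simp: span_of_def orthonormal_on_def intro!: L2_sum L2_scale)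

lemma span_ofI: "(\<lambda>z. \<Sum>j\<in>J. c j * G j z) \<in> span_of J G"
  by (auto simp: span_of_def)

lemma inner_combination:
  assumes G: "orthonormal_on J G" and "finite J" "i \<in> J"
  shows "inner_gauss (\<lambda>z. \<Sum>j\<in>J. c j * G j z) (G i) = c i"
proof -
  have "inner_gauss (\<lambda>z. \<Sum>j\<in>J. c j * G j z) (G i) = (\<Sum>j\<in>J. c j * inner_gauss (G j) (G i))"
    using orthonormal_onD[OF G] \<open>i \<in> J\<close> by (intro inner_gauss_sum) auto
  also have "\<dots> = (\<Sum>j\<in>J. if j = i then c j else 0)"
    using orthonormal_onD[OF G] \<open>i \<in> J\<close> by (intro sum.cong) auto
  finally show ?thesis using assms by simp
qed

lemma span_of_expansion:
  assumes "orthonormal_on J G" "finite J" "f \<in> span_of J G"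
  shows "f = (\<lambda>z. \<Sum>j\<in>J. inner_gauss f (G j) * G j z)"
proof -
  obtain c where c: "f = (\<lambda>z. \<Sum>j\<in>J. c j * G j z)" using assms(3) by (auto simp: span_of_def)
  then show ?thesis using inner_combination[OF assms(1,2)] by (auto intro!: sum.cong)
qed

text \<open>
  The description in \<open>orth_proj\<close> determines the coefficients of the projection by testing against the \<open>G j\<close>,
  which are themselves in the span; conversely, the Fourier coefficients of \<open>f\<close> meet the requirement.
\<close>

lemma orth_proj_span_of:
  assumes G: "orthonormal_on J G" and fin: "finite J" and f: "f \<in> L2_gauss"
  shows "orth_proj (span_of J G) f = (\<lambda>z. \<Sum>j\<in>J. inner_gauss f (G j) * G j z)" (is "_ = ?p")
  unfolding orth_proj_def
proof (rule the_equality)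
  have p: "?p \<in> L2_gauss" using span_of_L2[OF G span_ofI] .
  have "inner_gauss (\<lambda>z. f z - ?p z) h = 0" if h: "h \<in> span_of J G" for h
  proof -
    obtain c where c: "h = (\<lambda>z. \<Sum>j\<in>J. c j * G j z)" using h by (auto simp: span_of_def)
    have "inner_gauss (\<lambda>z. f z - ?p z) (G j) = 0" if "j \<in> J" for j
      using inner_gauss_diff[OF f p orthonormal_onD(1)[OF G that]]
        inner_combination[OF G fin that] by simp
    then show ?thesis unfolding c
      using orthonormal_onD(1)[OF G] L2_diff[OF f p] by (subst inner_gauss_sum_right) auto
  qed
  then show "?p \<in> span_of J G \<and> (\<forall>h\<in>span_of J G. inner_gauss (\<lambda>z. f z - ?p z) h = 0)"
    by (simp add: span_ofI)
  fix g assume g: "g \<in> span_of J G \<and> (\<forall>h\<in>span_of J G. inner_gauss (\<lambda>z. f z - g z) h = 0)"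
  have "inner_gauss g (G j) = inner_gauss f (G j)" if "j \<in> J" for j
  proof -
    have "G j = (\<lambda>z. \<Sum>i\<in>J. (if i = j then 1 else 0) * G i z)"
      using that fin by (auto simp: if_distrib[where f="\<lambda>x. x * _"] cong: if_cong)
    then have "G j \<in> span_of J G" by (metis span_ofI)
    then show ?thesis
      using g inner_gauss_diff[OF f span_of_L2[OF G] orthonormal_onD(1)[OF G that], of g] by simp
  qed
  moreover have "g = (\<lambda>z. \<Sum>j\<in>J. inner_gauss g (G j) * G j z)"
    using span_of_expansion[OF G fin] g by blast
  ultimately show "g = ?p" by (metis (no_types, lifting) sum.cong)
qed

lemma l2sq_combination:
  assumes G: "orthonormal_on J G" and "finite J"
  shows "l2sq (\<lambda>z. \<Sum>j\<in>J. c j * G j z) = (\<Sum>j\<in>J. (cmod (c j))\<^sup>2)"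
proof -
  have "complex_of_real (l2sq (\<lambda>z. \<Sum>j\<in>J. c j * G j z))
      = (\<Sum>j\<in>J. cnj (c j) * inner_gauss (\<lambda>z. \<Sum>j\<in>J. c j * G j z) (G j))"
    unfolding inner_gauss_self[symmetric] using orthonormal_onD(1)[OF G] span_of_L2[OF G span_ofI]
    by (intro inner_gauss_sum_right) auto
  also have "\<dots> = (\<Sum>j\<in>J. cnj (c j) * c j)"
    using inner_combination[OF assms] by (intro sum.cong) auto
  also have "\<dots> = complex_of_real (\<Sum>j\<in>J. (cmod (c j))\<^sup>2)"
    by (simp add: complex_norm_square mult.commute flip: of_real_power)
  finally show ?thesis using of_real_eq_iff by blast
qed

text \<open>
  The difference of the two sides is the squared norm of \<open>f\<close> minus its Fourier sum.
\<close>

lemma bessel_gauss: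
  assumes G: "orthonormal_on J G" and "finite J" and f: "f \<in> L2_gauss"
  shows "(\<Sum>j\<in>J. (cmod (inner_gauss f (G j)))\<^sup>2) \<le> l2sq f"
proof -
  define p where "p = (\<lambda>z. \<Sum>j\<in>J. inner_gauss f (G j) * G j z)"
  have p: "p \<in> L2_gauss" unfolding p_def using span_of_L2[OF G span_ofI] .
  have fp: "inner_gauss f p = complex_of_real (\<Sum>j\<in>J. (cmod (inner_gauss f (G j)))\<^sup>2)"
    unfolding p_def using orthonormal_onD(1)[OF G] f
    by (subst inner_gauss_sum_right) (auto simp: complex_norm_square mult.commute simp flip: of_real_power)
  have pp: "l2sq p = (\<Sum>j\<in>J. (cmod (inner_gauss f (G j)))\<^sup>2)"
    unfolding p_def by (rule l2sq_combination[OF assms(1,2)])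
  have "complex_of_real (l2sq (\<lambda>z. f z - p z)) = inner_gauss f (\<lambda>z. f z - p z) - inner_gauss p (\<lambda>z. f z - p z)"
    unfolding inner_gauss_self[symmetric] using f p by (intro inner_gauss_diff L2_diff) auto
  also have "\<dots> = (inner_gauss f f - inner_gauss f p) - (cnj (inner_gauss f p) - inner_gauss p p)"
    using f p by (simp add: inner_gauss_diff_right inner_gauss_cnj)
  finally have "l2sq (\<lambda>z. f z - p z) = l2sq f - (\<Sum>j\<in>J. (cmod (inner_gauss f (G j)))\<^sup>2)"
    unfolding fp inner_gauss_self pp by (simp flip: of_real_diff of_real_sum of_real_power)
  then show ?thesis using l2sq_nonneg[of "\<lambda>z. f z - p z"] by linarith
qed

lemma integrable_gauss_norm_power: "integrable gauss (\<lambda>z. cmod z ^ (2 * n))"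
  and integral_gauss_norm_power: "(LINT z|gauss. cmod z ^ (2 * n)) = fact n"
proof -
  have m: "(\<lambda>z. cmod z ^ (2 * n)) \<in> borel_measurable gauss"
    by (rule borel_imp_gauss_measurable) measurable
  show "integrable gauss (\<lambda>z. cmod z ^ (2 * n))"
    by (rule integrableI_nn_integral_finite[OF m _ nn_integral_gauss_power]) auto
  show "(LINT z|gauss. cmod z ^ (2 * n)) = fact n"
    by (subst integral_eq_nn_integral[OF m]) (simp_all add: nn_integral_gauss_power del: fact_Suc)
qed

lemma power_in_L2: "(\<lambda>z. c * z ^ n) \<in> L2_gauss"
proof (rule L2_scale)
  have "(cmod (z ^ n))\<^sup>2 = cmod z ^ (2 * n)" for z :: complex
    by (simp add: norm_power mult.commute flip: power_mult)
  moreover have "(\<lambda>z::complex. z ^ n) \<in> borel_measurable gauss"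
    by (rule borel_imp_gauss_measurable) measurable
  ultimately show "(\<lambda>z. z ^ n) \<in> L2_gauss"
    by (simp add: L2_gauss_def integrable_gauss_norm_power)
qed

text \<open>
  Rotation by the angle \<open>pi / (m - n)\<close> preserves the integral and changes the sign of the integrand.
\<close>

lemma integral_gauss_homogeneous_eq_0:
  fixes f :: "complex \<Rightarrow> complex"
  assumes "f \<in> borel_measurable borel" "m \<noteq> n"
    and hom: "\<And>c z. cmod c = 1 \<Longrightarrow> f (c * z) = c ^ m * cnj c ^ n * f z"
  shows "(LINT z|gauss. f z) = 0"
proof -
  define c where "c = cis (pi / (real m - real n))"
  have "c ^ m * cnj c ^ n = cis ((real m - real n) * (pi / (real m - real n)))"
    by (simp only: c_def Complex.DeMoivre cis_mult cis_cnj)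
      (intro arg_cong[where f=cis], simp add: left_diff_distrib diff_divide_distrib)
  also have "\<dots> = -1" using \<open>m \<noteq> n\<close> by simp
  finally have "c ^ m * cnj c ^ n = -1" .
  moreover have "cmod c = 1" by (simp add: c_def)
  ultimately have "(LINT z|gauss. f z) = (LINT z|gauss. - f z)"
    using integral_gauss_rotate[OF assms(1), of c] by (simp add: hom)
  then show ?thesis by simp
qed

lemma integral_gauss_monomials:
  "(LINT z|gauss. z ^ m * cnj (z ^ n)) = (if m = n then fact n else 0)"
proof (cases "m = n")
  case True
  have "z ^ n * cnj (z ^ n) = complex_of_real (cmod z ^ (2 * n))" for z
    by (metis complex_norm_square norm_power power_mult mult.commute of_real_power)
  then have "(LINT z|gauss. z ^ n * cnj (z ^ n)) = complex_of_real (LINT z|gauss. cmod z ^ (2 * n))"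
    by (simp only: integral_complex_of_real)
  then show ?thesis using True by (simp only: integral_gauss_norm_power) simp
next
  case False
  then show ?thesis
    by (subst integral_gauss_homogeneous_eq_0[of _ m n]) (auto simp: power_mult_distrib)
qed

lemma orthonormal_fock_basis: "orthonormal_on J fock_basis"
proof -
  have "fock_basis n \<in> L2_gauss" for n
    using power_in_L2[of "1 / complex_of_real (sqrt (fact n))" n] by (simp add: fock_basis_def[abs_def])
  moreover have "inner_gauss (fock_basis m) (fock_basis n) = (if m = n then 1 else 0)" for m n
  proof -
    have "inner_gauss (fock_basis m) (fock_basis n)
        = (LINT z|gauss. z ^ m * cnj (z ^ n) / (complex_of_real (sqrt (fact m)) * complex_of_real (sqrt (fact n))))"
      by (simp add: inner_gauss_def fock_basis_def)
    also have "\<dots> = (LINT z|gauss. z ^ m * cnj (z ^ n)) / (complex_of_real (sqrt (fact m)) * complex_of_real (sqrt (fact n)))"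
      by (rule integral_divide_zero)
    also have "\<dots> = (if m = n then 1 else 0)"
      by (simp add: integral_gauss_monomials del: complex_cnj_power flip: of_real_mult)
    finally show ?thesis .
  qed
  ultimately show ?thesis by (simp add: orthonormal_on_def)
qed

lemmas fock_basis_L2 = orthonormal_onD(1)[OF orthonormal_fock_basis[of UNIV], simplified]

lemma norm_fock_basis_square: "(cmod (fock_basis n z))\<^sup>2 = ((cmod z)\<^sup>2) ^ n /\<^sub>R fact n"
proof -
  have "cmod (fock_basis n z) = cmod z ^ n / sqrt (fact n)"
    by (simp add: fock_basis_def norm_divide norm_power)
  then show ?thesis
    by (simp add: power_divide divide_inverse power_mult_distrib power_inverse mult.commute flip: power_mult)
qed

lemma poly_space_eq_span: "poly_space N = span_of {..N} fock_basis"
proof -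
  have "(\<lambda>z. \<Sum>n\<le>N. c n * z ^ n) \<in> span_of {..N} fock_basis" for c
  proof -
    have eq: "(\<lambda>z. \<Sum>n\<le>N. c n * z ^ n) = (\<lambda>z. \<Sum>n\<le>N. (c n * complex_of_real (sqrt (fact n))) * fock_basis n z)"
      by (simp add: fock_basis_def)
    show ?thesis unfolding eq by (rule span_ofI)
  qed
  moreover have "(\<lambda>z. \<Sum>n\<le>N. c n * fock_basis n z) \<in> poly_space N" for c
  proof -
    have eq: "(\<lambda>z. \<Sum>n\<le>N. c n * fock_basis n z) = (\<lambda>z. \<Sum>n\<le>N. (c n / complex_of_real (sqrt (fact n))) * z ^ n)"
      by (simp add: fock_basis_def)
    show ?thesis unfolding eq poly_space_def
      by (rule range_eqI[where x="\<lambda>n. c n / complex_of_real (sqrt (fact n))"]) simp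
  qed
  ultimately show ?thesis by (auto simp: poly_space_def span_of_def)
qed

section \<open>The projection onto the Fock space\<close>

lemma fock_L2: "f \<in> fock \<Longrightarrow> f \<in> L2_gauss"
  by (simp add: fock_def)

lemma fock_basis_fock: "fock_basis n \<in> fock"
proof -
  have "fock_basis n holomorphic_on UNIV"
    unfolding fock_basis_def[abs_def] by (intro holomorphic_intros) auto
  then show ?thesis by (simp add: fock_def fock_basis_L2)
qed

lemma fock_diff: "f \<in> fock \<Longrightarrow> g \<in> fock \<Longrightarrow> (\<lambda>z. f z - g z) \<in> fock"
  by (auto simp: fock_def intro: L2_diff holomorphic_intros)

lemma entire_sums_monomials:
  assumes "f holomorphic_on UNIV"
  shows "(\<lambda>n. (deriv ^^ n) f 0 / fact n * z ^ n) sums f z"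
  using holomorphic_power_series[of f 0 "cmod z + 1" z] assms holomorphic_on_subset by fastforce

lemma integral_disc_tendsto:
  fixes f :: "complex \<Rightarrow> complex"
  assumes "integrable gauss f"
  shows "(\<lambda>j. LINT z|gauss. indicator (ball 0 (real j)) z * f z) \<longlonglongrightarrow> (LINT z|gauss. f z)"
proof (rule integral_dominated_convergence[where w="\<lambda>z. norm (f z)"])
  have m: "indicator (ball 0 (real j)) \<in> borel_measurable gauss" for j
    by (intro borel_imp_gauss_measurable borel_measurable_indicator) simp
  note [measurable] = borel_measurable_integrable[OF assms]
  show "f \<in> borel_measurable gauss" "integrable gauss (\<lambda>z. norm (f z))" using assms by auto
  show "(\<lambda>z. indicator (ball 0 (real j)) z * f z) \<in> borel_measurable gauss" for j
    using m by measurable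
  show "AE z in gauss. (\<lambda>j. indicator (ball 0 (real j)) z * f z) \<longlonglongrightarrow> f z"
  proof (rule AE_I2, rule tendsto_eventually)
    fix z :: complex
    obtain k where "cmod z < real k" using reals_Archimedean2 by blast
    then show "\<forall>\<^sub>F j in sequentially. indicator (ball 0 (real j)) z * f z = f z"
      by (intro eventually_sequentiallyI[of k]) (auto simp: indicator_def)
  qed
  show "AE z in gauss. norm (indicator (ball 0 (real j)) z * f z) \<le> norm (f z)" for j
    by (auto simp: indicator_def)
qed

text \<open>
  On a disc the Taylor series converges boundedly and distinct monomials are orthogonal, so the
  integral over the disc sees a single Taylor coefficient. Letting the radius grow gives the claim.
  Working on discs first is necessary because nothing is known yet about the series in \<open>L\<^sup>2\<close>.
\<close>

lemma inner_entire_monomial: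
  assumes f: "f \<in> L2_gauss" and sums: "\<And>z. (\<lambda>m. b m * z ^ m) sums f z"
  shows "inner_gauss f (\<lambda>z. z ^ n) = b n * fact n"
proof -
  have zn: "(\<lambda>z. z ^ n) \<in> L2_gauss" for n using power_in_L2[of 1 n] by simp
  have fm: "f \<in> borel_measurable gauss" using f by auto
  have bm: "(\<lambda>z::complex. z ^ k) \<in> borel_measurable borel" for k by measurable
  have im: "indicator (ball 0 R) \<in> borel_measurable (borel :: complex measure)" for R :: real
    by (intro borel_measurable_indicator) simp
  define m where "m R = (LINT z|gauss. indicator (ball 0 R) z * (z ^ n * cnj (z ^ n)))" for R :: real
  have disc: "(LINT z|gauss. indicator (ball 0 R) z * (f z * cnj (z ^ n))) = b n * m R" for R :: real
  proof -
    define S where "S M z = indicator (ball 0 R) z * ((\<Sum>k<M. b k * z ^ k) * cnj (z ^ n))" for M z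
    have summ: "summable (\<lambda>k. norm (b k) * \<bar>R\<bar> ^ k)"
      using powser_insidea[of b "complex_of_real (\<bar>R\<bar> + 1)" "complex_of_real \<bar>R\<bar>"]
        sums_summable[OF sums] by (simp add: norm_mult norm_power)
    define C where "C = (\<Sum>k. norm (b k) * \<bar>R\<bar> ^ k) * \<bar>R\<bar> ^ n"
    have bound: "norm (S M z) \<le> C" for M z
    proof (cases "z \<in> ball 0 R")
      case True
      then have z: "cmod z \<le> \<bar>R\<bar>" by simp
      have "norm (\<Sum>k<M. b k * z ^ k) \<le> (\<Sum>k<M. norm (b k) * \<bar>R\<bar> ^ k)"
        by (rule sum_norm_le) (auto simp: norm_mult norm_power intro!: mult_left_mono power_mono z)
      also have "\<dots> \<le> (\<Sum>k. norm (b k) * \<bar>R\<bar> ^ k)"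
        by (rule sum_le_suminf[OF summ]) auto
      finally show ?thesis using True unfolding S_def C_def
        by (auto simp: norm_mult norm_power intro!: mult_mono power_mono z suminf_nonneg summ)
    next
      case False
      have "C \<ge> 0" unfolding C_def by (intro mult_nonneg_nonneg suminf_nonneg summ) auto
      with False show ?thesis by (simp add: S_def)
    qed
    have Sm: "S M \<in> borel_measurable gauss" for M
      unfolding S_def by (rule borel_imp_gauss_measurable) (use im bm in measurable)
    have "(\<lambda>M. LINT z|gauss. S M z) \<longlonglongrightarrow> (LINT z|gauss. indicator (ball 0 R) z * (f z * cnj (z ^ n)))"
    proof (rule integral_dominated_convergence[where w="\<lambda>_. C"])
      show "(\<lambda>z. indicator (ball 0 R) z * (f z * cnj (z ^ n))) \<in> borel_measurable gauss"
        using fm borel_imp_gauss_measurable[OF im[of R]] borel_imp_gauss_measurable[OF bm[of n]]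
        by measurable
      show "AE z in gauss. (\<lambda>M. S M z) \<longlonglongrightarrow> indicator (ball 0 R) z * (f z * cnj (z ^ n))"
        unfolding S_def using sums by (intro AE_I2 tendsto_intros) (simp add: sums_def)
    qed (use bound Sm in auto)
    moreover have "(LINT z|gauss. S M z) = b n * m R" if "M > n" for M
    proof -
      have int: "integrable gauss (\<lambda>z. indicator (ball 0 R) z * (z ^ k * cnj (z ^ n)))" for k
      proof (rule Bochner_Integration.integrable_bound[OF L2_integrable_mult[OF zn[of k] zn[of n]]])
        show "(\<lambda>z. indicator (ball 0 R) z * (z ^ k * cnj (z ^ n))) \<in> borel_measurable gauss"
          by (rule borel_imp_gauss_measurable) (use im bm in measurable)
      qed (auto simp: indicator_def)
      have z: "(LINT z|gauss. indicator (ball 0 R) z * (z ^ k * cnj (z ^ n))) = 0" if "k \<noteq> n" for k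
      proof (rule integral_gauss_homogeneous_eq_0[OF _ that])
        show "(\<lambda>z. indicator (ball 0 R) z * (z ^ k * cnj (z ^ n))) \<in> borel_measurable borel"
          using im bm by measurable
        fix c z :: complex assume "cmod c = 1"
        then have "indicator (ball 0 R) (c * z) = (indicator (ball 0 R) z :: complex)"
          by (auto simp: indicator_def norm_mult)
        then show "indicator (ball 0 R) (c * z) * ((c * z) ^ k * cnj ((c * z) ^ n))
            = c ^ k * cnj c ^ n * (indicator (ball 0 R) z * (z ^ k * cnj (z ^ n)))"
          by (simp add: power_mult_distrib)
      qed
      have "(LINT z|gauss. S M z) = (LINT z|gauss. (\<Sum>k<M. b k * (indicator (ball 0 R) z * (z ^ k * cnj (z ^ n)))))"
        unfolding S_def by (simp add: sum_distrib_left sum_distrib_right mult_ac)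
      also have "\<dots> = (\<Sum>k<M. b k * (LINT z|gauss. indicator (ball 0 R) z * (z ^ k * cnj (z ^ n))))"
        using int by (subst Bochner_Integration.integral_sum) auto
      also have "\<dots> = (\<Sum>k<M. if k = n then b n * m R else 0)"
        by (intro sum.cong refl) (simp only: m_def split: if_split, use z in simp)
      finally show ?thesis using that by simp
    qed
    then have "(\<lambda>M. LINT z|gauss. S M z) \<longlonglongrightarrow> b n * m R"
      by (intro tendsto_eventually eventually_sequentiallyI[of "Suc n"]) auto
    ultimately show ?thesis using LIMSEQ_unique by blast
  qed
  have "(\<lambda>j. LINT z|gauss. indicator (ball 0 (real j)) z * (f z * cnj (z ^ n))) \<longlonglongrightarrow> (LINT z|gauss. f z * cnj (z ^ n))"
    by (rule integral_disc_tendsto[OF L2_integrable_mult[OF f zn[of n]]])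
  moreover have "(\<lambda>j. m (real j)) \<longlonglongrightarrow> (LINT z|gauss. z ^ n * cnj (z ^ n))"
    unfolding m_def by (rule integral_disc_tendsto[OF L2_integrable_mult[OF zn[of n] zn[of n]]])
  then have "(\<lambda>j. b n * m (real j)) \<longlonglongrightarrow> b n * fact n"
    unfolding integral_gauss_monomials by (intro tendsto_intros) simp
  ultimately show ?thesis unfolding disc inner_gauss_def using LIMSEQ_unique by blast
qed

text \<open>
  By \<open>inner_entire_monomial\<close> the Fourier series of an element of the Fock space is its Taylor series.
  Convergence at every point, not only almost everywhere, makes projections onto the Fock space unique
  as functions.
\<close>

lemma fock_sums:
  assumes "f \<in> fock"
  shows "(\<lambda>n. inner_gauss f (fock_basis n) * fock_basis n z) sums f z"
proof -
  define b where "b n = (deriv ^^ n) f 0 / fact n" for n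
  have hol: "f holomorphic_on UNIV" and f: "f \<in> L2_gauss" using assms by (auto simp: fock_def)
  have sums: "(\<lambda>m. b m * z ^ m) sums f z" for z
    unfolding b_def by (rule entire_sums_monomials[OF hol])
  have "inner_gauss f (fock_basis n) * fock_basis n z = b n * z ^ n" for n
  proof -
    have "inner_gauss f (fock_basis n) = inner_gauss f (\<lambda>z. z ^ n) / complex_of_real (sqrt (fact n))"
      unfolding inner_gauss_def fock_basis_def by simp
    also have "\<dots> = b n * fact n / complex_of_real (sqrt (fact n))"
      unfolding inner_entire_monomial[OF f sums] ..
    finally have "inner_gauss f (fock_basis n) * fock_basis n z
        = b n * z ^ n * (fact n / (complex_of_real (sqrt (fact n)) * complex_of_real (sqrt (fact n))))"
      by (simp add: fock_basis_def)
    also have "complex_of_real (sqrt (fact n)) * complex_of_real (sqrt (fact n)) = fact n"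
      by (simp flip: of_real_mult)
    finally show ?thesis by simp
  qed
  then show ?thesis using sums[of z] by simp
qed

lemma fock_eq_0: "f \<in> fock \<Longrightarrow> (\<And>n. inner_gauss f (fock_basis n) = 0) \<Longrightarrow> f z = 0"
  using fock_sums[of f z] sums_unique2[OF sums_zero, of "f z"] by simp

text \<open>
  Fatou's lemma, applied to the partial sums of the tail, bounds the norm of the tail by that of its
  coefficients. This replaces the completeness of \<open>L\<^sup>2\<close>, since pointwise convergence is given.
\<close>

lemma l2_series_tail:
  assumes pw: "\<And>z. (\<lambda>n. c n * fock_basis n z) sums g z"
    and summ: "summable (\<lambda>n. (cmod (c n))\<^sup>2)"
  shows "(\<lambda>z. g z - (\<Sum>n<M. c n * fock_basis n z)) \<in> L2_gauss"
    and "l2sq (\<lambda>z. g z - (\<Sum>n<M. c n * fock_basis n z)) \<le> (\<Sum>n. (cmod (c (n + M)))\<^sup>2)"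
proof -
  define s where "s k z = (\<Sum>n\<in>{M..<M + k}. c n * fock_basis n z)" for k z
  define r where "r = (\<lambda>z. g z - (\<Sum>n<M. c n * fock_basis n z))"
  have sL2: "s k \<in> L2_gauss" for k unfolding s_def[abs_def] by (intro L2_sum L2_scale fock_basis_L2)
  have lim: "(\<lambda>k. s k z) \<longlonglongrightarrow> r z" for z
  proof -
    have "(\<lambda>k. (\<Sum>n<k + M. c n * fock_basis n z) - (\<Sum>n<M. c n * fock_basis n z)) \<longlonglongrightarrow> r z"
      unfolding r_def using LIMSEQ_ignore_initial_segment[OF pw[unfolded sums_def]]
      by (intro tendsto_diff tendsto_const)
    moreover have "(\<Sum>n<k + M. c n * fock_basis n z) - (\<Sum>n<M. c n * fock_basis n z) = s k z" for k
      using sum.atLeastLessThan_concat[of 0 M "k + M" "\<lambda>n. c n * fock_basis n z"]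
      by (simp add: s_def lessThan_atLeast0 algebra_simps)
    ultimately show ?thesis by simp
  qed
  have [measurable]: "s k \<in> borel_measurable gauss" for k using sL2 by auto
  have rm [measurable]: "r \<in> borel_measurable gauss"
    by (rule borel_measurable_LIMSEQ_metric[of s, OF _ lim]) measurable
  have summ': "summable (\<lambda>n. (cmod (c (n + M)))\<^sup>2)" using summ by (subst summable_iff_shift)
  define T where "T = (\<Sum>n. (cmod (c (n + M)))\<^sup>2)"
  have "T \<ge> 0" unfolding T_def by (rule suminf_nonneg[OF summ']) simp
  have s_le: "(\<integral>\<^sup>+z. ennreal ((cmod (s k z))\<^sup>2) \<partial>gauss) \<le> ennreal T" for k
  proof -
    have "l2sq (s k) = (\<Sum>n\<in>{M..<M + k}. (cmod (c n))\<^sup>2)"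
      unfolding s_def[abs_def] by (rule l2sq_combination[OF orthonormal_fock_basis]) simp
    also have "\<dots> = (\<Sum>n<k. (cmod (c (n + M)))\<^sup>2)"
      by (rule sum.reindex_bij_witness[of _ "\<lambda>n. n + M" "\<lambda>n. n - M"]) auto
    also have "\<dots> \<le> T" unfolding T_def by (rule sum_le_suminf[OF summ']) auto
    finally have "l2sq (s k) \<le> T" .
    moreover have "(\<integral>\<^sup>+z. ennreal ((cmod (s k z))\<^sup>2) \<partial>gauss) = ennreal (l2sq (s k))"
      unfolding l2sq_def using L2_gaussD(2)[OF sL2] by (intro nn_integral_eq_integral) auto
    ultimately show ?thesis by (simp add: ennreal_leI)
  qed
  have "(\<integral>\<^sup>+z. ennreal ((cmod (r z))\<^sup>2) \<partial>gauss) = (\<integral>\<^sup>+z. liminf (\<lambda>k. ennreal ((cmod (s k z))\<^sup>2)) \<partial>gauss)"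
  proof (rule nn_integral_cong)
    fix z
    have "(\<lambda>k. ennreal ((cmod (s k z))\<^sup>2)) \<longlonglongrightarrow> ennreal ((cmod (r z))\<^sup>2)"
      using lim by (intro tendsto_ennrealI tendsto_intros)
    then show "ennreal ((cmod (r z))\<^sup>2) = liminf (\<lambda>k. ennreal ((cmod (s k z))\<^sup>2))"
      using lim_imp_Liminf[OF sequentially_bot] by metis
  qed
  also have "\<dots> \<le> liminf (\<lambda>k. \<integral>\<^sup>+z. ennreal ((cmod (s k z))\<^sup>2) \<partial>gauss)"
    by (rule nn_integral_liminf) measurable
  also have "\<dots> \<le> ennreal T"
    using s_le by (intro Liminf_le) auto
  finally have le: "(\<integral>\<^sup>+z. ennreal ((cmod (r z))\<^sup>2) \<partial>gauss) \<le> ennreal T" .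
  then have fin: "(\<integral>\<^sup>+z. ennreal ((cmod (r z))\<^sup>2) \<partial>gauss) < \<infinity>"
    by (rule le_less_trans) simp
  have int: "integrable gauss (\<lambda>z. (cmod (r z))\<^sup>2)"
    by (rule integrableI_nonneg[OF _ _ fin]) auto
  show "(\<lambda>z. g z - (\<Sum>n<M. c n * fock_basis n z)) \<in> L2_gauss"
    unfolding r_def[symmetric] L2_gauss_def using int rm by simp
  have "ennreal (l2sq r) = (\<integral>\<^sup>+z. ennreal ((cmod (r z))\<^sup>2) \<partial>gauss)"
    unfolding l2sq_def using int by (intro nn_integral_eq_integral[symmetric]) auto
  with le have "ennreal (l2sq r) \<le> ennreal T" by simp
  then show "l2sq (\<lambda>z. g z - (\<Sum>n<M. c n * fock_basis n z)) \<le> (\<Sum>n. (cmod (c (n + M)))\<^sup>2)"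
    unfolding r_def[symmetric] T_def[symmetric] using \<open>T \<ge> 0\<close> by (simp add: ennreal_le_iff)
qed

lemma l2_series:
  assumes pw: "\<And>z. (\<lambda>n. c n * fock_basis n z) sums g z"
    and summ: "summable (\<lambda>n. (cmod (c n))\<^sup>2)"
  shows "g \<in> L2_gauss"
    and "(\<lambda>M. l2sq (\<lambda>z. g z - (\<Sum>n<M. c n * fock_basis n z))) \<longlonglongrightarrow> 0"
    and "h \<in> L2_gauss \<Longrightarrow> (\<lambda>n. cnj (c n) * inner_gauss h (fock_basis n)) sums inner_gauss h g"
proof -
  define r where "r M = (\<lambda>z. g z - (\<Sum>n<M. c n * fock_basis n z))" for M
  have rL2: "r M \<in> L2_gauss" for M unfolding r_def by (rule l2_series_tail[OF assms])
  show g: "g \<in> L2_gauss" using rL2[of 0] by (simp add: r_def)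
  have "(\<lambda>M. \<Sum>n. (cmod (c (n + M)))\<^sup>2) \<longlonglongrightarrow> 0"
    using suminf_exist_split2[OF summ] .
  then show r0: "(\<lambda>M. l2sq (\<lambda>z. g z - (\<Sum>n<M. c n * fock_basis n z))) \<longlonglongrightarrow> 0"
    by (rule tendsto_sandwich[OF _ _ tendsto_const, rotated 2])
      (intro always_eventually allI l2_series_tail[OF assms] l2sq_nonneg)+
  assume h: "h \<in> L2_gauss"
  have "(\<lambda>M. inner_gauss h (r M)) \<longlonglongrightarrow> 0"
    using h rL2 r0 by (intro inner_gauss_tendsto_0) (auto simp: r_def)
  moreover have "inner_gauss h (r M) = inner_gauss h g - (\<Sum>n<M. cnj (c n) * inner_gauss h (fock_basis n))" for M
    unfolding r_def using h g
    by (subst inner_gauss_diff_right)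
      (auto intro!: L2_sum L2_scale fock_basis_L2 inner_gauss_sum_right)
  ultimately have "(\<lambda>M. inner_gauss h g - (inner_gauss h g - (\<Sum>n<M. cnj (c n) * inner_gauss h (fock_basis n)))) \<longlonglongrightarrow> inner_gauss h g - 0"
    by (intro tendsto_diff tendsto_const) simp
  then show "(\<lambda>n. cnj (c n) * inner_gauss h (fock_basis n)) sums inner_gauss h g"
    by (simp add: sums_def)
qed

lemma summable_inner_fock_basis:
  assumes "h \<in> L2_gauss" shows "summable (\<lambda>n. (cmod (inner_gauss h (fock_basis n)))\<^sup>2)"
  by (rule summableI_nonneg_bounded[where x="l2sq h"])
    (auto intro: bessel_gauss[OF orthonormal_fock_basis _ assms])

lemma fock_parseval:
  assumes "f \<in> fock" "h \<in> L2_gauss"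
  shows "(\<lambda>n. inner_gauss h (fock_basis n) * cnj (inner_gauss f (fock_basis n))) sums inner_gauss h f"
  using l2_series(3)[OF fock_sums[OF assms(1)] summable_inner_fock_basis[OF fock_L2[OF assms(1)]] assms(2)]
  by (simp add: mult.commute)

text \<open>
  The projection is the series with the Fourier coefficients of \<open>h\<close>. By Bessel's inequality these are square
  summable, and so are the values \<open>fock_basis n z\<close> for fixed \<open>z\<close>; hence the series converges everywhere,
  defines an entire function, and lies in \<open>L\<^sup>2\<close> by Fatou's lemma.
\<close>

lemma exists_fock_projection:
  assumes h: "h \<in> L2_gauss"
  obtains g where "g \<in> fock" "\<And>n. inner_gauss g (fock_basis n) = inner_gauss h (fock_basis n)"
proof -
  define c where "c n = inner_gauss h (fock_basis n)" for n
  have csq: "summable (\<lambda>n. (cmod (c n))\<^sup>2)" unfolding c_def by (rule summable_inner_fock_basis[OF h])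
  have summ: "summable (\<lambda>n. c n * fock_basis n z)" for z
  proof (rule summable_comparison_test)
    have "summable (\<lambda>n. ((cmod z)\<^sup>2) ^ n /\<^sub>R fact n)" by (rule summable_exp_generic)
    then show "summable (\<lambda>n. (cmod (c n))\<^sup>2 + (cmod (fock_basis n z))\<^sup>2)"
      by (intro summable_add csq) (simp only: norm_fock_basis_square)
    have "norm (c n * fock_basis n z) \<le> (cmod (c n))\<^sup>2 + (cmod (fock_basis n z))\<^sup>2" for n
      using sum_squares_bound[of "cmod (c n)" "cmod (fock_basis n z)"]
        mult_nonneg_nonneg[OF norm_ge_zero[of "c n"] norm_ge_zero[of "fock_basis n z"]]
      unfolding norm_mult by linarith
    then show "\<exists>N. \<forall>n\<ge>N. norm (c n * fock_basis n z) \<le> (cmod (c n))\<^sup>2 + (cmod (fock_basis n z))\<^sup>2"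
      by blast
  qed
  define g where "g z = (\<Sum>n. c n * fock_basis n z)" for z
  have pw: "(\<lambda>n. c n * fock_basis n z) sums g z" for z
    unfolding g_def by (rule summable_sums[OF summ])
  have gL2: "g \<in> L2_gauss" by (rule l2_series(1)[OF pw csq])
  have "g holomorphic_on UNIV"
  proof -
    have "g field_differentiable at z" for z
    proof -
      have "g holomorphic_on ball 0 (cmod z + 1)"
        using pw unfolding fock_basis_def
        by (intro power_series_holomorphic[where a="\<lambda>n. c n / complex_of_real (sqrt (fact n))"]) simp
      then show ?thesis by (rule holomorphic_on_imp_differentiable_at) auto
    qed
    then show ?thesis by (auto simp: holomorphic_on_def)
  qed
  then have gf: "g \<in> fock" using gL2 by (simp add: fock_def)
  have "inner_gauss (fock_basis n) g = cnj (c n)" for n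
  proof -
    have "(\<lambda>m. if m = n then cnj (c n) else 0) sums cnj (c n)"
      using sums_single[of n "\<lambda>_. cnj (c n)"] by simp
    moreover have "(\<lambda>m. cnj (c m) * inner_gauss (fock_basis n) (fock_basis m)) = (\<lambda>m. if m = n then cnj (c n) else 0)"
      using orthonormal_onD(2)[OF orthonormal_fock_basis[of UNIV]] by auto
    ultimately show ?thesis using l2_series(3)[OF pw csq fock_basis_L2[of n]] sums_unique2 by metis
  qed
  then have "inner_gauss g (fock_basis n) = c n" for n
    using inner_gauss_cnj[of "fock_basis n" g] by simp
  with gf that[of g] show ?thesis by (simp add: c_def)
qed

text \<open>
  Orthogonality to the Fourier basis suffices for orthogonality to the whole Fock space because
  Fourier series of Fock functions converge in \<open>L\<^sup>2\<close> (\<open>fock_parseval\<close>).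
\<close>

lemma orth_proj_fock:
  assumes h: "h \<in> L2_gauss"
  shows "orth_proj fock h \<in> fock"
    and "inner_gauss (orth_proj fock h) (fock_basis n) = inner_gauss h (fock_basis n)"
proof -
  obtain g where g: "g \<in> fock" "\<And>n. inner_gauss g (fock_basis n) = inner_gauss h (fock_basis n)"
    using exists_fock_projection[OF h] by blast
  have orth: "inner_gauss (\<lambda>z. h z - g z) f = 0" if f: "f \<in> fock" for f
  proof -
    have "inner_gauss (\<lambda>z. h z - g z) (fock_basis n) = 0" for n
      using g inner_gauss_diff[OF h fock_L2[OF g(1)] fock_basis_L2[of n]] by simp
    then show ?thesis
      using fock_parseval[OF f L2_diff[OF h fock_L2[OF g(1)]]]
        sums_unique2[OF sums_zero, of "inner_gauss (\<lambda>z. h z - g z) f"] by simp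
  qed
  have "orth_proj fock h = g" unfolding orth_proj_def
  proof (rule the_equality)
    fix g' assume g': "g' \<in> fock \<and> (\<forall>f\<in>fock. inner_gauss (\<lambda>z. h z - g' z) f = 0)"
    have "inner_gauss (\<lambda>z. g' z - g z) (fock_basis n) = 0" for n
      using g g' inner_gauss_diff[OF h fock_L2 fock_basis_L2[of n], of g'] fock_basis_fock
        inner_gauss_diff[OF fock_L2 fock_L2 fock_basis_L2[of n], of g' g] by simp
    then have "g' z - g z = 0" for z
      using fock_eq_0[OF fock_diff[of g' g]] g g' by blast
    then show "g' = g" by (auto simp: fun_eq_iff)
  qed (use g orth in auto)
  with g show "orth_proj fock h \<in> fock"
    "inner_gauss (orth_proj fock h) (fock_basis n) = inner_gauss h (fock_basis n)" by auto
qed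

text \<open>
  The Fock projection does not change inner products with polynomials, so projecting further to polynomials
  removes it from the formula.
\<close>

lemma compression_toeplitz:
  assumes s: "s \<in> borel_measurable gauss" "\<And>z. cmod (s z) \<le> B" and f: "f \<in> poly_space N"
  shows "compression N (toeplitz s) f
    = (\<lambda>z. \<Sum>n\<le>N. inner_gauss (\<lambda>z. s z * f z) (fock_basis n) * fock_basis n z)"
proof -
  note on = orthonormal_fock_basis[of "{..N}"]
  have fL2: "f \<in> L2_gauss" using span_of_L2[OF on] f by (simp add: poly_space_eq_span)
  have sf: "(\<lambda>z. s z * f z) \<in> L2_gauss" by (rule L2_mult_bounded[OF fL2 s])
  have "orth_proj (poly_space N) f = f"
    unfolding poly_space_eq_span orth_proj_span_of[OF on finite_atMost fL2]
    using span_of_expansion[OF on finite_atMost] f by (simp add: poly_space_eq_span)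
  then show ?thesis
    unfolding compression_def toeplitz_def poly_space_eq_span
    using orth_proj_fock[OF sf] by (simp add: orth_proj_span_of[OF on finite_atMost fock_L2])
qed

section \<open>Orthonormal eigenvectors of a Hermitian matrix\<close>

definition dotp :: "nat \<Rightarrow> (nat \<Rightarrow> complex) \<Rightarrow> (nat \<Rightarrow> complex) \<Rightarrow> complex" where
  "dotp d u v = (\<Sum>n<d. u n * cnj (v n))"

definition mat_app :: "nat \<Rightarrow> (nat \<Rightarrow> nat \<Rightarrow> complex) \<Rightarrow> (nat \<Rightarrow> complex) \<Rightarrow> nat \<Rightarrow> complex" where
  "mat_app d a u m = (\<Sum>n<d. a m n * u n)"

lemma dotp_self: "dotp d u u = complex_of_real (\<Sum>n<d. (cmod (u n))\<^sup>2)"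
  by (simp add: dotp_def complex_norm_square flip: of_real_power)

lemma dotp_self_Re: "Re (dotp d u u) = (\<Sum>n<d. (cmod (u n))\<^sup>2)"
  by (simp add: dotp_self)

lemma dotp_cnj: "cnj (dotp d u v) = dotp d v u"
  by (simp add: dotp_def mult.commute)

lemma dotp_self_eq_0: "dotp d u u = 0 \<longleftrightarrow> (\<forall>n<d. u n = 0)"
  by (auto simp: dotp_self sum_nonneg_eq_0_iff simp flip: of_real_sum of_real_power)

lemma dotp_lin:
  "dotp d (\<lambda>n. u n + u' n) v = dotp d u v + dotp d u' v"
  "dotp d (\<lambda>n. u n - u' n) v = dotp d u v - dotp d u' v"
  "dotp d (\<lambda>n. c * u n) v = c * dotp d u v"
  "dotp d u (\<lambda>n. v n + v' n) = dotp d u v + dotp d u v'"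
  "dotp d u (\<lambda>n. v n - v' n) = dotp d u v - dotp d u v'"
  "dotp d u (\<lambda>n. c * v n) = cnj c * dotp d u v"
  by (simp_all add: dotp_def sum.distrib sum_subtractf sum_distrib_left algebra_simps)

lemma dotp_sum_left: "dotp d (\<lambda>n. \<Sum>j\<in>J. f j n) v = (\<Sum>j\<in>J. dotp d (f j) v)"
  unfolding dotp_def by (simp add: sum_distrib_right) (rule sum.swap)

lemma dotp_delta: "k < d \<Longrightarrow> dotp d (\<lambda>n. if n = k then 1 else 0) v = cnj (v k)"
  by (simp add: dotp_def if_distrib[where f="\<lambda>x. x * _"] cong: if_cong)

lemma mat_app_lin:
  "mat_app d a (\<lambda>n. u n + u' n) = (\<lambda>m. mat_app d a u m + mat_app d a u' m)"
  "mat_app d a (\<lambda>n. c * u n) = (\<lambda>m. c * mat_app d a u m)"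
  by (simp_all add: mat_app_def fun_eq_iff sum.distrib sum_distrib_left algebra_simps)

lemma dotp_mat_app_hermitian:
  assumes "\<And>m n. cnj (a m n) = a n m"
  shows "dotp d (mat_app d a u) v = dotp d u (mat_app d a v)"
proof -
  have "dotp d (mat_app d a u) v = (\<Sum>m<d. \<Sum>n<d. a m n * u n * cnj (v m))"
    by (simp add: dotp_def mat_app_def sum_distrib_right)
  also have "\<dots> = (\<Sum>n<d. \<Sum>m<d. a m n * u n * cnj (v m))"
    by (rule sum.swap)
  also have "\<dots> = dotp d u (mat_app d a v)"
    by (simp add: dotp_def mat_app_def sum_distrib_left assms mult_ac)
  finally show ?thesis .
qed

lemma dotp_cong: "(\<And>n. n < d \<Longrightarrow> u n = u' n) \<Longrightarrow> (\<And>n. n < d \<Longrightarrow> v n = v' n) \<Longrightarrow> dotp d u v = dotp d u' v'"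
  by (simp add: dotp_def)

lemma mat_app_cong: "(\<And>n. n < d \<Longrightarrow> u n = u' n) \<Longrightarrow> mat_app d a u = mat_app d a u'"
  by (auto simp: mat_app_def fun_eq_iff intro!: sum.cong)

text \<open>
  If only 0 were orthogonal to the \<open>u j\<close>, each unit vector would equal its Fourier sum, so that its
  squared norm is the sum of the squared moduli of one coordinate of the \<open>u j\<close>. Adding this up over all
  coordinates would give \<open>d = k\<close>.
\<close>

lemma exists_unit_orthogonal:
  assumes "k < d" and on: "\<And>i j. i < k \<Longrightarrow> j < k \<Longrightarrow> dotp d (u i) (u j) = (if i = j then 1 else 0)"
  obtains w where "dotp d w w = 1" "\<And>j. j < k \<Longrightarrow> dotp d w (u j) = 0"
proof -
  have "\<exists>w. dotp d w w \<noteq> 0 \<and> (\<forall>j<k. dotp d w (u j) = 0)"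
  proof (rule ccontr)
    assume "\<not> ?thesis"
    then have null: "\<And>w. (\<And>j. j < k \<Longrightarrow> dotp d w (u j) = 0) \<Longrightarrow> dotp d w w = 0" by blast
    have one: "(\<Sum>j<k. u j m * cnj (u j m)) = 1" if m: "m < d" for m
    proof -
      define r where "r n = (if n = m then 1 else 0) - (\<Sum>j<k. cnj (u j m) * u j n)" for n
      have "dotp d r (u i) = 0" if "i < k" for i
      proof -
        have "(\<Sum>j<k. cnj (u j m) * dotp d (u j) (u i)) = (\<Sum>j<k. if j = i then cnj (u j m) else 0)"
          using that by (intro sum.cong) (auto simp: on)
        then show ?thesis
          unfolding r_def[abs_def] using m that by (simp add: dotp_lin dotp_sum_left dotp_delta)
      qed
      then have "dotp d r r = 0" by (rule null)
      then have "r m = 0" using m by (simp add: dotp_self_eq_0)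
      then show ?thesis by (simp add: r_def mult.commute)
    qed
    have "of_nat d = (\<Sum>m<d. \<Sum>j<k. u j m * cnj (u j m))" by (simp add: one)
    also have "\<dots> = (\<Sum>j<k. dotp d (u j) (u j))" unfolding dotp_def by (rule sum.swap)
    also have "\<dots> = of_nat k" by (simp add: on)
    finally show False using \<open>k < d\<close> by simp
  qed
  then obtain w where w: "dotp d w w \<noteq> 0" "\<And>j. j < k \<Longrightarrow> dotp d w (u j) = 0" by blast
  define s where "s = (\<Sum>n<d. (cmod (w n))\<^sup>2)"
  have s: "dotp d w w = complex_of_real s" by (simp add: dotp_self s_def)
  have "s \<ge> 0" by (simp add: s_def sum_nonneg)
  with w(1) s have "s > 0" by (auto simp: less_le)
  have "dotp d (\<lambda>n. complex_of_real (1 / sqrt s) * w n) (\<lambda>n. complex_of_real (1 / sqrt s) * w n) = 1"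
    using \<open>s > 0\<close> by (simp only: dotp_lin s complex_cnj_complex_of_real flip: of_real_mult)
      (simp add: real_div_sqrt field_simps flip: of_real_mult)
  then show ?thesis
    by (rule that) (simp only: dotp_lin w mult_zero_right)
qed

text \<open>
  The Rayleigh quotient attains its maximum \<open>\<mu>\<close> on the unit vectors orthogonal to the eigenvectors found so
  far, by compactness. At a maximiser \<open>v\<close> the residual \<open>w = \<mu> v - A v\<close> is again orthogonal to those
  eigenvectors, so \<open>v + t w\<close> is an admissible variation for every real \<open>t\<close>; its first-order term is twice
  the squared norm of \<open>w\<close>, which must therefore vanish.
\<close>

lemma exists_hermitian_eigenvector:
  assumes herm: "\<And>m n. cnj (a m n) = a n m" and "k < d"
    and on: "\<And>i j. i < k \<Longrightarrow> j < k \<Longrightarrow> dotp d (u i) (u j) = (if i = j then 1 else 0)"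
    and eig: "\<And>j m. j < k \<Longrightarrow> m < d \<Longrightarrow> mat_app d a (u j) m = complex_of_real (l j) * u j m"
  obtains v \<mu> where "dotp d v v = 1" "\<And>j. j < k \<Longrightarrow> dotp d v (u j) = 0"
    "\<And>m. m < d \<Longrightarrow> mat_app d a v m = complex_of_real \<mu> * v m"
proof -
  \<comment> \<open>Coordinates from \<open>d\<close> onwards are set to 0 to make the unit sphere compact in the product topology.\<close>
  define K where "K = PiE UNIV (\<lambda>n. if n < d then cball 0 1 else {0 :: complex})"
  define S where "S = K \<inter> {c. dotp d c c = 1 \<and> (\<forall>j. j < k \<longrightarrow> dotp d c (u j) = 0)}"
  define R where "R c = Re (dotp d (mat_app d a c) c)" for c
  have "compactin (product_topology (\<lambda>_. euclidean) UNIV) K"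
    unfolding K_def by (subst compactin_PiE) auto
  then have "compact K" by (metis compactin_euclidean_iff euclidean_product_topology)
  moreover have "closed {c. dotp d c c = 1 \<and> (\<forall>j. j < k \<longrightarrow> dotp d c (u j) = 0)}"
    unfolding dotp_def
    by (intro closed_Collect_conj closed_Collect_all closed_Collect_imp open_Collect_const
        closed_Collect_eq continuous_intros
        continuous_on_product_coordinates)
  ultimately have "compact S" unfolding S_def by (rule compact_Int_closed)
  have unit_in_S: "\<exists>c'\<in>S. \<forall>n<d. c' n = c n"
    if "dotp d c c = 1" "\<And>j. j < k \<Longrightarrow> dotp d c (u j) = 0" for c
  proof
    define c' where "c' n = (if n < d then c n else 0)" for n
    have eq: "dotp d c' c' = dotp d c c" "dotp d c' (u j) = dotp d c (u j)" for j
      by (auto simp: c'_def intro!: dotp_cong)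
    have "cmod (c n) \<le> 1" if "n < d" for n
    proof -
      have "(cmod (c n))\<^sup>2 \<le> (\<Sum>n<d. (cmod (c n))\<^sup>2)" using that by (intro member_le_sum) auto
      also have "\<dots> = 1" using \<open>dotp d c c = 1\<close> by (metis dotp_self_Re one_complex.simps(1))
      finally show ?thesis using abs_square_le_1[of "cmod (c n)"] by simp
    qed
    then show "c' \<in> S" using that by (auto simp: S_def K_def eq) (simp_all add: c'_def)
    show "\<forall>n<d. c' n = c n" by (simp add: c'_def)
  qed
  obtain w0 where "dotp d w0 w0 = 1" "\<And>j. j < k \<Longrightarrow> dotp d w0 (u j) = 0"
    using exists_unit_orthogonal[OF \<open>k < d\<close> on] by blast
  then have "S \<noteq> {}" using unit_in_S by blast
  have "continuous_on S R" 
    unfolding R_def dotp_def mat_app_def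
    by (intro continuous_intros continuous_on_subset[OF continuous_on_product_coordinates subset_UNIV])
  with \<open>compact S\<close> \<open>S \<noteq> {}\<close> obtain v where "v \<in> S" and vmax: "\<And>c. c \<in> S \<Longrightarrow> R c \<le> R v"
    by (meson continuous_attains_sup)
  define \<mu> where "\<mu> = R v"
  have v1: "dotp d v v = 1" and vu: "\<And>j. j < k \<Longrightarrow> dotp d v (u j) = 0"
    using \<open>v \<in> S\<close> by (auto simp: S_def)
  have bound: "R c \<le> \<mu> * Re (dotp d c c)" if "\<And>j. j < k \<Longrightarrow> dotp d c (u j) = 0" for c
  proof (cases "dotp d c c = 0")
    case True
    then have "\<forall>n<d. c n = 0" by (simp add: dotp_self_eq_0)
    then have "dotp d (mat_app d a c) c = 0" by (simp add: dotp_def)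
    then show ?thesis using True by (simp add: R_def)
  next
    case False
    define s where "s = (\<Sum>n<d. (cmod (c n))\<^sup>2)"
    have s: "dotp d c c = complex_of_real s" by (simp add: dotp_self s_def)
    have "s \<ge> 0" by (simp add: s_def sum_nonneg)
    with False s have "s > 0" by (auto simp: less_le)
    define c1 where "c1 n = complex_of_real (1 / sqrt s) * c n" for n
    have sq: "complex_of_real (1 / sqrt s) * complex_of_real (1 / sqrt s) = complex_of_real (1 / s)"
      using \<open>s > 0\<close> by (simp flip: of_real_mult)
    have "dotp d c1 c1 = complex_of_real (1 / sqrt s) * complex_of_real (1 / sqrt s) * dotp d c c"
      by (simp only: c1_def[abs_def] dotp_lin complex_cnj_complex_of_real mult.assoc)
    then have "dotp d c1 c1 = 1" using \<open>s > 0\<close> by (simp only: sq s) simp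
    moreover have "dotp d c1 (u j) = 0" if "j < k" for j
      by (simp only: c1_def[abs_def] dotp_lin mult_zero_right \<open>\<And>j. j < k \<Longrightarrow> dotp d c (u j) = 0\<close> that)
    ultimately obtain c' where c': "c' \<in> S" "\<forall>n<d. c' n = c1 n" using unit_in_S by blast
    have "R c1 = R c'" unfolding R_def
      using c'(2) mat_app_cong[of d c' c1 a] by (auto intro!: arg_cong[where f=Re] dotp_cong)
    then have "R c1 \<le> \<mu>" using vmax[OF c'(1)] by (simp add: \<mu>_def)
    moreover have "dotp d (mat_app d a c1) c1 =
        complex_of_real (1 / sqrt s) * complex_of_real (1 / sqrt s) * dotp d (mat_app d a c) c"
      by (simp only: c1_def[abs_def] dotp_lin mat_app_lin complex_cnj_complex_of_real mult.assoc)
    then have "R c1 = R c / s" unfolding R_def sq by simp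
    ultimately show ?thesis using \<open>s > 0\<close> by (simp add: s field_simps)
  qed
  define w where "w m = complex_of_real \<mu> * v m - mat_app d a v m" for m
  have wu: "dotp d w (u j) = 0" if "j < k" for j
  proof -
    have "dotp d (mat_app d a v) (u j) = dotp d v (mat_app d a (u j))"
      by (rule dotp_mat_app_hermitian[OF herm])
    also have "\<dots> = dotp d v (\<lambda>m. complex_of_real (l j) * u j m)"
      by (rule dotp_cong) (simp_all add: eig that)
    also have "\<dots> = 0" by (simp add: dotp_lin vu that)
    finally show ?thesis by (simp add: w_def[abs_def] dotp_lin vu that)
  qed
  define \<beta> where "\<beta> = (\<Sum>n<d. (cmod (w n))\<^sup>2)"
  have ww: "dotp d w w = complex_of_real \<beta>" by (simp add: \<beta>_def dotp_self)
  define C where "C = \<mu> * \<beta> - R w"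
  have quad: "0 \<le> 2 * t * \<beta> + t\<^sup>2 * C" for t :: real
  proof -
    define x where "x n = v n + complex_of_real t * w n" for n
    have "R x \<le> \<mu> * Re (dotp d x x)"
      by (rule bound) (simp add: x_def[abs_def] dotp_lin vu wu)
    moreover have "Re (dotp d w v) = Re (dotp d v w)" using dotp_cnj[of d w v] by (metis cnj.sel(1))
    moreover have "Re (dotp d (mat_app d a w) v) = Re (dotp d (mat_app d a v) w)"
      using dotp_cnj[of d w "mat_app d a v"] dotp_mat_app_hermitian[of a d w v] herm
      by (metis cnj.sel(1))
    moreover have "\<mu> * Re (dotp d v w) - Re (dotp d (mat_app d a v) w) = \<beta>"
    proof -
      have "dotp d w w = complex_of_real \<mu> * dotp d v w - dotp d (mat_app d a v) w"
        by (subst (1) w_def[abs_def]) (simp add: dotp_lin)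
      then have "\<beta> = Re (complex_of_real \<mu> * dotp d v w - dotp d (mat_app d a v) w)"
        unfolding ww by (metis Re_complex_of_real)
      then show ?thesis by simp
    qed
    ultimately show ?thesis
      by (simp add: x_def[abs_def] R_def C_def \<mu>_def dotp_lin mat_app_lin v1 ww power2_eq_square algebra_simps)
  qed
  have "\<beta> \<ge> 0" by (simp add: \<beta>_def sum_nonneg)
  have "\<beta> = 0"
  proof (rule ccontr)
    assume "\<beta> \<noteq> 0"
    then have "\<beta> > 0" using \<open>\<beta> \<ge> 0\<close> by simp
    \<comment> \<open>The linear term of \<open>quad\<close> dominates for small negative \<open>t\<close>; \<open>t = - \<beta> / E\<close> is small enough.\<close>
    define E where "E = \<bar>C\<bar> + 1"
    have "E > 0" "C < E" by (auto simp: E_def)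
    have "2 * (- \<beta> / E) * \<beta> + (- \<beta> / E)\<^sup>2 * C = (\<beta>\<^sup>2 / E) * (C / E - 2)"
      using \<open>E > 0\<close> by (simp add: field_simps power2_eq_square)
    moreover have "C / E < 2" using \<open>E > 0\<close> \<open>C < E\<close> by (simp add: field_simps)
    then have "(\<beta>\<^sup>2 / E) * (C / E - 2) < 0"
      using \<open>\<beta> > 0\<close> \<open>E > 0\<close> by (intro mult_pos_neg) auto
    ultimately show False using quad[of "- \<beta> / E"] by simp
  qed
  then have "\<forall>m<d. w m = 0" using ww dotp_self_eq_0[of d w] by simp
  then have "\<And>m. m < d \<Longrightarrow> mat_app d a v m = complex_of_real \<mu> * v m" by (simp add: w_def)
  with v1 vu show ?thesis by (rule that)
qed

lemma hermitian_orthonormal_eigenvectors_aux: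
  assumes herm: "\<And>m n. cnj (a m n) = a n m" and "k \<le> d"
  shows "\<exists>u l. (\<forall>i<k. \<forall>j<k. dotp d (u i) (u j) = (if i = j then 1 else 0)) \<and>
    (\<forall>j<k. \<forall>m<d. mat_app d a (u j) m = complex_of_real (l j) * u j m)"
  using \<open>k \<le> d\<close>
proof (induction k)
  case (Suc k)
  then have "k \<le> d" by simp
  from Suc.IH[OF this] obtain u l where
    on: "\<And>i j. i < k \<Longrightarrow> j < k \<Longrightarrow> dotp d (u i) (u j) = (if i = j then 1 else 0)" and
    eig: "\<And>j m. j < k \<Longrightarrow> m < d \<Longrightarrow> mat_app d a (u j) m = complex_of_real (l j) * u j m"
    by blast
  obtain v \<mu> where v: "dotp d v v = 1" "\<And>j. j < k \<Longrightarrow> dotp d v (u j) = 0"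
    "\<And>m. m < d \<Longrightarrow> mat_app d a v m = complex_of_real \<mu> * v m"
    using exists_hermitian_eigenvector[of a k d u l] herm on eig Suc.prems Suc_le_lessD by blast
  have "dotp d (u j) v = 0" if "j < k" for j
    using dotp_cnj[of d v "u j"] v(2)[OF that] by simp
  then have "(\<forall>i<Suc k. \<forall>j<Suc k. dotp d ((u(k := v)) i) ((u(k := v)) j) = (if i = j then 1 else 0)) \<and>
    (\<forall>j<Suc k. \<forall>m<d. mat_app d a ((u(k := v)) j) m = complex_of_real ((l(k := \<mu>)) j) * (u(k := v)) j m)"
    using on eig v by (auto simp: less_Suc_eq)
  then show ?case by blast
qed simp

text \<open>
  The last property, completeness, follows by counting: the defects \<open>r m\<close> of the unit vectors have
  squared norms that are nonnegative and add up to \<open>d - d = 0\<close>.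
\<close>

theorem hermitian_orthonormal_eigenbasis:
  assumes herm: "\<And>m n. cnj (a m n) = a n m"
  obtains u l where "\<And>i j. i < d \<Longrightarrow> j < d \<Longrightarrow> dotp d (u i) (u j) = (if i = j then 1 else 0)"
    "\<And>j m. j < d \<Longrightarrow> m < d \<Longrightarrow> mat_app d a (u j) m = complex_of_real (l j) * u j m"
    "\<And>m n. m < d \<Longrightarrow> n < d \<Longrightarrow> (\<Sum>j<d. u j n * cnj (u j m)) = (if m = n then 1 else 0)"
proof -
  obtain u l where
    on: "\<And>i j. i < d \<Longrightarrow> j < d \<Longrightarrow> dotp d (u i) (u j) = (if i = j then 1 else 0)" and
    eig: "\<And>j m. j < d \<Longrightarrow> m < d \<Longrightarrow> mat_app d a (u j) m = complex_of_real (l j) * u j m"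
    using hermitian_orthonormal_eigenvectors_aux[of a d d] herm by blast
  define r where "r m n = (if n = m then 1 else 0) - (\<Sum>j<d. cnj (u j m) * u j n)" for m n
  have rr: "dotp d (r m) (r m) = 1 - (\<Sum>j<d. u j m * cnj (u j m))" if m: "m < d" for m
  proof -
    have ru: "dotp d (r m) (u i) = 0" if "i < d" for i
    proof -
      have "(\<Sum>j<d. cnj (u j m) * dotp d (u j) (u i)) = (\<Sum>j<d. if j = i then cnj (u j m) else 0)"
        using that by (intro sum.cong) (auto simp: on)
      then show ?thesis
        unfolding r_def[abs_def] using m that by (simp add: dotp_lin dotp_sum_left dotp_delta)
    qed
    have ur: "dotp d (u i) (r m) = 0" if "i < d" for i
      using dotp_cnj[of d "r m" "u i"] ru[OF that] by simp
    have "dotp d (r m) (r m) = dotp d (\<lambda>n. if n = m then 1 else 0) (r m)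
        - (\<Sum>j<d. cnj (u j m) * dotp d (u j) (r m))"
      by (subst (1) r_def[abs_def]) (simp add: dotp_lin dotp_sum_left)
    also have "\<dots> = cnj (r m m)" using m by (simp add: ur dotp_delta)
    also have "\<dots> = 1 - (\<Sum>j<d. u j m * cnj (u j m))" by (simp add: r_def)
    finally show ?thesis .
  qed
  have "(\<Sum>m<d. dotp d (r m) (r m)) = of_nat d - (\<Sum>m<d. \<Sum>j<d. u j m * cnj (u j m))"
    by (simp add: rr sum_subtractf)
  also have "(\<Sum>m<d. \<Sum>j<d. u j m * cnj (u j m)) = (\<Sum>j<d. dotp d (u j) (u j))"
    unfolding dotp_def by (rule sum.swap)
  also have "\<dots> = of_nat d" by (simp add: on)
  finally have "(\<Sum>m<d. Re (dotp d (r m) (r m))) = 0"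
    by (metis Re_sum cancel_comm_monoid_add_class.diff_cancel zero_complex.simps(1))
  then have "Re (dotp d (r m) (r m)) = 0" if "m < d" for m
    using that by (subst (asm) sum_nonneg_eq_0_iff) (auto simp: dotp_self sum_nonneg simp flip: of_real_sum of_real_power)
  then have "dotp d (r m) (r m) = 0" if "m < d" for m
    using that by (simp add: dotp_self)
  then have r0: "r m n = 0" if "m < d" "n < d" for m n
    using that by (auto simp: dotp_self_eq_0)
  then have "(\<Sum>j<d. u j n * cnj (u j m)) = (if m = n then 1 else 0)" if "m < d" "n < d" for m n
    using r0[OF that] unfolding r_def by (simp add: mult.commute eq_commute[of n m])
  with on eig show ?thesis by (rule that)
qed

section \<open>The trace of a function of a compressed Toeplitz operator\<close>

lemma inner_gauss_mult_real:
  "inner_gauss (\<lambda>z. complex_of_real (\<sigma> z) * f z) g = inner_gauss f (\<lambda>z. complex_of_real (\<sigma> z) * g z)"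
  by (simp add: inner_gauss_def mult_ac)

text \<open>
  The matrix of the compressed operator in the basis \<open>fock_basis\<close> is Hermitian because \<open>\<sigma>\<close> is real, and
  \<open>F j\<close> is the polynomial whose coefficients form its \<open>j\<close>-th eigenvector. The eigenspace of \<open>\<mu>\<close> is spanned
  by those \<open>F j\<close> whose eigenvalue is \<open>\<mu>\<close>, so summing over the spectrum and then over these \<open>j\<close> runs
  through each index once. The third property says that a reproducing kernel can be computed in any
  orthonormal basis.
\<close>

theorem toeplitz_compression_eigenbasis:
  fixes \<sigma> :: "complex \<Rightarrow> real"
  assumes \<sigma>: "\<sigma> \<in> borel_measurable gauss" and bound: "\<And>z. \<bar>\<sigma> z\<bar> \<le> B"
  obtains F :: "nat \<Rightarrow> complex \<Rightarrow> complex" and l :: "nat \<Rightarrow> real"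
  where "orthonormal_on {..N} F"
    "\<And>j k. j \<le> N \<Longrightarrow> k \<le> N \<Longrightarrow>
      inner_gauss (\<lambda>z. complex_of_real (\<sigma> z) * F j z) (F k) = (if j = k then complex_of_real (l j) else 0)"
    "\<And>z w. (\<Sum>j\<le>N. F j z * cnj (F j w)) = (\<Sum>n\<le>N. fock_basis n z * cnj (fock_basis n w))"
    "\<And>\<psi>. trace_on_poly_space N (fun_calc_on (poly_space N) \<psi>
        (compression N (toeplitz (\<lambda>z. complex_of_real (\<sigma> z))))) = (\<Sum>j\<le>N. \<psi> (l j))"
proof -
  define s where "s z = complex_of_real (\<sigma> z)" for z
  have s: "s \<in> borel_measurable gauss" "\<And>z. cmod (s z) \<le> B"
    using \<sigma> bound by (auto simp: s_def[abs_def])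
  note on = orthonormal_fock_basis[of "{..N}"]
  define a where "a m n = inner_gauss (\<lambda>z. s z * fock_basis n z) (fock_basis m)" for m n
  have herm: "cnj (a m n) = a n m" for m n
    unfolding a_def s_def inner_gauss_cnj inner_gauss_mult_real ..
  obtain u l where
    u: "\<And>i j. i < Suc N \<Longrightarrow> j < Suc N \<Longrightarrow> dotp (Suc N) (u i) (u j) = (if i = j then 1 else 0)" and
    eig: "\<And>j m. j < Suc N \<Longrightarrow> m < Suc N \<Longrightarrow> mat_app (Suc N) a (u j) m = complex_of_real (l j) * u j m" and
    compl: "\<And>m n. m < Suc N \<Longrightarrow> n < Suc N \<Longrightarrow> (\<Sum>j<Suc N. u j n * cnj (u j m)) = (if m = n then 1 else 0)"
    using hermitian_orthonormal_eigenbasis[of a "Suc N"] herm by blast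
  define F where "F j = (\<lambda>z. \<Sum>n\<le>N. u j n * fock_basis n z)" for j
  have FL2: "F j \<in> L2_gauss" for j unfolding F_def by (intro L2_sum L2_scale fock_basis_L2)
  have sL2: "(\<lambda>z. s z * f z) \<in> L2_gauss" if "f \<in> L2_gauss" for f by (rule L2_mult_bounded[OF that s])
  have Fe: "inner_gauss (F j) (fock_basis n) = u j n" if "n \<le> N" for j n
    unfolding F_def using inner_combination[OF on] that by simp
  have eF: "inner_gauss (fock_basis n) (F j) = cnj (u j n)" if "n \<le> N" for j n
    using Fe[OF that] inner_gauss_cnj by metis
  have FF: "inner_gauss (F j) (F k) = (if j = k then 1 else 0)" if "j \<le> N" "k \<le> N" for j k
  proof -
    have "inner_gauss (F j) (F k) = (\<Sum>n\<le>N. cnj (u k n) * inner_gauss (F j) (fock_basis n))"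
      by (subst (2) F_def) (intro inner_gauss_sum_right fock_basis_L2 FL2)
    also have "\<dots> = dotp (Suc N) (u j) (u k)"
      unfolding dotp_def lessThan_Suc_atMost by (intro sum.cong) (auto simp: Fe)
    finally show ?thesis using u[of j k] that by simp
  qed
  then have onF: "orthonormal_on {..N} F" by (simp add: orthonormal_on_def FL2)
  have sFe: "inner_gauss (\<lambda>z. s z * F j z) (fock_basis m) = complex_of_real (l j) * u j m"
    if "j \<le> N" "m \<le> N" for j m
  proof -
    have "(\<lambda>z. s z * F j z) = (\<lambda>z. \<Sum>n\<le>N. u j n * (s z * fock_basis n z))"
      by (simp add: F_def sum_distrib_left mult_ac)
    then have "inner_gauss (\<lambda>z. s z * F j z) (fock_basis m) = (\<Sum>n\<le>N. u j n * a m n)"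
      unfolding a_def by (simp only:) (intro inner_gauss_sum sL2 fock_basis_L2)
    also have "\<dots> = mat_app (Suc N) a (u j) m"
      by (simp add: mat_app_def lessThan_Suc_atMost mult.commute)
    finally show ?thesis using eig that by simp
  qed
  have sFF: "inner_gauss (\<lambda>z. s z * F j z) (F k) = (if j = k then complex_of_real (l j) else 0)"
    if "j \<le> N" "k \<le> N" for j k
  proof -
    have "inner_gauss (\<lambda>z. s z * F j z) (F k) = (\<Sum>m\<le>N. cnj (u k m) * inner_gauss (\<lambda>z. s z * F j z) (fock_basis m))"
      by (subst (2) F_def) (intro inner_gauss_sum_right fock_basis_L2 FL2 sL2)
    also have "\<dots> = complex_of_real (l j) * dotp (Suc N) (u j) (u k)"
      unfolding dotp_def lessThan_Suc_atMost sum_distrib_left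
      by (intro sum.cong) (auto simp: sFe that)
    finally show ?thesis using u[of j k] that by simp
  qed
  have eq_e: "fock_basis n z = (\<Sum>j\<le>N. cnj (u j n) * F j z)" if "n \<le> N" for n z
  proof -
    have "(\<Sum>j\<le>N. cnj (u j n) * F j z) = (\<Sum>j\<le>N. \<Sum>m\<le>N. (u j m * cnj (u j n)) * fock_basis m z)"
      by (simp add: F_def sum_distrib_left mult_ac)
    also have "\<dots> = (\<Sum>m\<le>N. (\<Sum>j\<le>N. u j m * cnj (u j n)) * fock_basis m z)"
      unfolding sum_distrib_right by (rule sum.swap)
    also have "\<dots> = (\<Sum>m\<le>N. if m = n then fock_basis n z else 0)"
      using compl that unfolding lessThan_Suc_atMost by (intro sum.cong) auto
    finally show ?thesis using that by simp
  qed
  have span: "poly_space N = span_of {..N} F"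
  proof (intro equalityI subsetI)
    fix f assume "f \<in> poly_space N"
    then obtain c where c: "f = (\<lambda>z. \<Sum>n\<le>N. c n * fock_basis n z)"
      by (auto simp: poly_space_eq_span span_of_def)
    have "f = (\<lambda>z. \<Sum>j\<le>N. (\<Sum>n\<le>N. c n * cnj (u j n)) * F j z)"
    proof
      fix z
      have "f z = (\<Sum>n\<le>N. \<Sum>j\<le>N. c n * cnj (u j n) * F j z)"
        unfolding c by (intro sum.cong) (auto simp: eq_e sum_distrib_left mult.assoc)
      also have "\<dots> = (\<Sum>j\<le>N. (\<Sum>n\<le>N. c n * cnj (u j n)) * F j z)"
        unfolding sum_distrib_right by (rule sum.swap)
      finally show "f z = \<dots>" .
    qed
    then show "f \<in> span_of {..N} F" by (auto simp: span_of_def)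
  next
    fix f assume "f \<in> span_of {..N} F"
    then obtain c where c: "f = (\<lambda>z. \<Sum>j\<le>N. c j * F j z)" by (auto simp: span_of_def)
    have "f = (\<lambda>z. \<Sum>n\<le>N. (\<Sum>j\<le>N. c j * u j n) * fock_basis n z)"
    proof
      fix z
      have "f z = (\<Sum>j\<le>N. \<Sum>n\<le>N. c j * u j n * fock_basis n z)"
        unfolding c F_def by (simp add: sum_distrib_left mult.assoc)
      also have "\<dots> = (\<Sum>n\<le>N. (\<Sum>j\<le>N. c j * u j n) * fock_basis n z)"
        unfolding sum_distrib_right by (rule sum.swap)
      finally show "f z = \<dots>" .
    qed
    then show "f \<in> poly_space N" by (auto simp: poly_space_eq_span span_of_def)
  qed
  define A where "A = compression N (toeplitz s)"
  have A: "A (\<lambda>z. \<Sum>j\<le>N. x j * F j z) = (\<lambda>z. \<Sum>j\<le>N. (x j * complex_of_real (l j)) * F j z)" for x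
  proof -
    let ?f = "\<lambda>z. \<Sum>j\<le>N. x j * F j z"
    have "?f \<in> poly_space N" unfolding span by (rule span_ofI)
    then have "A ?f = (\<lambda>z. \<Sum>n\<le>N. inner_gauss (\<lambda>z. s z * ?f z) (fock_basis n) * fock_basis n z)"
      unfolding A_def by (rule compression_toeplitz[OF s])
    also have "\<dots> = (\<lambda>z. \<Sum>n\<le>N. (\<Sum>j\<le>N. x j * (complex_of_real (l j) * u j n)) * fock_basis n z)"
    proof (intro ext sum.cong refl)
      fix z n assume n: "n \<in> {..N}"
      have "(\<lambda>z. s z * ?f z) = (\<lambda>z. \<Sum>j\<le>N. x j * (s z * F j z))"
        by (simp add: sum_distrib_left mult_ac)
      then have "inner_gauss (\<lambda>z. s z * ?f z) (fock_basis n) = (\<Sum>j\<le>N. x j * inner_gauss (\<lambda>z. s z * F j z) (fock_basis n))"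
        by (simp only:) (intro inner_gauss_sum sL2 fock_basis_L2 FL2)
      also have "\<dots> = (\<Sum>j\<le>N. x j * (complex_of_real (l j) * u j n))"
        using n by (intro sum.cong) (auto simp: sFe)
      finally show "inner_gauss (\<lambda>z. s z * ?f z) (fock_basis n) * fock_basis n z
        = (\<Sum>j\<le>N. x j * (complex_of_real (l j) * u j n)) * fock_basis n z" by simp
    qed
    also have "\<dots> = (\<lambda>z. \<Sum>j\<le>N. (x j * complex_of_real (l j)) * F j z)"
      unfolding F_def sum_distrib_left sum_distrib_right by (subst sum.swap) (simp add: mult_ac)
    finally show ?thesis .
  qed
  define J where "J \<mu> = {j \<in> {..N}. l j = \<mu>}" for \<mu>
  have onJ: "orthonormal_on (J \<mu>) F" for \<mu> using onF by (auto simp: orthonormal_on_def J_def)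
  have finJ: "finite (J \<mu>)" for \<mu> by (simp add: J_def)
  have eigsp: "eigenspace_on (poly_space N) A \<mu> = span_of (J \<mu>) F" for \<mu>
  proof (intro equalityI subsetI)
    fix f assume "f \<in> eigenspace_on (poly_space N) A \<mu>"
    then have f: "f \<in> span_of {..N} F" and Af: "A f = (\<lambda>z. complex_of_real \<mu> * f z)"
      by (auto simp: eigenspace_on_def span)
    then obtain x where x: "f = (\<lambda>z. \<Sum>j\<le>N. x j * F j z)" by (auto simp: span_of_def)
    have zero: "x k = 0" if "k \<le> N" "l k \<noteq> \<mu>" for k
    proof -
      have "inner_gauss (A f) (F k) = x k * complex_of_real (l k)"
        unfolding x A using inner_combination[OF onF, of k "\<lambda>j. x j * complex_of_real (l j)"] that by simp
      moreover have "inner_gauss (A f) (F k) = complex_of_real \<mu> * x k"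
      proof -
        have "inner_gauss f (F k) = x k"
          unfolding x using inner_combination[OF onF, of k x] that by simp
        then show ?thesis unfolding Af inner_gauss_scale by simp
      qed
      ultimately show ?thesis using that(2) by simp
    qed
    have "f = (\<lambda>z. \<Sum>j\<in>J \<mu>. x j * F j z)"
      unfolding x J_def using zero by (intro ext sum.mono_neutral_right) auto
    then show "f \<in> span_of (J \<mu>) F" by (auto simp: span_of_def)
  next
    fix f assume "f \<in> span_of (J \<mu>) F"
    then obtain x where x: "f = (\<lambda>z. \<Sum>j\<in>J \<mu>. x j * F j z)" by (auto simp: span_of_def)
    define y where "y j = (if l j = \<mu> then x j else 0)" for j
    have fy: "f = (\<lambda>z. \<Sum>j\<le>N. y j * F j z)"
      unfolding x J_def y_def by (intro ext sum.mono_neutral_cong_left) auto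
    have "A f = (\<lambda>z. complex_of_real \<mu> * f z)"
      unfolding fy A sum_distrib_left y_def by (intro ext sum.cong) auto
    moreover have "f \<in> poly_space N" unfolding fy span by (rule span_ofI)
    ultimately show "f \<in> eigenspace_on (poly_space N) A \<mu>" by (simp add: eigenspace_on_def)
  qed
  have spec: "spectrum_on (poly_space N) A = l ` {..N}"
  proof (intro equalityI subsetI)
    fix \<mu> assume "\<mu> \<in> spectrum_on (poly_space N) A"
    then obtain f where "f \<in> span_of (J \<mu>) F" "f \<noteq> (\<lambda>z. 0)"
      by (auto simp: spectrum_on_def eigsp)
    then have "J \<mu> \<noteq> {}" by (auto simp: span_of_def)
    then show "\<mu> \<in> l ` {..N}" by (auto simp: J_def)
  next
    fix \<mu> assume "\<mu> \<in> l ` {..N}"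
    then obtain k where k: "k \<in> J \<mu>" "k \<le> N" by (auto simp: J_def)
    have "F k = (\<lambda>z. \<Sum>j\<in>J \<mu>. (if j = k then 1 else 0) * F j z)"
      using k finJ by (auto simp: if_distrib[where f="\<lambda>x. x * _"] cong: if_cong)
    then have "F k \<in> span_of (J \<mu>) F" by (auto simp: span_of_def)
    moreover have "F k \<noteq> (\<lambda>z. 0)"
    proof
      assume "F k = (\<lambda>z. 0)"
      then have "inner_gauss (F k) (F k) = 0" by simp
      then show False using FF[of k k] k by simp
    qed
    ultimately show "\<mu> \<in> spectrum_on (poly_space N) A" by (auto simp: spectrum_on_def eigsp)
  qed
  have calc: "fun_calc_on (poly_space N) \<psi> A f = (\<lambda>z. \<Sum>j\<le>N. (\<psi> (l j) * inner_gauss f (F j)) * F j z)"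
    if "f \<in> L2_gauss" for f \<psi>
  proof
    fix z
    have "fun_calc_on (poly_space N) \<psi> A f z
        = (\<Sum>\<mu>\<in>l ` {..N}. \<psi> \<mu> * (\<Sum>j\<in>J \<mu>. inner_gauss f (F j) * F j z))"
      by (simp add: fun_calc_on_def spec eigsp orth_proj_span_of[OF onJ finJ that])
    also have "\<dots> = (\<Sum>\<mu>\<in>l ` {..N}. \<Sum>j\<in>J \<mu>. (\<psi> (l j) * inner_gauss f (F j)) * F j z)"
      unfolding sum_distrib_left by (intro sum.cong) (auto simp: J_def)
    also have "\<dots> = (\<Sum>j\<le>N. (\<psi> (l j) * inner_gauss f (F j)) * F j z)"
      unfolding J_def by (rule sum.image_gen[symmetric]) simp
    finally show "fun_calc_on (poly_space N) \<psi> A f z = \<dots>" .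
  qed
  have trace: "trace_on_poly_space N (fun_calc_on (poly_space N) \<psi> A) = (\<Sum>j\<le>N. \<psi> (l j))" for \<psi>
  proof -
    have "trace_on_poly_space N (fun_calc_on (poly_space N) \<psi> A)
        = (\<Sum>n\<le>N. \<Sum>j\<le>N. \<psi> (l j) * inner_gauss (fock_basis n) (F j) * inner_gauss (F j) (fock_basis n))"
      unfolding trace_on_poly_space_def
      by (intro sum.cong refl, subst calc[OF fock_basis_L2])
        (intro inner_gauss_sum FL2 fock_basis_L2)
    also have "\<dots> = (\<Sum>n\<le>N. \<Sum>j\<le>N. \<psi> (l j) * (u j n * cnj (u j n)))"
      by (intro sum.cong refl) (simp add: Fe eF mult_ac)
    also have "\<dots> = (\<Sum>j\<le>N. \<psi> (l j) * dotp (Suc N) (u j) (u j))"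
      unfolding dotp_def lessThan_Suc_atMost sum_distrib_left by (rule sum.swap)
    also have "\<dots> = (\<Sum>j\<le>N. \<psi> (l j))" using u by (intro sum.cong) auto
    finally show ?thesis .
  qed
  have kern: "(\<Sum>j\<le>N. F j z * cnj (F j w)) = (\<Sum>n\<le>N. fock_basis n z * cnj (fock_basis n w))" for z w
  proof -
    have "(\<Sum>n\<le>N. fock_basis n z * cnj (fock_basis n w))
        = (\<Sum>n\<le>N. \<Sum>j\<le>N. cnj (u j n) * F j z * cnj (fock_basis n w))"
      by (intro sum.cong refl) (simp add: eq_e[of _ z] sum_distrib_right)
    also have "\<dots> = (\<Sum>j\<le>N. \<Sum>n\<le>N. cnj (u j n) * F j z * cnj (fock_basis n w))"
      by (rule sum.swap)
    also have "\<dots> = (\<Sum>j\<le>N. F j z * cnj (F j w))"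
      unfolding F_def[of _] by (intro sum.cong refl) (simp add: F_def sum_distrib_left mult_ac)
    finally show ?thesis by simp
  qed
  show ?thesis
    using onF sFF kern trace by (intro that[of F l]) (simp_all add: s_def[abs_def] A_def)
qed

section \<open>The polynomial kernel and the spread of the eigenvalues\<close>

interpretation gauss2: pair_sigma_finite gauss gauss
  by unfold_locales

abbreviation gauss2 :: "(complex \<times> complex) measure" where "gauss2 \<equiv> gauss \<Otimes>\<^sub>M gauss"

lemma
  fixes f g :: "complex \<Rightarrow> complex"
  assumes f: "integrable gauss f" and g: "integrable gauss g"
  shows integrable_gauss2_product: "integrable gauss2 (\<lambda>p. f (fst p) * g (snd p))"
    and integral_gauss2_product:
      "(LINT p|gauss2. f (fst p) * g (snd p)) = (LINT z|gauss. f z) * (LINT z|gauss. g z)"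
proof -
  note [measurable] = borel_measurable_integrable[OF f] borel_measurable_integrable[OF g]
  show int: "integrable gauss2 (\<lambda>p. f (fst p) * g (snd p))"
  proof (rule gauss2.Fubini_integrable)
    show "(\<lambda>p. f (fst p) * g (snd p)) \<in> borel_measurable gauss2" by measurable
    show "integrable gauss (\<lambda>x. LINT y|gauss. norm (f (fst (x, y)) * g (snd (x, y))))"
      using f g by (simp add: norm_mult)
    show "AE x in gauss. integrable gauss (\<lambda>y. f (fst (x, y)) * g (snd (x, y)))"
      using g by simp
  qed
  show "(LINT p|gauss2. f (fst p) * g (snd p)) = (LINT z|gauss. f z) * (LINT z|gauss. g z)"
    unfolding gauss2.integral_fst'[OF int, symmetric] by simp
qed

definition fock_kernel :: "nat \<Rightarrow> complex \<Rightarrow> complex \<Rightarrow> complex" where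
  "fock_kernel N z w = (\<Sum>n\<le>N. fock_basis n z * cnj (fock_basis n w))"

definition kernel_weight :: "nat \<Rightarrow> complex \<times> complex \<Rightarrow> real" where
  "kernel_weight N p = (cmod (fock_kernel N (fst p) (snd p)))\<^sup>2"

definition fock_density :: "nat \<Rightarrow> complex \<Rightarrow> real" where
  "fock_density N z = (\<Sum>n\<le>N. (cmod (fock_basis n z))\<^sup>2)"

text \<open>
  The squared modulus of the kernel is a finite sum of products of a function of \<open>z\<close> and a function of \<open>w\<close>.
  The expansion may use any orthonormal basis \<open>G\<close> that represents the kernel: monomials serve for
  \<open>integral_kernel_dist\<close>, eigenfunctions for \<open>eigenvalue_variance\<close>.
\<close>

lemma
  fixes f g :: "complex \<Rightarrow> complex"
  assumes K: "\<And>z w. fock_kernel N z w = (\<Sum>j\<le>N. G j z * cnj (G j w))"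
    and f: "\<And>j k. integrable gauss (\<lambda>z. f z * G j z * cnj (G k z))"
    and g: "\<And>j k. integrable gauss (\<lambda>z. g z * G j z * cnj (G k z))"
  shows integrable_kernel_product:
      "integrable gauss2 (\<lambda>p. f (fst p) * g (snd p) * complex_of_real (kernel_weight N p))"
    and integral_kernel_product:
      "(LINT p|gauss2. f (fst p) * g (snd p) * complex_of_real (kernel_weight N p))
        = (\<Sum>j\<le>N. \<Sum>k\<le>N. (LINT z|gauss. f z * G j z * cnj (G k z)) * (LINT z|gauss. g z * G k z * cnj (G j z)))"
proof -
  have eq: "f (fst p) * g (snd p) * complex_of_real (kernel_weight N p)
      = (\<Sum>j\<le>N. \<Sum>k\<le>N. (f (fst p) * G j (fst p) * cnj (G k (fst p))) * (g (snd p) * G k (snd p) * cnj (G j (snd p))))" for p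
  proof -
    have kw: "complex_of_real (kernel_weight N p)
        = (\<Sum>j\<le>N. G j (fst p) * cnj (G j (snd p))) * (\<Sum>k\<le>N. cnj (G k (fst p)) * G k (snd p))"
      unfolding kernel_weight_def complex_norm_square K by simp
    show ?thesis unfolding kw sum_product by (simp add: sum_distrib_left mult_ac)
  qed
  note int = integrable_gauss2_product[OF f g] and val = integral_gauss2_product[OF f g]
  show "integrable gauss2 (\<lambda>p. f (fst p) * g (snd p) * complex_of_real (kernel_weight N p))"
    unfolding eq by (intro Bochner_Integration.integrable_sum int)
  show "(LINT p|gauss2. f (fst p) * g (snd p) * complex_of_real (kernel_weight N p))
        = (\<Sum>j\<le>N. \<Sum>k\<le>N. (LINT z|gauss. f z * G j z * cnj (G k z)) * (LINT z|gauss. g z * G k z * cnj (G j z)))"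
    unfolding eq using int
    by (simp add: Bochner_Integration.integral_sum Bochner_Integration.integrable_sum val)
qed

lemma integrable_bounded_mult_L2:
  fixes f :: "complex \<Rightarrow> complex"
  assumes "f \<in> borel_measurable gauss" "\<And>z. cmod (f z) \<le> B" "g \<in> L2_gauss" "h \<in> L2_gauss"
  shows "integrable gauss (\<lambda>z. f z * g z * cnj (h z))"
  using L2_integrable_mult[OF L2_mult_bounded[OF assms(3,1,2)] assms(4)] .

lemma integrable_bounded_norm_square:
  fixes f :: "complex \<Rightarrow> real"
  assumes "f \<in> borel_measurable gauss" "\<And>z. \<bar>f z\<bar> \<le> B" "g \<in> L2_gauss"
  shows "integrable gauss (\<lambda>z. f z * (cmod (g z))\<^sup>2)"
proof -
  have "integrable gauss (\<lambda>z. complex_of_real (f z) * g z * cnj (g z))"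
    by (rule integrable_bounded_mult_L2[where B=B]) (use assms in auto)
  also have "(\<lambda>z. complex_of_real (f z) * g z * cnj (g z)) = (\<lambda>z. complex_of_real (f z * (cmod (g z))\<^sup>2))"
    by (simp only: of_real_mult complex_norm_square mult.assoc)
  finally show ?thesis unfolding complex_of_real_integrable_eq .
qed

lemma inner_gauss_weighted_self:
  "inner_gauss (\<lambda>z. complex_of_real (f z) * g z) g = complex_of_real (LINT z|gauss. f z * (cmod (g z))\<^sup>2)"
  unfolding inner_gauss_def integral_complex_of_real[symmetric]
  by (simp only: of_real_mult complex_norm_square mult.assoc)

lemma fock_density_eq: "complex_of_real (fock_density N z) = (\<Sum>n\<le>N. fock_basis n z * cnj (fock_basis n z))"
  by (simp add: fock_density_def complex_norm_square flip: of_real_power)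

lemma fock_density_nonneg: "fock_density N z \<ge> 0"
  by (simp add: fock_density_def sum_nonneg)

lemma integrable_fock_density: "integrable gauss (fock_density N)"
  unfolding fock_density_def[abs_def]
  by (intro Bochner_Integration.integrable_sum L2_gaussD fock_basis_L2)

lemma integral_fock_density: "(LINT z|gauss. fock_density N z) = real (N + 1)"
proof -
  have "l2sq (fock_basis n) = 1" for n
    by (rule orthonormal_on_l2sq[OF orthonormal_fock_basis UNIV_I])
  then show ?thesis
    unfolding fock_density_def[abs_def] using L2_gaussD(2)[OF fock_basis_L2]
    by (subst Bochner_Integration.integral_sum) (auto simp: l2sq_def)
qed

lemma integrable_bounded_fock_density:
  fixes f :: "complex \<Rightarrow> 'a::{banach, second_countable_topology, real_normed_field}"
  assumes "f \<in> borel_measurable gauss" "\<And>z. norm (f z) \<le> B"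
  shows "integrable gauss (\<lambda>z. f z * of_real (fock_density N z))"
proof (rule Bochner_Integration.integrable_bound)
  note [measurable] = assms(1) borel_measurable_integrable[OF integrable_fock_density]
  show "integrable gauss (\<lambda>z. B * fock_density N z)" using integrable_fock_density by auto
  show "(\<lambda>z. f z * of_real (fock_density N z)) \<in> borel_measurable gauss" by measurable
  show "AE z in gauss. norm (f z * of_real (fock_density N z)) \<le> norm (B * fock_density N z)"
    using assms(2) order_trans[OF norm_ge_zero assms(2)]
    by (auto simp: norm_mult fock_density_nonneg intro!: mult_right_mono)
qed

lemma kernel_basis: "fock_kernel N z w = (\<Sum>j\<le>N. fock_basis j z * cnj (fock_basis j w))"
  by (simp add: fock_kernel_def)

text \<open>
  When one of the two factors is 1, orthonormality leaves only the diagonal terms of the expansion.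
\<close>

lemma
  fixes f :: "complex \<Rightarrow> real"
  assumes f: "f \<in> borel_measurable gauss" and bound: "\<And>z. \<bar>f z\<bar> \<le> B"
  shows integrable_kernel_fst: "integrable gauss2 (\<lambda>p. f (fst p) * kernel_weight N p)"
    and integrable_kernel_snd: "integrable gauss2 (\<lambda>p. f (snd p) * kernel_weight N p)"
    and integral_kernel_fst: "(LINT p|gauss2. f (fst p) * kernel_weight N p)
      = (LINT z|gauss. f z * fock_density N z)"
    and integral_kernel_snd: "(LINT p|gauss2. f (snd p) * kernel_weight N p)
      = (LINT z|gauss. f z * fock_density N z)"
proof -
  define c where "c z = complex_of_real (f z)" for z
  have c: "integrable gauss (\<lambda>z. c z * fock_basis j z * cnj (fock_basis k z))" for j k
    by (rule integrable_bounded_mult_L2[where B=B]) (use f bound in \<open>auto simp: c_def[abs_def] fock_basis_L2\<close>)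
  have one: "integrable gauss (\<lambda>z. 1 * fock_basis j z * cnj (fock_basis k z))" for j k
    using L2_integrable_mult[OF fock_basis_L2 fock_basis_L2] by simp
  have delta: "(LINT z|gauss. 1 * fock_basis j z * cnj (fock_basis k z)) = (if j = k then 1 else 0)" for j k
    using orthonormal_onD(2)[OF orthonormal_fock_basis[of UNIV], of j k] by (simp add: inner_gauss_def)
  have diag: "(\<Sum>j\<le>N. LINT z|gauss. c z * fock_basis j z * cnj (fock_basis j z))
      = complex_of_real (LINT z|gauss. f z * fock_density N z)"
  proof -
    have "(\<Sum>j\<le>N. LINT z|gauss. c z * fock_basis j z * cnj (fock_basis j z))
        = (LINT z|gauss. (\<Sum>j\<le>N. c z * fock_basis j z * cnj (fock_basis j z)))"
      using c by (intro Bochner_Integration.integral_sum[symmetric]) auto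
    also have "\<dots> = (LINT z|gauss. complex_of_real (f z * fock_density N z))"
      by (simp add: fock_density_eq c_def sum_distrib_left mult.assoc)
    finally show ?thesis by (simp only: integral_complex_of_real)
  qed
  have e1: "c (fst p) * 1 * complex_of_real (kernel_weight N p)
      = complex_of_real (f (fst p) * kernel_weight N p)"
    and e2: "1 * c (snd p) * complex_of_real (kernel_weight N p)
      = complex_of_real (f (snd p) * kernel_weight N p)" for p
    by (simp_all add: c_def)
  show "integrable gauss2 (\<lambda>p. f (fst p) * kernel_weight N p)"
    using integrable_kernel_product[OF kernel_basis c one, of N] unfolding e1 complex_of_real_integrable_eq .
  show "integrable gauss2 (\<lambda>p. f (snd p) * kernel_weight N p)"
    using integrable_kernel_product[OF kernel_basis one c, of N] unfolding e2 complex_of_real_integrable_eq .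
  have "complex_of_real (LINT p|gauss2. f (fst p) * kernel_weight N p)
      = complex_of_real (LINT z|gauss. f z * fock_density N z)"
    using integral_kernel_product[OF kernel_basis c one, of N]
    unfolding e1 integral_complex_of_real delta diag[symmetric]
    by (simp add: if_distrib[where f="\<lambda>x. _ * x"] cong: if_cong)
  then show "(LINT p|gauss2. f (fst p) * kernel_weight N p)
      = (LINT z|gauss. f z * fock_density N z)" by (simp only: of_real_eq_iff)
  have "complex_of_real (LINT p|gauss2. f (snd p) * kernel_weight N p)
      = complex_of_real (LINT z|gauss. f z * fock_density N z)"
    using integral_kernel_product[OF kernel_basis one c, of N]
    unfolding e2 integral_complex_of_real delta diag[symmetric]
    by (simp add: if_distrib[where f="\<lambda>x. x * _"] cong: if_cong)
  then show "(LINT p|gauss2. f (snd p) * kernel_weight N p)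
      = (LINT z|gauss. f z * fock_density N z)" by (simp only: of_real_eq_iff)
qed

lemma z_fock_basis: "z * fock_basis n z = complex_of_real (sqrt (real n + 1)) * fock_basis (Suc n) z"
  by (simp add: fock_basis_def real_sqrt_mult add.commute)

text \<open>
  Expanding \<open>|z - w|\<^sup>2\<close> leads to matrix elements of multiplication by \<open>z\<close>, a weighted shift with
  weights \<open>sqrt (j + 1)\<close>. The square terms contribute \<open>2 * (\<Sum>j\<le>N. j + 1)\<close> and the mixed terms
  \<open>- 2 * (\<Sum>j<N. j + 1)\<close>, since the shift leads out of the polynomial space only at \<open>j = N\<close>. The sums
  cancel up to the boundary term, so the value is of the order of the total mass of the kernel weight.
\<close>

lemma
  shows integrable_kernel_dist: "integrable gauss2 (\<lambda>p. (cmod (fst p - snd p))\<^sup>2 * kernel_weight N p)"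
    and integral_kernel_dist: "(LINT p|gauss2. (cmod (fst p - snd p))\<^sup>2 * kernel_weight N p)
      = 2 * real (N + 1)"
proof -
  let ?e = fock_basis
  define K where "K p = complex_of_real (kernel_weight N p)" for p
  define r where "r n = complex_of_real (sqrt (real n + 1))" for n
  have on: "inner_gauss (?e i) (?e j) = (if i = j then 1 else 0)" for i j
    using orthonormal_onD(2)[OF orthonormal_fock_basis[of UNIV], of i j] by simp
  have zL2: "(\<lambda>z. z * ?e n z) \<in> L2_gauss" for n
    unfolding z_fock_basis by (intro L2_scale fock_basis_L2)
  have sq: "(z * cnj z) * ?e j z * cnj (?e k z) = (z * ?e j z) * cnj (z * ?e k z)" for z j k by simp
  have one: "integrable gauss (\<lambda>z. 1 * ?e j z * cnj (?e k z))" for j k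
    using L2_integrable_mult[OF fock_basis_L2 fock_basis_L2] by simp
  have iz: "integrable gauss (\<lambda>z. z * ?e j z * cnj (?e k z))" for j k
    by (rule L2_integrable_mult[OF zL2 fock_basis_L2])
  have cz: "cnj z * ?e j z * cnj (?e k z) = ?e j z * cnj (z * ?e k z)" for z j k by simp
  have icz: "integrable gauss (\<lambda>z. cnj z * ?e j z * cnj (?e k z))" for j k
    unfolding cz by (rule L2_integrable_mult[OF fock_basis_L2 zL2])
  have izz: "integrable gauss (\<lambda>z. (z * cnj z) * ?e j z * cnj (?e k z))" for j k
    unfolding sq by (rule L2_integrable_mult[OF zL2 zL2])
  have v1: "(LINT z|gauss. 1 * ?e j z * cnj (?e k z)) = (if j = k then 1 else 0)" for j k
    using on by (simp add: inner_gauss_def)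
  have vz: "(LINT z|gauss. z * ?e j z * cnj (?e k z)) = (if Suc j = k then r j else 0)" for j k
  proof -
    have "(LINT z|gauss. z * ?e j z * cnj (?e k z)) = inner_gauss (\<lambda>z. r j * ?e (Suc j) z) (?e k)"
      unfolding inner_gauss_def z_fock_basis r_def ..
    then show ?thesis by (simp add: inner_gauss_scale on)
  qed
  have vcz: "(LINT z|gauss. cnj z * ?e j z * cnj (?e k z)) = (if j = Suc k then r k else 0)" for j k
  proof -
    have "(LINT z|gauss. cnj z * ?e j z * cnj (?e k z)) = inner_gauss (?e j) (\<lambda>z. r k * ?e (Suc k) z)"
      unfolding inner_gauss_def cz z_fock_basis r_def ..
    also have "\<dots> = cnj (r k) * inner_gauss (?e j) (?e (Suc k))"
      unfolding inner_gauss_cnj[of "\<lambda>z. r k * ?e (Suc k) z", symmetric] inner_gauss_scale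
      by (simp add: inner_gauss_cnj)
    finally show ?thesis by (simp add: on r_def)
  qed
  have rr: "r j * r j = of_nat (Suc j)" for j
    unfolding r_def by (simp flip: of_real_mult)
  have vzz: "(LINT z|gauss. (z * cnj z) * ?e j z * cnj (?e j z)) = of_nat (Suc j)" for j
  proof -
    have "(LINT z|gauss. (z * cnj z) * ?e j z * cnj (?e j z))
        = inner_gauss (\<lambda>z. r j * ?e (Suc j) z) (\<lambda>z. r j * ?e (Suc j) z)"
      unfolding inner_gauss_def sq z_fock_basis r_def ..
    also have "\<dots> = r j * (cnj (r j) * inner_gauss (?e (Suc j)) (?e (Suc j)))"
      unfolding inner_gauss_scale
      unfolding inner_gauss_cnj[of "\<lambda>z. r j * ?e (Suc j) z", symmetric] inner_gauss_scale
      by (simp add: inner_gauss_cnj)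
    finally show ?thesis using rr[of j] by (simp add: on r_def)
  qed
  note I1 = integrable_kernel_product[OF kernel_basis izz one, of N, folded K_def]
    and I2 = integrable_kernel_product[OF kernel_basis one izz, of N, folded K_def]
    and I3 = integrable_kernel_product[OF kernel_basis iz icz, of N, folded K_def]
    and I4 = integrable_kernel_product[OF kernel_basis icz iz, of N, folded K_def]
  have eq: "complex_of_real ((cmod (fst p - snd p))\<^sup>2 * kernel_weight N p)
      = (fst p * cnj (fst p)) * 1 * K p + 1 * (snd p * cnj (snd p)) * K p
        - fst p * cnj (snd p) * K p - cnj (fst p) * snd p * K p" for p
    unfolding of_real_mult K_def[symmetric] complex_norm_square[of "fst p - snd p"]
    by (simp add: algebra_simps)
  have "integrable gauss2 (\<lambda>p. complex_of_real ((cmod (fst p - snd p))\<^sup>2 * kernel_weight N p))"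
    unfolding eq by (intro Bochner_Integration.integrable_add Bochner_Integration.integrable_diff I1 I2 I3 I4)
  then show "integrable gauss2 (\<lambda>p. (cmod (fst p - snd p))\<^sup>2 * kernel_weight N p)"
    unfolding complex_of_real_integrable_eq .
  have S: "(\<Sum>j\<le>N. if j < N then of_nat (Suc j) else 0) = (\<Sum>j<N. of_nat (Suc j) :: complex)"
    by (rule sum.mono_neutral_cong_right) auto
  have V1: "(LINT p|gauss2. (fst p * cnj (fst p)) * 1 * K p) = (\<Sum>j\<le>N. of_nat (Suc j))"
    unfolding K_def integral_kernel_product[OF kernel_basis izz one] v1
    by (simp add: if_distrib[where f="\<lambda>x. _ * x"] vzz cong: if_cong)
  have V2: "(LINT p|gauss2. 1 * (snd p * cnj (snd p)) * K p) = (\<Sum>j\<le>N. of_nat (Suc j))"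
    unfolding K_def integral_kernel_product[OF kernel_basis one izz] v1
    by (simp add: if_distrib[where f="\<lambda>x. x * _"] vzz cong: if_cong)
  have V3: "(LINT p|gauss2. fst p * cnj (snd p) * K p) = (\<Sum>j<N. of_nat (Suc j))"
  proof -
    have "(LINT p|gauss2. fst p * cnj (snd p) * K p)
        = (\<Sum>j\<le>N. \<Sum>k\<le>N. if k = Suc j then of_nat (Suc j) else 0)"
      unfolding K_def integral_kernel_product[OF kernel_basis iz icz] vz vcz
      by (intro sum.cong refl) (auto simp: rr)
    also have "\<dots> = (\<Sum>j\<le>N. if j < N then of_nat (Suc j) else 0)"
      by (intro sum.cong refl) (auto simp: Suc_le_eq)
    finally show ?thesis using S by simp
  qed
  have V4: "(LINT p|gauss2. cnj (fst p) * snd p * K p) = (\<Sum>j<N. of_nat (Suc j))"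
  proof -
    have "(LINT p|gauss2. cnj (fst p) * snd p * K p)
        = (\<Sum>j\<le>N. \<Sum>k\<le>N. if j = Suc k then of_nat (Suc k) else 0)"
      unfolding K_def integral_kernel_product[OF kernel_basis icz iz] vz vcz
      by (intro sum.cong refl) (auto simp: rr)
    also have "\<dots> = (\<Sum>k\<le>N. \<Sum>j\<le>N. if j = Suc k then of_nat (Suc k) else 0)"
      by (rule sum.swap)
    also have "\<dots> = (\<Sum>j\<le>N. if j < N then of_nat (Suc j) else 0)"
      by (intro sum.cong refl) (auto simp: Suc_le_eq)
    finally show ?thesis using S by simp
  qed
  have "complex_of_real (LINT p|gauss2. (cmod (fst p - snd p))\<^sup>2 * kernel_weight N p)
      = (\<Sum>j\<le>N. of_nat (Suc j)) + (\<Sum>j\<le>N. of_nat (Suc j)) - (\<Sum>j<N. of_nat (Suc j)) - (\<Sum>j<N. of_nat (Suc j))"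
    unfolding integral_complex_of_real[symmetric] eq
    by (simp only: Bochner_Integration.integral_add Bochner_Integration.integral_diff
        Bochner_Integration.integrable_add Bochner_Integration.integrable_diff I1 I2 I3 I4 V1 V2 V3 V4)
  also have "\<dots> = complex_of_real (2 * real (N + 1))"
    by (simp flip: lessThan_Suc_atMost)
  finally show "(LINT p|gauss2. (cmod (fst p - snd p))\<^sup>2 * kernel_weight N p)
      = 2 * real (N + 1)" by (simp only: of_real_eq_iff)
qed

text \<open>
  In the basis of eigenfunctions the matrix of \<open>\<sigma>\<close> is diagonal. The mixed term of the expanded square
  therefore gives the sum of the squared eigenvalues, and the other two terms give the second moments.
\<close>

lemma eigenvalue_variance:
  fixes \<sigma> :: "complex \<Rightarrow> real"
  assumes \<sigma>: "\<sigma> \<in> borel_measurable gauss" and bound: "\<And>z. \<bar>\<sigma> z\<bar> \<le> B"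
    and F: "orthonormal_on {..N} F"
    and eig: "\<And>j k. j \<le> N \<Longrightarrow> k \<le> N \<Longrightarrow>
      inner_gauss (\<lambda>z. complex_of_real (\<sigma> z) * F j z) (F k) = (if j = k then complex_of_real (l j) else 0)"
    and K: "\<And>z w. (\<Sum>j\<le>N. F j z * cnj (F j w)) = (\<Sum>n\<le>N. fock_basis n z * cnj (fock_basis n w))"
  shows "2 * (\<Sum>j\<le>N. LINT z|gauss. (\<sigma> z - l j)\<^sup>2 * (cmod (F j z))\<^sup>2)
    = (LINT p|gauss2. (\<sigma> (fst p) - \<sigma> (snd p))\<^sup>2 * kernel_weight N p)"
proof -
  \<comment> \<open>Cutting off at \<open>N\<close> gives square integrability for every index.\<close>
  define G where "G j = (if j \<le> N then F j else (\<lambda>z. 0))" for j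
  have GL2: "G j \<in> L2_gauss" for j using orthonormal_onD(1)[OF F] by (simp add: G_def L2_gauss_0)
  have KG: "fock_kernel N z w = (\<Sum>j\<le>N. G j z * cnj (G j w))" for z w
    unfolding fock_kernel_def K[symmetric] by (simp add: G_def)
  have on: "inner_gauss (G j) (G k) = (if j = k then 1 else 0)" if "j \<le> N" "k \<le> N" for j k
    using orthonormal_onD(2)[OF F] that by (simp add: G_def)
  define s where "s z = complex_of_real (\<sigma> z)" for z
  have "B \<ge> 0" using order_trans[OF abs_ge_zero bound] .
  have s: "s \<in> borel_measurable gauss" "\<And>z. cmod (s z) \<le> B" using \<sigma> bound by (auto simp: s_def[abs_def])
  have s2: "(\<lambda>z. (s z)\<^sup>2) \<in> borel_measurable gauss" "\<And>z. cmod ((s z)\<^sup>2) \<le> B\<^sup>2"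
    using s by (auto simp: norm_power intro: power_mono)
  have i1: "integrable gauss (\<lambda>z. 1 * G j z * cnj (G k z))" for j k
    using L2_integrable_mult[OF GL2 GL2] by simp
  note i\<sigma> = integrable_bounded_mult_L2[OF s GL2 GL2] and i\<sigma>2 = integrable_bounded_mult_L2[OF s2 GL2 GL2]
  define K' where "K' p = complex_of_real (kernel_weight N p)" for p
  define m2 where "m2 j = (LINT z|gauss. (\<sigma> z)\<^sup>2 * (cmod (F j z))\<^sup>2)" for j
  have v1: "(LINT z|gauss. 1 * G j z * cnj (G k z)) = (if j = k then 1 else 0)" if "j \<le> N" "k \<le> N" for j k
    using on[OF that] by (simp add: inner_gauss_def)
  have vs: "(LINT z|gauss. s z * G j z * cnj (G k z)) = (if j = k then complex_of_real (l j) else 0)"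
    if "j \<le> N" "k \<le> N" for j k
    using eig[OF that] that by (simp add: inner_gauss_def s_def G_def)
  have sq: "s z ^ 2 * G j z * cnj (G j z) = complex_of_real ((\<sigma> z)\<^sup>2 * (cmod (F j z))\<^sup>2)" if "j \<le> N" for z j
    using that by (simp add: s_def G_def complex_norm_square mult.assoc flip: of_real_power)
  have vs2: "(LINT z|gauss. (s z)\<^sup>2 * G j z * cnj (G j z)) = complex_of_real (m2 j)" if "j \<le> N" for j
    unfolding sq[OF that] m2_def by (rule integral_complex_of_real)
  note I1 = integrable_kernel_product[OF KG i\<sigma>2 i1, folded K'_def]
    and I2 = integrable_kernel_product[OF KG i1 i\<sigma>2, folded K'_def]
    and I3 = integrable_kernel_product[OF KG i\<sigma> i\<sigma>, folded K'_def]
  have V1: "(LINT p|gauss2. (s (fst p))\<^sup>2 * 1 * K' p) = complex_of_real (\<Sum>j\<le>N. m2 j)"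
  proof -
    have "(LINT p|gauss2. (s (fst p))\<^sup>2 * 1 * K' p) = (\<Sum>j\<le>N. \<Sum>k\<le>N. if k = j then complex_of_real (m2 j) else 0)"
      unfolding K'_def integral_kernel_product[OF KG i\<sigma>2 i1]
      by (intro sum.cong refl) (simp add: v1[simplified] vs2)
    then show ?thesis by simp
  qed
  have V2: "(LINT p|gauss2. 1 * (s (snd p))\<^sup>2 * K' p) = complex_of_real (\<Sum>j\<le>N. m2 j)"
  proof -
    have "(LINT p|gauss2. 1 * (s (snd p))\<^sup>2 * K' p) = (\<Sum>j\<le>N. \<Sum>k\<le>N. if k = j then complex_of_real (m2 j) else 0)"
      unfolding K'_def integral_kernel_product[OF KG i1 i\<sigma>2]
      by (intro sum.cong refl) (simp add: v1[simplified] vs2)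
    then show ?thesis by simp
  qed
  have V3: "(LINT p|gauss2. s (fst p) * s (snd p) * K' p) = complex_of_real (\<Sum>j\<le>N. (l j)\<^sup>2)"
  proof -
    have "(LINT p|gauss2. s (fst p) * s (snd p) * K' p) = (\<Sum>j\<le>N. \<Sum>k\<le>N. if k = j then complex_of_real ((l j)\<^sup>2) else 0)"
      unfolding K'_def integral_kernel_product[OF KG i\<sigma> i\<sigma>]
      by (intro sum.cong refl) (simp add: vs power2_eq_square)
    then show ?thesis by simp
  qed
  have eq: "complex_of_real ((\<sigma> (fst p) - \<sigma> (snd p))\<^sup>2 * kernel_weight N p)
      = (s (fst p))\<^sup>2 * 1 * K' p + 1 * (s (snd p))\<^sup>2 * K' p - 2 * (s (fst p) * s (snd p) * K' p)" for p
    unfolding of_real_mult K'_def[symmetric] unfolding of_real_power of_real_diff s_def[symmetric]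
    by (simp add: power2_diff algebra_simps)
  have "complex_of_real (LINT p|gauss2. (\<sigma> (fst p) - \<sigma> (snd p))\<^sup>2 * kernel_weight N p)
      = complex_of_real (\<Sum>j\<le>N. m2 j) + complex_of_real (\<Sum>j\<le>N. m2 j) - 2 * complex_of_real (\<Sum>j\<le>N. (l j)\<^sup>2)"
    unfolding integral_complex_of_real[symmetric] eq
    by (simp only: Bochner_Integration.integral_add Bochner_Integration.integral_diff integral_mult_right_zero
        Bochner_Integration.integrable_add integrable_mult_right I1 I2 I3 V1 V2 V3)
  also have "\<dots> = complex_of_real (2 * (\<Sum>j\<le>N. m2 j - (l j)\<^sup>2))"
    by (simp add: sum_subtractf)
  finally have lhs: "(LINT p|gauss2. (\<sigma> (fst p) - \<sigma> (snd p))\<^sup>2 * kernel_weight N p)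
      = 2 * (\<Sum>j\<le>N. m2 j - (l j)\<^sup>2)" by (simp only: of_real_eq_iff)
  have "(LINT z|gauss. (\<sigma> z - l j)\<^sup>2 * (cmod (F j z))\<^sup>2) = m2 j - (l j)\<^sup>2" if "j \<le> N" for j
  proof -
    have FL2: "F j \<in> L2_gauss" using orthonormal_onD(1)[OF F] that by simp
    have a: "integrable gauss (\<lambda>z. (cmod (F j z))\<^sup>2)" using L2_gaussD(2)[OF FL2] .
    have b: "integrable gauss (\<lambda>z. \<sigma> z * (cmod (F j z))\<^sup>2)"
      by (rule integrable_bounded_norm_square[OF \<sigma> bound FL2])
    have "\<bar>(\<sigma> z)\<^sup>2\<bar> \<le> B\<^sup>2" for z using s2(2)[of z] by (simp add: s_def norm_power)
    then have c: "integrable gauss (\<lambda>z. (\<sigma> z)\<^sup>2 * (cmod (F j z))\<^sup>2)"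
      using \<sigma> by (intro integrable_bounded_norm_square[OF _ _ FL2]) auto
    have va: "(LINT z|gauss. (cmod (F j z))\<^sup>2) = 1"
      using orthonormal_on_l2sq[OF F] that by (simp add: l2sq_def)
    have vb: "(LINT z|gauss. \<sigma> z * (cmod (F j z))\<^sup>2) = l j"
      using eig[OF that that] by (simp add: inner_gauss_weighted_self)
    have "(LINT z|gauss. (\<sigma> z - l j)\<^sup>2 * (cmod (F j z))\<^sup>2)
        = (LINT z|gauss. (\<sigma> z)\<^sup>2 * (cmod (F j z))\<^sup>2 - 2 * l j * (\<sigma> z * (cmod (F j z))\<^sup>2) + (l j)\<^sup>2 * (cmod (F j z))\<^sup>2)"
      by (intro Bochner_Integration.integral_cong refl) (simp add: power2_diff algebra_simps)
    also have "\<dots> = m2 j - 2 * l j * l j + (l j)\<^sup>2 * 1"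
      unfolding m2_def va[symmetric] vb[symmetric] using a b c by simp
    finally show ?thesis by (simp add: power2_eq_square)
  qed
  then have "(\<Sum>j\<le>N. LINT z|gauss. (\<sigma> z - l j)\<^sup>2 * (cmod (F j z))\<^sup>2) = (\<Sum>j\<le>N. m2 j - (l j)\<^sup>2)"
    by (intro sum.cong) auto
  with lhs show ?thesis by simp
qed

section \<open>Polar coordinates and averages of radial limits\<close>

lemma nn_integral_periodic_shift:
  fixes g :: "real \<Rightarrow> ennreal"
  assumes [measurable]: "g \<in> borel_measurable borel"
    and per: "\<And>x. g (x + 2 * pi) = g x" and a: "0 \<le> a" "a < 2 * pi"
  shows "(\<integral>\<^sup>+x. g (x + a) * indicator {0..<2 * pi} x \<partial>lborel) = (\<integral>\<^sup>+x. g x * indicator {0..<2 * pi} x \<partial>lborel)"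
proof -
  have "(\<integral>\<^sup>+x. g (x + a) * indicator {0..<2 * pi} x \<partial>lborel)
      = (\<integral>\<^sup>+x. g (x + a) * indicator {a..<a + 2 * pi} (x + a) \<partial>lborel)"
    by (intro nn_integral_cong) (auto simp: indicator_def)
  also have "\<dots> = (\<integral>\<^sup>+x. g x * indicator {a..<a + 2 * pi} x \<partial>lborel)"
    by (rule nn_integral_lborel_shift[where f="\<lambda>x. g x * indicator {a..<a + 2 * pi} x"]) measurable
  also have "\<dots> = (\<integral>\<^sup>+x. g x * indicator {a..<2 * pi} x + g x * indicator {2 * pi..<2 * pi + a} x \<partial>lborel)"
    using a by (intro nn_integral_cong) (auto simp: indicator_def)
  also have "\<dots> = (\<integral>\<^sup>+x. g x * indicator {a..<2 * pi} x \<partial>lborel) + (\<integral>\<^sup>+x. g x * indicator {2 * pi..<2 * pi + a} x \<partial>lborel)"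
    by (rule nn_integral_add) measurable
  also have "(\<integral>\<^sup>+x. g x * indicator {2 * pi..<2 * pi + a} x \<partial>lborel)
      = (\<integral>\<^sup>+x. g (x + 2 * pi) * indicator {2 * pi..<2 * pi + a} (x + 2 * pi) \<partial>lborel)"
    by (rule nn_integral_lborel_shift[where f="\<lambda>x. g x * indicator {2 * pi..<2 * pi + a} x", symmetric]) measurable
  also have "\<dots> = (\<integral>\<^sup>+x. g x * indicator {0..<a} x \<partial>lborel)"
    unfolding per by (intro nn_integral_cong) (auto simp: indicator_def)
  also have "(\<integral>\<^sup>+x. g x * indicator {a..<2 * pi} x \<partial>lborel) + \<dots>
      = (\<integral>\<^sup>+x. g x * indicator {a..<2 * pi} x + g x * indicator {0..<a} x \<partial>lborel)"
    by (rule nn_integral_add[symmetric]) measurable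
  also have "\<dots> = (\<integral>\<^sup>+x. g x * indicator {0..<2 * pi} x \<partial>lborel)"
    using a by (intro nn_integral_cong) (auto simp: indicator_def)
  finally show ?thesis .
qed

lemma measurable_ident_gauss [measurable]: "(\<lambda>z. z) \<in> measurable gauss borel"
  by (rule borel_imp_gauss_measurable) simp

lemma borel_measurable_cis [measurable]: "cis \<in> borel_measurable borel"
  by (intro borel_measurable_continuous_onI continuous_intros) 

definition angle_measure :: "real measure" where
  "angle_measure = density lborel (\<lambda>\<theta>. ennreal (indicator {0..<2 * pi} \<theta> / (2 * pi)))"

lemma sets_angle_measure [measurable_cong, simp]: "sets angle_measure = sets borel"
  and space_angle_measure [simp]: "space angle_measure = UNIV"
  by (simp_all add: angle_measure_def)

lemma nn_integral_angle_measure: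
  assumes [measurable]: "f \<in> borel_measurable borel"
  shows "ennreal (2 * pi) * (\<integral>\<^sup>+\<theta>. f \<theta> \<partial>angle_measure) = (\<integral>\<^sup>+\<theta>. f \<theta> * indicator {0..<2 * pi} \<theta> \<partial>lborel)"
proof -
  have "ennreal (2 * pi) * ennreal (1 / (2 * pi)) = 1" by (subst ennreal_mult[symmetric]) auto
  then have *: "ennreal (2 * pi) * (ennreal (indicator {0..<2 * pi} \<theta> / (2 * pi)) * f \<theta>) = f \<theta> * indicator {0..<2 * pi} \<theta>" for \<theta>
    by (auto simp: indicator_def simp flip: mult.assoc)
  have "ennreal (2 * pi) * (\<integral>\<^sup>+\<theta>. f \<theta> \<partial>angle_measure)
      = (\<integral>\<^sup>+\<theta>. ennreal (2 * pi) * (ennreal (indicator {0..<2 * pi} \<theta> / (2 * pi)) * f \<theta>) \<partial>lborel)"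
    unfolding angle_measure_def by (subst nn_integral_density) (auto simp: nn_integral_cmult)
  then show ?thesis unfolding * .
qed

lemma prob_space_angle_measure: "prob_space angle_measure"
proof
  have "ennreal (2 * pi) * emeasure angle_measure (space angle_measure) = ennreal (2 * pi)"
    using nn_integral_angle_measure[of "\<lambda>_. 1"] by simp
  also have "\<dots> = ennreal (2 * pi) * 1" by simp
  finally show "emeasure angle_measure (space angle_measure) = 1"
    by (subst (asm) ennreal_mult_cancel_left) auto
qed

interpretation angle: prob_space angle_measure by (rule prob_space_angle_measure)

interpretation angle_gauss: pair_sigma_finite angle_measure gauss by unfold_locales

lemma measurable_snd_gauss [measurable]: "(\<lambda>p. snd p) \<in> measurable (angle_measure \<Otimes>\<^sub>M gauss) borel"
  by (rule measurable_compose[OF measurable_snd measurable_ident_gauss])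

lemma polar_measurable [measurable]:
  "(\<lambda>p. complex_of_real (cmod (snd p)) * cis (fst p)) \<in> borel_measurable (angle_measure \<Otimes>\<^sub>M gauss)"
  by measurable

lemma nn_integral_angle_shift:
  fixes g :: "real \<Rightarrow> ennreal"
  assumes [measurable]: "g \<in> borel_measurable borel"
    and "\<And>x. g (x + 2 * pi) = g x" "0 \<le> a" "a < 2 * pi"
  shows "(\<integral>\<^sup>+\<theta>. g (\<theta> + a) \<partial>angle_measure) = (\<integral>\<^sup>+\<theta>. g \<theta> \<partial>angle_measure)"
proof -
  have "ennreal (2 * pi) * (\<integral>\<^sup>+\<theta>. g (\<theta> + a) \<partial>angle_measure)
      = ennreal (2 * pi) * (\<integral>\<^sup>+\<theta>. g \<theta> \<partial>angle_measure)"
    using nn_integral_periodic_shift[OF assms] by (simp add: nn_integral_angle_measure)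
  then show ?thesis by (subst (asm) ennreal_mult_cancel_left) auto
qed

text \<open>
  Under the Gaussian measure the direction is uniform and independent of the modulus. Averaging the rotation invariance
  over all angles replaces \<open>z\<close> by \<open>cis \<theta> * z\<close>, and for fixed \<open>z\<close> the argument of \<open>z\<close> can be absorbed into
  the uniform angle. No Jacobian enters, as the modulus stays a function of \<open>z\<close>.
\<close>

lemma nn_integral_gauss_polar:
  fixes f :: "complex \<Rightarrow> ennreal"
  assumes [measurable]: "f \<in> borel_measurable borel"
  shows "(\<integral>\<^sup>+z. f z \<partial>gauss)
    = (\<integral>\<^sup>+\<theta>. \<integral>\<^sup>+z. f (complex_of_real (cmod z) * cis \<theta>) \<partial>gauss \<partial>angle_measure)"
proof -
  have M: "(\<lambda>p. f (cis (fst p) * snd p)) \<in> borel_measurable (angle_measure \<Otimes>\<^sub>M gauss)"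
    "(\<lambda>p. f (complex_of_real (cmod (snd p)) * cis (fst p))) \<in> borel_measurable (angle_measure \<Otimes>\<^sub>M gauss)"
    by measurable
  have avg: "(\<integral>\<^sup>+\<theta>. f (cis \<theta> * z) \<partial>angle_measure)
      = (\<integral>\<^sup>+\<theta>. f (complex_of_real (cmod z) * cis \<theta>) \<partial>angle_measure)" for z
  proof -
    define \<phi> where "\<phi> = Arg2pi z"
    have \<phi>: "0 \<le> \<phi>" "\<phi> < 2 * pi" by (simp_all add: \<phi>_def Arg2pi_ge_0 Arg2pi_lt_2pi)
    have z: "z = complex_of_real (cmod z) * cis \<phi>"
      using Arg2pi_eq[of z] by (simp add: \<phi>_def cis_conv_exp mult.commute)
    have shift: "cis \<theta> * z = complex_of_real (cmod z) * cis (\<theta> + \<phi>)" for \<theta>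
      by (subst z) (simp add: mult_ac flip: cis_mult)
    show ?thesis unfolding shift
      by (rule nn_integral_angle_shift[where g="\<lambda>\<theta>. f (complex_of_real (cmod z) * cis \<theta>)"])
        (use \<phi> in \<open>auto simp flip: cis_mult\<close>)
  qed
  have "(\<integral>\<^sup>+z. f z \<partial>gauss) = (\<integral>\<^sup>+\<theta>. \<integral>\<^sup>+z. f (cis \<theta> * z) \<partial>gauss \<partial>angle_measure)"
    using angle.emeasure_space_1 by (simp add: nn_integral_gauss_rotate)
  also have "\<dots> = (\<integral>\<^sup>+z. \<integral>\<^sup>+\<theta>. f (cis \<theta> * z) \<partial>angle_measure \<partial>gauss)"
    using angle_gauss.Fubini'[of "\<lambda>\<theta> z. f (cis \<theta> * z)"] M by (simp add: case_prod_beta')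
  also have "\<dots> = (\<integral>\<^sup>+z. \<integral>\<^sup>+\<theta>. f (complex_of_real (cmod z) * cis \<theta>) \<partial>angle_measure \<partial>gauss)"
    by (simp only: avg)
  also have "\<dots> = (\<integral>\<^sup>+\<theta>. \<integral>\<^sup>+z. f (complex_of_real (cmod z) * cis \<theta>) \<partial>gauss \<partial>angle_measure)"
    using angle_gauss.Fubini'[of "\<lambda>\<theta> z. f (complex_of_real (cmod z) * cis \<theta>)"] M
    by (simp add: case_prod_beta')
  finally show ?thesis .
qed

lemma distr_polar: "distr (angle_measure \<Otimes>\<^sub>M gauss) borel (\<lambda>p. complex_of_real (cmod (snd p)) * cis (fst p))
  = distr gauss borel (\<lambda>z. z)" (is "?L = ?R")
proof (rule measure_eqI)
  fix A assume "A \<in> sets ?L"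
  then have [measurable]: "A \<in> sets borel" by simp
  let ?T = "\<lambda>p. complex_of_real (cmod (snd p)) * cis (fst p)"
  have "emeasure ?L A = (\<integral>\<^sup>+p. indicator A (?T p) \<partial>(angle_measure \<Otimes>\<^sub>M gauss))"
    using nn_integral_distr[OF polar_measurable, of "indicator A"] by simp
  also have "\<dots> = (\<integral>\<^sup>+\<theta>. \<integral>\<^sup>+z. indicator A (complex_of_real (cmod z) * cis \<theta>) \<partial>gauss \<partial>angle_measure)"
    by (subst gauss.nn_integral_fst[symmetric]) (auto intro: measurable_compose[OF polar_measurable])
  also have "\<dots> = (\<integral>\<^sup>+z. indicator A z \<partial>gauss)"
    by (rule nn_integral_gauss_polar[symmetric]) measurable
  also have "\<dots> = emeasure ?R A"
    using nn_integral_distr[OF measurable_ident_gauss, of "indicator A"] by simp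
  finally show "emeasure ?L A = emeasure ?R A" .
qed simp

lemma
  fixes f :: "complex \<Rightarrow> complex"
  assumes [measurable]: "f \<in> borel_measurable borel" and int: "integrable gauss f"
  shows integral_gauss_polar: "(LINT z|gauss. f z)
      = (LINT \<theta>|angle_measure. LINT z|gauss. f (complex_of_real (cmod z) * cis \<theta>))"
proof -
  let ?T = "\<lambda>p. complex_of_real (cmod (snd p)) * cis (fst p)"
  have "integrable (distr gauss borel (\<lambda>z. z)) f"
    using int by (subst integrable_distr_eq) auto
  then have i: "integrable (angle_measure \<Otimes>\<^sub>M gauss) (\<lambda>p. f (?T p))"
    unfolding distr_polar[symmetric] by (subst (asm) integrable_distr_eq) auto
  have "(LINT z|gauss. f z) = (LINT z|distr gauss borel (\<lambda>z. z). f z)"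
    by (rule integral_distr[symmetric]) auto
  also have "\<dots> = (LINT p|(angle_measure \<Otimes>\<^sub>M gauss). f (?T p))"
    unfolding distr_polar[symmetric] by (rule integral_distr) auto
  also have "\<dots> = (LINT \<theta>|angle_measure. LINT z|gauss. f (complex_of_real (cmod z) * cis \<theta>))"
    using angle_gauss.integral_fst'[OF i] by simp
  finally show ?thesis .
qed

lemma AE_angle_iff: "(AE \<theta> in angle_measure. P \<theta>) \<longleftrightarrow> (AE \<theta> in lebesgue_on {0..<2 * pi}. P \<theta>)"
proof -
  have "(AE \<theta> in angle_measure. P \<theta>) \<longleftrightarrow> (AE \<theta> in lborel. \<theta> \<in> {0..<2 * pi} \<longrightarrow> P \<theta>)"
    unfolding angle_measure_def by (subst AE_density) (auto simp: indicator_def)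
  also have "\<dots> \<longleftrightarrow> (AE \<theta> in lebesgue. \<theta> \<in> {0..<2 * pi} \<longrightarrow> P \<theta>)"
    by (rule AE_completion_iff[symmetric])
  also have "\<dots> \<longleftrightarrow> (AE \<theta> in lebesgue_on {0..<2 * pi}. P \<theta>)"
    by (subst AE_restrict_space_iff) auto
  finally show ?thesis .
qed

lemma integral_angle_measure:
  fixes f :: "real \<Rightarrow> complex"
  assumes [measurable]: "f \<in> borel_measurable borel"
  shows "(LINT \<theta>|angle_measure. f \<theta>) = (LINT \<theta>|lebesgue_on {0..<2 * pi}. f \<theta> / complex_of_real (2 * pi))"
proof -
  have "(LINT \<theta>|angle_measure. f \<theta>) = (LINT \<theta>|lborel. (indicator {0..<2 * pi} \<theta> / (2 * pi)) *\<^sub>R f \<theta>)"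
    unfolding angle_measure_def by (rule integral_density) auto
  also have "\<dots> = (LINT \<theta>|lebesgue. (indicator {0..<2 * pi} \<theta> / (2 * pi)) *\<^sub>R f \<theta>)"
    by (rule integral_completion[symmetric]) measurable
  also have "\<dots> = (LINT \<theta>|lebesgue. indicator {0..<2 * pi} \<theta> *\<^sub>R (f \<theta> / complex_of_real (2 * pi)))"
    by (intro Bochner_Integration.integral_cong refl) (auto simp: indicator_def scaleR_conv_of_real)
  also have "\<dots> = (LINT \<theta>|lebesgue_on {0..<2 * pi}. f \<theta> / complex_of_real (2 * pi))"
    by (rule integral_restrict_space[symmetric]) auto
  finally show ?thesis .
qed

lemma fock_density_polar: "fock_density N (complex_of_real (cmod z) * cis \<theta>) = fock_density N z"
  by (simp add: fock_density_def fock_basis_def norm_mult norm_divide norm_power)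

lemma fock_density_borel [measurable]: "fock_density N \<in> borel_measurable borel"
  unfolding fock_density_def[abs_def] fock_basis_def by measurable

lemma fock_density_le_exp: "fock_density N z \<le> exp ((cmod z)\<^sup>2)"
proof -
  have sums: "(\<lambda>n. ((cmod z)\<^sup>2) ^ n /\<^sub>R fact n) sums exp ((cmod z)\<^sup>2)" by (rule exp_converges)
  have "fock_density N z = (\<Sum>n\<le>N. ((cmod z)\<^sup>2) ^ n /\<^sub>R fact n)"
    by (simp add: fock_density_def norm_fock_basis_square)
  also have "\<dots> \<le> (\<Sum>n. ((cmod z)\<^sup>2) ^ n /\<^sub>R fact n)"
    by (rule sum_le_suminf[OF sums_summable[OF sums]]) auto
  finally show ?thesis using sums_unique[OF sums] by simp
qed

lemma integral_fock_density_ball_le: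
  "(LINT z|gauss. indicator (ball 0 R) z * fock_density N z) \<le> exp (R\<^sup>2)"
proof -
  have m: "indicator (ball 0 R) \<in> borel_measurable gauss"
    by (intro borel_imp_gauss_measurable borel_measurable_indicator) simp
  have "(LINT z|gauss. indicator (ball 0 R) z * fock_density N z) \<le> (LINT z|gauss. exp (R\<^sup>2))"
  proof (rule integral_mono)
    show "integrable gauss (\<lambda>z. indicator (ball 0 R) z * fock_density N z)"
      using integrable_bounded_fock_density[of "indicator (ball 0 R) :: complex \<Rightarrow> real" 1 N] m
      by (auto simp: indicator_def)
    show "indicator (ball 0 R) z * fock_density N z \<le> exp (R\<^sup>2)" for z
    proof (cases "z \<in> ball 0 R")
      case True
      then have "(cmod z)\<^sup>2 \<le> R\<^sup>2" by (intro power_mono) auto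
      with True show ?thesis using fock_density_le_exp[of N z]
        by simp (meson exp_le_cancel_iff order_trans)
    qed simp
  qed simp
  then show ?thesis using gauss.prob_space by simp
qed

text \<open>
  The density has total mass \<open>N + 1\<close>, but its mass on any disc is bounded uniformly in \<open>N\<close>. Hence
  the weighted mean depends in the limit only on the behaviour at infinity. The function \<open>\<phi>\<close> may
  differ from \<open>\<eta>\<close>, which has the limit, on a null set: in the application \<open>\<phi>\<close> is a Borel version
  of \<open>\<eta>\<close>.
\<close>

lemma fock_density_average_tendsto:
  fixes \<phi> \<eta> :: "complex \<Rightarrow> complex"
  assumes m: "\<phi> \<in> borel_measurable gauss" and bound: "\<And>z. cmod (\<phi> z) \<le> B"
    and eq: "AE z in gauss. \<phi> z = \<eta> z" and bound': "\<And>z. cmod (\<eta> z) \<le> B"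
    and lim: "(\<eta> \<longlongrightarrow> L) at_infinity"
  shows "(\<lambda>N. (LINT z|gauss. \<phi> z * complex_of_real (fock_density N z)) / of_nat (N + 1)) \<longlonglongrightarrow> L"
proof (rule tendstoI)
  fix e :: real assume "e > 0"
  have "\<forall>\<^sub>F z in at_infinity. dist (\<eta> z) L < e / 2" using lim \<open>e > 0\<close> by (intro tendstoD) auto
  then obtain R where R: "\<And>z. cmod z \<ge> R \<Longrightarrow> dist (\<eta> z) L < e / 2" by (auto simp: eventually_at_infinity)
  have "B \<ge> 0" using order_trans[OF norm_ge_zero bound] .
  have Lb: "cmod L \<le> B"
    by (rule tendsto_upperbound[OF tendsto_norm[OF lim]]) (auto simp: bound' trivial_limit_at_infinity)
  define I where "I N = (LINT z|gauss. indicator (ball 0 R) z * fock_density N z)" for N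
  have key: "cmod ((LINT z|gauss. \<phi> z * complex_of_real (fock_density N z)) / of_nat (N + 1) - L)
      \<le> e / 2 + 2 * B * exp (R\<^sup>2) / real (N + 1)" for N
  proof -
    have i1: "integrable gauss (\<lambda>z. \<phi> z * complex_of_real (fock_density N z))"
      by (rule integrable_bounded_fock_density[OF m bound])
    have i2: "integrable gauss (\<lambda>z. complex_of_real (fock_density N z))"
      using integrable_fock_density[of N] by auto
    have mi: "indicator (ball 0 R) \<in> borel_measurable gauss"
      by (intro borel_imp_gauss_measurable borel_measurable_indicator) simp
    have i3: "integrable gauss (\<lambda>z. indicator (ball 0 R) z * fock_density N z)"
      using integrable_bounded_fock_density[of "indicator (ball 0 R) :: complex \<Rightarrow> real" 1 N] mi
      by (auto simp: indicator_def)
    have "(LINT z|gauss. \<phi> z * complex_of_real (fock_density N z)) - L * of_nat (N + 1)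
        = (LINT z|gauss. \<phi> z * complex_of_real (fock_density N z)) - L * (LINT z|gauss. complex_of_real (fock_density N z))"
      by (simp add: integral_fock_density)
    also have "\<dots> = (LINT z|gauss. \<phi> z * complex_of_real (fock_density N z) - L * complex_of_real (fock_density N z))"
      using i1 i2 by (subst Bochner_Integration.integral_diff) auto
    also have "\<dots> = (LINT z|gauss. (\<phi> z - L) * complex_of_real (fock_density N z))"
      by (simp add: left_diff_distrib)
    finally have eq': "(LINT z|gauss. \<phi> z * complex_of_real (fock_density N z)) - L * of_nat (N + 1) = \<dots>" .
    have "cmod (LINT z|gauss. (\<phi> z - L) * complex_of_real (fock_density N z))
        \<le> (LINT z|gauss. cmod ((\<phi> z - L) * complex_of_real (fock_density N z)))"
      by (rule integral_norm_bound)
    also have "\<dots> \<le> (LINT z|gauss. e / 2 * fock_density N z + 2 * B * (indicator (ball 0 R) z * fock_density N z))"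
    proof (rule integral_mono_AE)
      have "integrable gauss (\<lambda>z. \<phi> z * complex_of_real (fock_density N z) - L * complex_of_real (fock_density N z))"
        using i1 i2 by auto
      then have "integrable gauss (\<lambda>z. (\<phi> z - L) * complex_of_real (fock_density N z))"
        by (simp add: left_diff_distrib)
      then show "integrable gauss (\<lambda>z. cmod ((\<phi> z - L) * complex_of_real (fock_density N z)))" by auto
      show "integrable gauss (\<lambda>z. e / 2 * fock_density N z + 2 * B * (indicator (ball 0 R) z * fock_density N z))"
        using i3 integrable_fock_density[of N] by auto
      show "AE z in gauss. cmod ((\<phi> z - L) * complex_of_real (fock_density N z))
          \<le> e / 2 * fock_density N z + 2 * B * (indicator (ball 0 R) z * fock_density N z)"
        using eq
      proof eventually_elim
        case (elim z)
        have "cmod (\<phi> z - L) \<le> e / 2 + 2 * B * indicator (ball 0 R) z"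
        proof (cases "cmod z \<ge> R")
          case True
          then show ?thesis using R[of z] elim by (simp add: dist_norm)
        next
          case False
          then show ?thesis using norm_triangle_ineq4[of "\<phi> z" L] bound[of z] Lb \<open>e > 0\<close> by simp
        qed
        then have "cmod (\<phi> z - L) * fock_density N z \<le> (e / 2 + 2 * B * indicator (ball 0 R) z) * fock_density N z"
          by (rule mult_right_mono) (rule fock_density_nonneg)
        then show ?case by (simp add: norm_mult fock_density_nonneg distrib_right mult.assoc)
      qed
    qed
    also have "\<dots> = e / 2 * real (N + 1) + 2 * B * I N"
      unfolding I_def integral_fock_density[symmetric] using i3 integrable_fock_density[of N]
      by (subst Bochner_Integration.integral_add) auto
    also have "\<dots> \<le> e / 2 * real (N + 1) + 2 * B * exp (R\<^sup>2)"
      using integral_fock_density_ball_le[of R N] \<open>B \<ge> 0\<close> by (auto simp: I_def intro: mult_left_mono)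
    finally have "cmod ((LINT z|gauss. \<phi> z * complex_of_real (fock_density N z)) - L * of_nat (N + 1))
        \<le> e / 2 * real (N + 1) + 2 * B * exp (R\<^sup>2)" unfolding eq' .
    then have "cmod ((LINT z|gauss. \<phi> z * complex_of_real (fock_density N z)) - L * of_nat (N + 1)) / real (N + 1)
        \<le> (e / 2 * real (N + 1) + 2 * B * exp (R\<^sup>2)) / real (N + 1)" by (rule divide_right_mono) simp
    also have "\<dots> = e / 2 + 2 * B * exp (R\<^sup>2) / real (N + 1)"
      unfolding add_divide_distrib by (subst nonzero_mult_div_cancel_right) auto
    also have "cmod ((LINT z|gauss. \<phi> z * complex_of_real (fock_density N z)) - L * of_nat (N + 1)) / real (N + 1)
        = cmod (((LINT z|gauss. \<phi> z * complex_of_real (fock_density N z)) - L * of_nat (N + 1)) / of_nat (N + 1))"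
      by (simp only: norm_divide norm_of_nat)
    also have "((LINT z|gauss. \<phi> z * complex_of_real (fock_density N z)) - L * of_nat (N + 1)) / of_nat (N + 1)
        = (LINT z|gauss. \<phi> z * complex_of_real (fock_density N z)) / of_nat (N + 1) - L"
      by (simp add: diff_divide_distrib del: of_nat_Suc of_nat_add)
    finally show ?thesis .
  qed
  have "(\<lambda>N. 2 * B * exp (R\<^sup>2) / real (N + 1)) \<longlonglongrightarrow> 0"
    using LIMSEQ_ignore_initial_segment[OF lim_const_over_n[of "2 * B * exp (R\<^sup>2)"], of 1] by simp
  then have "\<forall>\<^sub>F N in sequentially. dist (2 * B * exp (R\<^sup>2) / real (N + 1)) 0 < e / 2"
    using \<open>e > 0\<close> by (intro tendstoD) auto
  then show "\<forall>\<^sub>F N in sequentially. dist ((LINT z|gauss. \<phi> z * complex_of_real (fock_density N z)) / of_nat (N + 1)) L < e"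
  proof eventually_elim
    case (elim N)
    then show ?case using key[of N] by (simp only: dist_norm) (simp add: abs_if split: if_splits)
  qed
qed

text \<open>
  Polar coordinates need Borel functions: restricting a Lebesgue measurable function to a ray may
  destroy its measurability.
\<close>

lemma lebesgue_measurable_eq_borel_AE:
  fixes s :: "complex \<Rightarrow> complex"
  assumes s: "s \<in> borel_measurable gauss" and bound: "\<And>z. cmod (s z) \<le> B"
  obtains s0 where "s0 \<in> borel_measurable borel" "\<And>z. cmod (s0 z) \<le> B" "AE z in lborel. s z = s0 z"
proof -
  have sl: "s \<in> borel_measurable lebesgue" using s by (simp cong: measurable_cong_sets add: sets_gauss)
  then have "(\<lambda>z. Re (s z)) \<in> borel_measurable lebesgue" "(\<lambda>z. Im (s z)) \<in> borel_measurable lebesgue"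
    by measurable
  from this[THEN completion_ex_borel_measurable_real] obtain a b
    where [measurable]: "a \<in> borel_measurable lborel" "b \<in> borel_measurable lborel"
    and ae: "AE z in lborel. Re (s z) = a z" "AE z in lborel. Im (s z) = b z"
    by blast
  define t where "t z = complex_of_real (a z) + \<i> * complex_of_real (b z)" for z
  have [measurable]: "t \<in> borel_measurable borel" unfolding t_def by measurable
  define s0 where "s0 z = (if cmod (t z) \<le> B then t z else 0)" for z
  have "B \<ge> 0" using order_trans[OF norm_ge_zero bound] .
  show ?thesis
  proof (rule that)
    show "s0 \<in> borel_measurable borel" unfolding s0_def by measurable
    show "cmod (s0 z) \<le> B" for z using \<open>B \<ge> 0\<close> by (simp add: s0_def)
    show "AE z in lborel. s z = s0 z"
      using ae
    proof eventually_elim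
      case (elim z)
      then have "t z = s z" by (simp add: t_def complex_eq_iff)
      then show ?case using bound[of z] by (simp add: s0_def)
    qed
  qed
qed

lemma AE_lborel_imp_AE_gauss: "(AE z in lborel. P z) \<Longrightarrow> (AE z in gauss. P z)"
  unfolding gauss_def by (subst AE_density) (auto dest: AE_completion)

text \<open>
  The iterated polar integral of the indicator of a Borel null set vanishes, hence so does the inner
  integral for almost every angle.
\<close>

lemma AE_lborel_imp_AE_rays:
  assumes "AE z in lborel. P z"
  shows "AE \<theta> in angle_measure. AE z in gauss. P (complex_of_real (cmod z) * cis \<theta>)"
proof -
  obtain X where X: "{z \<in> space lborel. \<not> P z} \<subseteq> X" "emeasure lborel X = 0" "X \<in> sets lborel"
    using AE_E[OF assms] by blast
  then have [measurable]: "X \<in> sets borel" by simp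
  have m: "(\<lambda>p. indicator X (complex_of_real (cmod (snd p)) * cis (fst p)) :: ennreal)
      \<in> borel_measurable (angle_measure \<Otimes>\<^sub>M gauss)"
    by (intro measurable_compose[OF polar_measurable]) measurable
  have "AE z in lborel. z \<notin> X" using X by (intro AE_not_in) (auto simp: null_sets_def)
  then have "AE z in gauss. z \<notin> X" by (rule AE_lborel_imp_AE_gauss)
  then have "(\<integral>\<^sup>+z. indicator X z \<partial>gauss) = (\<integral>\<^sup>+z. 0 \<partial>gauss)"
    by (intro nn_integral_cong_AE) (auto elim!: eventually_mono simp: indicator_def)
  then have "(\<integral>\<^sup>+\<theta>. \<integral>\<^sup>+z. indicator X (complex_of_real (cmod z) * cis \<theta>) \<partial>gauss \<partial>angle_measure) = 0"
    using nn_integral_gauss_polar[of "indicator X"] by simp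
  then have "AE \<theta> in angle_measure. (\<integral>\<^sup>+z. indicator X (complex_of_real (cmod z) * cis \<theta>) \<partial>gauss) = 0"
    using gauss.borel_measurable_nn_integral_fst[OF m] by (subst (asm) nn_integral_0_iff_AE) auto
  then show ?thesis
  proof eventually_elim
    case (elim \<theta>)
    have "(\<lambda>z. indicator X (complex_of_real (cmod z) * cis \<theta>) :: ennreal) \<in> borel_measurable gauss"
      by (intro borel_imp_gauss_measurable) measurable
    with elim have "AE z in gauss. indicator X (complex_of_real (cmod z) * cis \<theta>) = (0 :: ennreal)"
      by (subst (asm) nn_integral_0_iff_AE) auto
    then show ?case
    proof eventually_elim
      case (elim z)
      then show ?case using X(1) by (auto simp: indicator_def split: if_splits)
    qed
  qed
qed

text \<open>
  The weighted means \<open>T N \<theta>\<close> along the ray of direction \<open>\<theta>\<close> are Borel functions of \<open>\<theta>\<close> which tend to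
  \<open>s' \<theta>\<close> on almost every ray. This yields the measurability of \<open>s'\<close>, which the existence of a radial
  limit does not include, and dominated convergence over the angles yields the average.
\<close>

theorem
  fixes s :: "complex \<Rightarrow> complex" and s' :: "real \<Rightarrow> complex"
  assumes s: "s \<in> borel_measurable gauss" and bound: "\<And>z. cmod (s z) \<le> B"
    and lim: "AE \<theta> in lebesgue_on {0..<2*pi}. ((\<lambda>r. s (complex_of_real r * cis \<theta>)) \<longlongrightarrow> s' \<theta>) at_top"
  shows radial_limit_measurable: "s' \<in> borel_measurable (lebesgue_on {0..<2*pi})"
    and radial_limit_bound: "AE \<theta> in lebesgue_on {0..<2*pi}. cmod (s' \<theta>) \<le> B"
    and radial_limit_average: "(\<lambda>N. (LINT z|gauss. s z * complex_of_real (fock_density N z)) / of_nat (N + 1))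
      \<longlonglongrightarrow> (LINT \<theta>|lebesgue_on {0..<2*pi}. s' \<theta> / complex_of_real (2 * pi))"
proof -
  obtain s0 where s0 [measurable]: "s0 \<in> borel_measurable borel" and s0b: "\<And>z. cmod (s0 z) \<le> B"
    and ae: "AE z in lborel. s z = s0 z"
    using lebesgue_measurable_eq_borel_AE[OF s bound] by blast
  have "B \<ge> 0" using order_trans[OF norm_ge_zero bound] .
  show bnd: "AE \<theta> in lebesgue_on {0..<2*pi}. cmod (s' \<theta>) \<le> B"
    using lim
  proof eventually_elim
    case (elim \<theta>)
    show ?case by (rule tendsto_upperbound[OF tendsto_norm[OF elim]]) (auto simp: bound)
  qed
  define T where "T N \<theta> = (LINT z|gauss. s0 (complex_of_real (cmod z) * cis \<theta>) * complex_of_real (fock_density N z)) / of_nat (N + 1)" for N \<theta>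
  have Tm [measurable]: "T N \<in> borel_measurable borel" for N
  proof -
    have a: "(\<lambda>p. s0 (complex_of_real (cmod (snd p)) * cis (fst p))) \<in> borel_measurable (angle_measure \<Otimes>\<^sub>M gauss)"
      by (intro measurable_compose[OF polar_measurable] s0)
    have "(\<lambda>z. complex_of_real (fock_density N z)) \<in> borel_measurable gauss"
      by (intro borel_imp_gauss_measurable) measurable
    from measurable_compose[OF measurable_snd this, of angle_measure] a
    have "(\<lambda>(\<theta>, z). s0 (complex_of_real (cmod z) * cis \<theta>) * complex_of_real (fock_density N z)) \<in> borel_measurable (angle_measure \<Otimes>\<^sub>M gauss)"
      by (simp add: case_prod_beta')
    from gauss.borel_measurable_lebesgue_integral[OF this]
    show ?thesis unfolding T_def by (simp cong: measurable_cong_sets)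
  qed
  have Tlim: "AE \<theta> in lebesgue_on {0..<2*pi}. (\<lambda>N. T N \<theta>) \<longlonglongrightarrow> s' \<theta>"
    using lim AE_lborel_imp_AE_rays[OF ae, unfolded AE_angle_iff]
  proof eventually_elim
    case (elim \<theta>)
    have "filterlim cmod at_top at_infinity" by (rule filterlim_norm_at_top)
    with elim(1) have "((\<lambda>z. s (complex_of_real (cmod z) * cis \<theta>)) \<longlongrightarrow> s' \<theta>) at_infinity"
      by (rule filterlim_compose)
    then show ?case unfolding T_def using elim(2)
      by (intro fock_density_average_tendsto[where \<eta> = "\<lambda>z. s (complex_of_real (cmod z) * cis \<theta>)" and B=B] borel_imp_gauss_measurable)
        (auto simp: bound s0b elim!: eventually_mono)
  qed
  show s'm: "s' \<in> borel_measurable (lebesgue_on {0..<2*pi})"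
  proof -
    obtain X where X: "{\<theta> \<in> space (lebesgue_on {0..<2*pi}). \<not> (\<lambda>N. T N \<theta>) \<longlonglongrightarrow> s' \<theta>} \<subseteq> X"
      "X \<in> null_sets (lebesgue_on {0..<2*pi})"
      using Tlim unfolding eventually_ae_filter by blast
    have "s' \<in> borel_measurable (lebesgue_on ({0..<2*pi} - X))"
    proof (rule borel_measurable_LIMSEQ_metric)
      show "T N \<in> borel_measurable (lebesgue_on ({0..<2*pi} - X))" for N
        by (intro measurable_restrict_space1 measurable_completion) simp
      show "(\<lambda>N. T N \<theta>) \<longlonglongrightarrow> s' \<theta>" if "\<theta> \<in> space (lebesgue_on ({0..<2*pi} - X))" for \<theta>
        using that X(1) by (auto simp: space_restrict_space)
    qed
    then show ?thesis using borel_measurable_diff_null[OF X(2), of s'] by simp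
  qed
  define s'' where "s'' \<theta> = lim (\<lambda>N. T N \<theta>)" for \<theta>
  have [measurable]: "s'' \<in> borel_measurable borel" unfolding s''_def by measurable
  have s''eq: "AE \<theta> in lebesgue_on {0..<2*pi}. s' \<theta> = s'' \<theta>"
    using Tlim by eventually_elim (simp add: s''_def limI)
  have Tb: "cmod (T N \<theta>) \<le> B" for N \<theta>
  proof -
    let ?f = "\<lambda>z. s0 (complex_of_real (cmod z) * cis \<theta>) * complex_of_real (fock_density N z)"
    have int: "integrable gauss ?f"
      by (rule integrable_bounded_fock_density[where B=B]) (auto intro!: borel_imp_gauss_measurable simp: s0b)
    have "cmod (LINT z|gauss. ?f z) \<le> (LINT z|gauss. cmod (?f z))" by (rule integral_norm_bound)
    also have "\<dots> \<le> (LINT z|gauss. B * fock_density N z)"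
    proof (rule integral_mono)
      show "integrable gauss (\<lambda>z. cmod (?f z))" using int by auto
      show "integrable gauss (\<lambda>z. B * fock_density N z)" using integrable_fock_density by auto
    qed (auto simp: norm_mult fock_density_nonneg s0b intro: mult_right_mono)
    also have "\<dots> = B * real (N + 1)" by (simp only: integral_mult_right_zero integral_fock_density)
    finally have "cmod (LINT z|gauss. ?f z) / real (N + 1) \<le> B * real (N + 1) / real (N + 1)"
      by (rule divide_right_mono) simp
    then show ?thesis unfolding T_def norm_divide norm_of_nat by (subst (asm) nonzero_mult_div_cancel_right) auto
  qed
  have "(LINT z|gauss. s z * complex_of_real (fock_density N z)) / of_nat (N + 1) = (LINT \<theta>|angle_measure. T N \<theta>)" for N
  proof -
    have "(LINT z|gauss. s z * complex_of_real (fock_density N z)) = (LINT z|gauss. s0 z * complex_of_real (fock_density N z))"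
    proof (rule integral_cong_AE)
      have "fock_density N \<in> borel_measurable gauss" by (intro borel_imp_gauss_measurable) measurable
      with s show "(\<lambda>z. s z * complex_of_real (fock_density N z)) \<in> borel_measurable gauss" by measurable
      show "(\<lambda>z. s0 z * complex_of_real (fock_density N z)) \<in> borel_measurable gauss"
        by (intro borel_imp_gauss_measurable) measurable
      show "AE z in gauss. s z * complex_of_real (fock_density N z) = s0 z * complex_of_real (fock_density N z)"
        using AE_lborel_imp_AE_gauss[OF ae] by (auto elim!: eventually_mono)
    qed
    also have "\<dots> = (LINT \<theta>|angle_measure. LINT z|gauss. s0 (complex_of_real (cmod z) * cis \<theta>) * complex_of_real (fock_density N z))"
      by (subst integral_gauss_polar)
        (auto simp: fock_density_polar intro!: integrable_bounded_fock_density[where B=B] borel_imp_gauss_measurable s0b)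
    finally show ?thesis unfolding T_def by simp
  qed
  moreover have "(\<lambda>N. LINT \<theta>|angle_measure. T N \<theta>) \<longlonglongrightarrow> (LINT \<theta>|angle_measure. s'' \<theta>)"
  proof (rule integral_dominated_convergence[where w="\<lambda>_. B"])
    show "AE \<theta> in angle_measure. (\<lambda>N. T N \<theta>) \<longlonglongrightarrow> s'' \<theta>"
      unfolding AE_angle_iff using Tlim s''eq by eventually_elim simp
  qed (auto simp: Tb)
  moreover have "(LINT \<theta>|angle_measure. s'' \<theta>) = (LINT \<theta>|lebesgue_on {0..<2 * pi}. s'' \<theta> / complex_of_real (2 * pi))"
    by (rule integral_angle_measure) measurable
  moreover have "(LINT \<theta>|lebesgue_on {0..<2 * pi}. s'' \<theta> / complex_of_real (2 * pi)) = (LINT \<theta>|lebesgue_on {0..<2 * pi}. s' \<theta> / complex_of_real (2 * pi))"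
  proof (rule integral_cong_AE)
    have [measurable]: "s'' \<in> borel_measurable (lebesgue_on {0..<2*pi})"
      by (intro measurable_restrict_space1 measurable_completion) simp
    note [measurable] = s'm
    show "(\<lambda>\<theta>. s'' \<theta> / complex_of_real (2 * pi)) \<in> borel_measurable (lebesgue_on {0..<2*pi})"
      "(\<lambda>\<theta>. s' \<theta> / complex_of_real (2 * pi)) \<in> borel_measurable (lebesgue_on {0..<2*pi})" by measurable
    show "AE \<theta> in lebesgue_on {0..<2 * pi}. s'' \<theta> / complex_of_real (2 * pi) = s' \<theta> / complex_of_real (2 * pi)"
      using s''eq by eventually_elim simp
  qed
  ultimately show "(\<lambda>N. (LINT z|gauss. s z * complex_of_real (fock_density N z)) / of_nat (N + 1))
      \<longlonglongrightarrow> (LINT \<theta>|lebesgue_on {0..<2*pi}. s' \<theta> / complex_of_real (2 * pi))" by simp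
qed

section \<open>Oscillation of symbols with a radial limit\<close>

text \<open>
  Near the diagonal uniform continuity gives the bound \<open>e\<close>, and away from it the quadratic term exceeds the
  diameter of the image. A quadratic error is what variances can control.
\<close>

lemma compact_quadratic_modulus:
  fixes h :: "'a::metric_space \<Rightarrow> 'b::real_normed_vector"
  assumes "compact S" "continuous_on S h" "e > 0"
  obtains M where "M \<ge> 0" "\<And>u v. u \<in> S \<Longrightarrow> v \<in> S \<Longrightarrow> norm (h u - h v) \<le> e + M * (dist u v)\<^sup>2"
proof -
  obtain d where "d > 0" and d: "\<And>u v. u \<in> S \<Longrightarrow> v \<in> S \<Longrightarrow> dist v u < d \<Longrightarrow> dist (h v) (h u) < e"
    using compact_uniformly_continuous[OF assms(2,1)] \<open>e > 0\<close> unfolding uniformly_continuous_on_def by metis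
  have "bounded (h ` S)" using assms by (intro compact_imp_bounded compact_continuous_image)
  then obtain C where "C > 0" and C: "\<And>u. u \<in> S \<Longrightarrow> norm (h u) \<le> C" by (auto simp: bounded_pos)
  show ?thesis
  proof (rule that[of "2 * C / d\<^sup>2"])
    show "2 * C / d\<^sup>2 \<ge> 0" using \<open>C > 0\<close> by simp
    fix u v assume uv: "u \<in> S" "v \<in> S"
    show "norm (h u - h v) \<le> e + 2 * C / d\<^sup>2 * (dist u v)\<^sup>2"
    proof (cases "dist u v < d")
      case True
      then have "norm (h u - h v) < e" using d[OF uv(2,1)] by (simp add: dist_norm)
      then show ?thesis using \<open>C > 0\<close> by (simp add: add_increasing2)
    next
      case False
      then have "d\<^sup>2 \<le> (dist u v)\<^sup>2" using \<open>d > 0\<close> by (intro power_mono) auto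
      then have "2 * C \<le> 2 * C / d\<^sup>2 * (dist u v)\<^sup>2"
        using \<open>C > 0\<close> \<open>d > 0\<close> by (simp add: field_simps)
      moreover have "norm (h u - h v) \<le> 2 * C"
        using norm_triangle_ineq4[of "h u" "h v"] C[OF uv(1)] C[OF uv(2)] by linarith
      ultimately show ?thesis using \<open>e > 0\<close> by linarith
    qed
  qed
qed

lemma continuous_on_circle_of_loop:
  fixes g :: "real \<Rightarrow> real"
  assumes "continuous_on UNIV g" "g 0 = g (2 * pi)"
  shows "continuous_on (sphere 0 1) (\<lambda>z. g (Arg2pi z))"
proof -
  define p where "p t = g (2 * pi * t)" for t
  have "continuous_on {0..1} p"
    unfolding p_def by (rule continuous_on_compose2[OF assms(1)]) (auto intro!: continuous_intros)
  then have "homotopic_loops UNIV p p"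
    using assms(2) by (simp add: homotopic_loops_refl path_def p_def pathfinish_def pathstart_def)
  then have "continuous_on (sphere 0 1) (p \<circ> (\<lambda>z. (Arg2pi z / (2 * pi))))"
    using homotopic_loops_imp_homotopic_circlemaps homotopic_with_imp_continuous by blast
  then show ?thesis by (simp add: p_def o_def)
qed

lemma Arg2pi_cis: "0 \<le> \<theta> \<Longrightarrow> \<theta> < 2 * pi \<Longrightarrow> Arg2pi (cis \<theta>) = \<theta>"
  by (rule Arg2pi_unique[of 1]) (auto simp: cis_conv_exp)

text \<open>
  A Lebesgue measurable function on the line is an almost everywhere limit of continuous functions.
  Truncating these to the bound of \<open>f\<close> allows dominated convergence, and cutting them off at both ends of the
  period makes them continuous on the circle.
\<close>

lemma L2_approximation_on_circle:
  fixes f :: "real \<Rightarrow> real"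
  assumes f: "f \<in> borel_measurable (lebesgue_on {0..<2*pi})"
    and bound: "AE \<theta> in lebesgue_on {0..<2*pi}. \<bar>f \<theta>\<bar> \<le> B" and "B \<ge> 0" "\<eta> > 0"
  obtains h :: "complex \<Rightarrow> real" where "continuous_on (sphere 0 1) h" "\<And>z. \<bar>h z\<bar> \<le> B"
    "(LINT \<theta>|lebesgue_on {0..<2*pi}. (f \<theta> - h (cis \<theta>))\<^sup>2) < \<eta>"
proof -
  let ?L = "lebesgue_on {0..<2*pi}"
  have "f measurable_on {0..<2*pi}" using f by (subst measurable_on_iff_borel_measurable) auto
  then obtain X g where X: "negligible X" and gc: "\<And>n. continuous_on UNIV (g n)"
    and gl: "\<And>\<theta>. \<theta> \<notin> X \<Longrightarrow> (\<lambda>n. g n \<theta>) \<longlonglongrightarrow> (if \<theta> \<in> {0..<2*pi} then f \<theta> else 0)"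
    unfolding measurable_on_def by blast
  \<comment> \<open>The cut-off vanishes at 0 and \<open>2 * pi\<close> and tends to 1 in between.\<close>
  define \<kappa> :: "nat \<Rightarrow> real \<Rightarrow> real"
    where "\<kappa> n \<theta> = max 0 (min 1 (real n * \<theta>)) * max 0 (min 1 (real n * (2 * pi - \<theta>)))" for n \<theta>
  define k where "k n \<theta> = max (-B) (min B (g n \<theta>)) * \<kappa> n \<theta>" for n \<theta>
  have kc: "continuous_on UNIV (k n)" for n
    unfolding k_def \<kappa>_def by (intro continuous_intros gc)
  have \<kappa>1: "0 \<le> \<kappa> n \<theta>" "\<kappa> n \<theta> \<le> 1" for n \<theta>
    unfolding \<kappa>_def by (auto intro!: mult_le_one)
  have kb: "\<bar>k n \<theta>\<bar> \<le> B" for n \<theta>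
  proof -
    have "\<bar>k n \<theta>\<bar> = \<bar>max (-B) (min B (g n \<theta>))\<bar> * \<kappa> n \<theta>" using \<kappa>1 by (simp add: k_def abs_mult)
    also have "\<dots> \<le> B * 1" using \<kappa>1 \<open>B \<ge> 0\<close> by (intro mult_mono) auto
    finally show ?thesis by simp
  qed
  have \<kappa>lim: "(\<lambda>n. \<kappa> n \<theta>) \<longlonglongrightarrow> 1" if \<theta>: "0 < \<theta>" "\<theta> < 2 * pi" for \<theta>
  proof -
    have ev: "\<forall>\<^sub>F n in sequentially. real n * x \<ge> 1" if "x > 0" for x
    proof -
      obtain m where "1 / x < real m" using reals_Archimedean2 by blast
      then have "1 < real m * x" using \<open>x > 0\<close> by (simp add: field_simps)
      moreover have "real m * x \<le> real n * x" if "n \<ge> m" for n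
        using that \<open>x > 0\<close> by (intro mult_right_mono) auto
      ultimately have "real n * x \<ge> 1" if "n \<ge> m" for n
        using that by fastforce
      then show ?thesis by (auto simp: eventually_sequentially)
    qed
    have that': "0 < 2 * pi - \<theta>" using \<theta>(2) by simp
    show ?thesis
    proof (rule tendsto_eventually)
      show "\<forall>\<^sub>F n in sequentially. \<kappa> n \<theta> = 1"
        using ev[OF \<theta>(1)] ev[OF that']
      proof eventually_elim
        case (elim n)
        then show ?case by (simp add: \<kappa>_def min_absorb1)
      qed
    qed
  qed
  have k0: "k n 0 = k n (2 * pi)" for n by (simp add: k_def \<kappa>_def)
  have kL: "k n \<in> borel_measurable ?L" for n
    by (intro measurable_restrict_space1 measurable_completion) (use borel_measurable_continuous_onI[OF kc] in simp)
  have fin: "finite_measure ?L" by (intro finite_measure_lebesgue_on bounded_set_imp_lmeasurable) auto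
  have Xae: "AE \<theta> in ?L. \<theta> \<in> {0..<2*pi} \<and> \<theta> \<notin> insert 0 X"
  proof -
    have "insert 0 X \<in> null_sets lebesgue" using X by (simp add: negligible_iff_null_sets[symmetric] negligible_insert)
    then have "AE \<theta> in lebesgue. \<theta> \<notin> insert 0 X" by (rule AE_not_in)
    then have "AE \<theta> in lebesgue. \<theta> \<in> {0..<2*pi} \<longrightarrow> \<theta> \<in> {0..<2*pi} \<and> \<theta> \<notin> insert 0 X"
      by eventually_elim simp
    then show ?thesis by (subst AE_restrict_space_iff) auto
  qed
  have "(\<lambda>n. LINT \<theta>|?L. (f \<theta> - k n \<theta>)\<^sup>2) \<longlonglongrightarrow> (LINT \<theta>|?L. 0)"
  proof (rule integral_dominated_convergence[where w="\<lambda>_. (2 * B)\<^sup>2"])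
    show "integrable ?L (\<lambda>_. (2 * B)\<^sup>2)" using fin by (intro finite_measure.integrable_const)
    show "(\<lambda>\<theta>. (f \<theta> - k n \<theta>)\<^sup>2) \<in> borel_measurable ?L" for n using f kL by measurable
    show "AE \<theta> in ?L. norm ((f \<theta> - k n \<theta>)\<^sup>2) \<le> (2 * B)\<^sup>2" for n
      using bound
    proof eventually_elim
      case (elim \<theta>)
      have "\<bar>f \<theta> - k n \<theta>\<bar> \<le> 2 * B" using elim kb[of n \<theta>] by linarith
      then have "\<bar>f \<theta> - k n \<theta>\<bar>\<^sup>2 \<le> (2 * B)\<^sup>2" by (intro power_mono) auto
      then show ?case by simp
    qed
    show "AE \<theta> in ?L. (\<lambda>n. (f \<theta> - k n \<theta>)\<^sup>2) \<longlonglongrightarrow> 0"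
      using bound Xae
    proof eventually_elim
      case (elim \<theta>)
      then have "(\<lambda>n. g n \<theta>) \<longlonglongrightarrow> f \<theta>" using gl[of \<theta>] by simp
      then have "(\<lambda>n. max (-B) (min B (g n \<theta>))) \<longlonglongrightarrow> max (-B) (min B (f \<theta>))"
        by (intro tendsto_intros)
      also have "max (-B) (min B (f \<theta>)) = f \<theta>" using elim by auto
      finally have "(\<lambda>n. k n \<theta>) \<longlonglongrightarrow> f \<theta> * 1"
        unfolding k_def using \<kappa>lim[of \<theta>] elim by (intro tendsto_mult) auto
      then have "(\<lambda>n. (f \<theta> - k n \<theta>)\<^sup>2) \<longlonglongrightarrow> (f \<theta> - f \<theta> * 1)\<^sup>2" by (intro tendsto_intros)
      then show ?case by simp
    qed
  qed simp
  then have "\<forall>\<^sub>F n in sequentially. (LINT \<theta>|?L. (f \<theta> - k n \<theta>)\<^sup>2) < \<eta>"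
    using \<open>\<eta> > 0\<close> by (intro order_tendstoD) auto
  then obtain n where n: "(LINT \<theta>|?L. (f \<theta> - k n \<theta>)\<^sup>2) < \<eta>"
    by (auto simp: eventually_sequentially)
  have "(LINT \<theta>|?L. (f \<theta> - k n (Arg2pi (cis \<theta>)))\<^sup>2) = (LINT \<theta>|?L. (f \<theta> - k n \<theta>)\<^sup>2)"
    by (intro Bochner_Integration.integral_cong refl) (auto simp: Arg2pi_cis)
  with n continuous_on_circle_of_loop[OF kc k0] kb show ?thesis
    by (intro that[of "\<lambda>z. k n (Arg2pi z)"]) auto
qed

text \<open>
  One half of the bound accounts for the displacement at the fixed scale \<open>|z|\<close>, the other half for the
  difference of the moduli. The case \<open>w = 0\<close>, where \<open>sgn w = 0\<close>, is covered as well.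
\<close>

lemma sgn_diff_le:
  fixes z w :: complex
  assumes "z \<noteq> 0"
  shows "cmod (sgn z - sgn w) \<le> 2 * cmod (z - w) / cmod z"
proof (cases "w = 0")
  case True
  then show ?thesis using assms by (simp add: norm_sgn)
next
  case False
  have "sgn z - sgn w = (z - w) /\<^sub>R cmod z + (inverse (cmod z) - inverse (cmod w)) *\<^sub>R w"
    by (simp add: sgn_div_norm algebra_simps scaleR_diff_right)
  also have "cmod \<dots> \<le> cmod ((z - w) /\<^sub>R cmod z) + cmod ((inverse (cmod z) - inverse (cmod w)) *\<^sub>R w)"
    by (rule norm_triangle_ineq)
  also have "cmod ((inverse (cmod z) - inverse (cmod w)) *\<^sub>R w) = \<bar>(inverse (cmod z) - inverse (cmod w)) * cmod w\<bar>"
    by (simp add: abs_mult)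
  also have "(inverse (cmod z) - inverse (cmod w)) * cmod w = (cmod w - cmod z) / cmod z"
    using assms False by (simp add: field_simps)
  also have "\<bar>(cmod w - cmod z) / cmod z\<bar> \<le> cmod (z - w) / cmod z"
    using norm_triangle_ineq3[of w z] by (simp add: norm_minus_commute divide_right_mono)
  finally show ?thesis by (simp add: divide_inverse mult.commute)
qed

lemma integrable_kernel_bounded:
  fixes f :: "complex \<times> complex \<Rightarrow> real"
  assumes f: "f \<in> borel_measurable gauss2" and bound: "\<And>p. \<bar>f p\<bar> \<le> C"
  shows "integrable gauss2 (\<lambda>p. f p * kernel_weight N p)"
proof (rule Bochner_Integration.integrable_bound)
  have K: "integrable gauss2 (\<lambda>p. kernel_weight N p)"
    using integrable_kernel_fst[of "\<lambda>_. 1" 1 N] by simp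
  then show "integrable gauss2 (\<lambda>p. C * kernel_weight N p)" by auto
  show "(\<lambda>p. f p * kernel_weight N p) \<in> borel_measurable gauss2"
    by (intro borel_measurable_times f borel_measurable_integrable[OF K])
  have "0 \<le> C" using order_trans[OF abs_ge_zero bound] .
  then show "AE p in gauss2. norm (f p * kernel_weight N p)
      \<le> norm (C * kernel_weight N p)"
    using bound by (intro AE_I2) (simp add: kernel_weight_def abs_mult mult_right_mono del: split_paired_All)
qed

text \<open>
  The symbol \<open>\<sigma>\<close> is compared with a function \<open>q\<close> whose variation is controlled by the direction alone.
  Outside the disc of radius \<open>R\<close> the variation of the direction is at most \<open>2 |z - w| / R\<close>, which is summed by
  \<open>integral_kernel_dist\<close>; inside the disc it is at most 2, and the weight of the disc is bounded.
\<close>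

lemma oscillation_estimate:
  fixes \<sigma> q :: "complex \<Rightarrow> real"
  assumes \<sigma>: "\<sigma> \<in> borel_measurable gauss" "\<And>z. \<bar>\<sigma> z\<bar> \<le> B"
    and q: "q \<in> borel_measurable gauss" "\<And>z. \<bar>q z\<bar> \<le> B"
    and osc: "\<And>z w. (q z - q w)\<^sup>2 \<le> e + M * (cmod (sgn z - sgn w))\<^sup>2"
    and "M \<ge> 0" "R > 0"
  shows "(LINT p|gauss2. (\<sigma> (fst p) - \<sigma> (snd p))\<^sup>2 * kernel_weight N p)
    \<le> 3 * ((e + 8 * M / R\<^sup>2) * real (N + 1) + 4 * M * exp (R\<^sup>2)
        + 2 * (LINT z|gauss. (\<sigma> z - q z)\<^sup>2 * fock_density N z))"
proof -
  define d where "d z = (\<sigma> z - q z)\<^sup>2" for z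
  define \<iota> where "\<iota> = (indicator (ball 0 R) :: complex \<Rightarrow> real)"
  have \<iota>m: "\<iota> \<in> borel_measurable gauss"
    unfolding \<iota>_def by (intro borel_imp_gauss_measurable borel_measurable_indicator) simp
  have \<iota>b: "\<bar>\<iota> z\<bar> \<le> 1" for z by (simp add: \<iota>_def indicator_def)
  have dm: "d \<in> borel_measurable gauss" unfolding d_def using \<sigma>(1) q(1) by measurable
  have sqb: "(x - y)\<^sup>2 \<le> (2 * B)\<^sup>2" if "\<bar>x\<bar> \<le> B" "\<bar>y\<bar> \<le> B" for x y
  proof -
    have "\<bar>x - y\<bar> \<le> 2 * B" using that by linarith
    then have "\<bar>x - y\<bar>\<^sup>2 \<le> (2 * B)\<^sup>2" by (intro power_mono) auto
    then show ?thesis by simp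
  qed
  have db: "\<bar>d z\<bar> \<le> (2 * B)\<^sup>2" for z using sqb[OF \<sigma>(2) q(2)] by (simp add: d_def)
  note I' = integrable_kernel_fst[of "\<lambda>_. 1" 1 N, simplified] integrable_kernel_dist[of N]
    integrable_kernel_fst[OF \<iota>m \<iota>b, of N] integrable_kernel_fst[OF dm db, of N] integrable_kernel_snd[OF dm db, of N]
    have pw: "(\<sigma> z - \<sigma> w)\<^sup>2 \<le> 3 * (e + 4 * M / R\<^sup>2 * (cmod (z - w))\<^sup>2 + 4 * M * \<iota> z + d z + d w)" for z w
  proof -
    have "(a + b + c)\<^sup>2 \<le> 3 * (a\<^sup>2 + b\<^sup>2 + c\<^sup>2)" for a b c :: real
      using sum_squares_bound[of a b] sum_squares_bound[of b c] sum_squares_bound[of a c]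
      by (simp add: power2_eq_square algebra_simps)
    from this[of "q z - q w" "\<sigma> z - q z" "q w - \<sigma> w"]
    have "(\<sigma> z - \<sigma> w)\<^sup>2 \<le> 3 * ((q z - q w)\<^sup>2 + d z + d w)"
      by (simp add: d_def power2_commute)
    moreover have "(cmod (sgn z - sgn w))\<^sup>2 \<le> 4 / R\<^sup>2 * (cmod (z - w))\<^sup>2 + 4 * \<iota> z"
    proof (cases "z \<in> ball 0 R")
      case True
      have "cmod (sgn z - sgn w) \<le> 2"
        using norm_triangle_ineq4[of "sgn z" "sgn w"] by (simp add: norm_sgn split: if_splits)
      then have "(cmod (sgn z - sgn w))\<^sup>2 \<le> 2\<^sup>2" by (intro power_mono) auto
      then show ?thesis using True by (simp add: \<iota>_def add_increasing)
    next
      case False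
      then have z: "R \<le> cmod z" "z \<noteq> 0" using \<open>R > 0\<close> by auto
      have "cmod (sgn z - sgn w) \<le> 2 * cmod (z - w) / cmod z" by (rule sgn_diff_le[OF z(2)])
      also have "\<dots> \<le> 2 * cmod (z - w) / R" using z(1) \<open>R > 0\<close> by (intro divide_left_mono mult_pos_pos) auto
      finally have "(cmod (sgn z - sgn w))\<^sup>2 \<le> (2 * cmod (z - w) / R)\<^sup>2" by (intro power_mono) auto
      then show ?thesis using False by (simp add: \<iota>_def power_divide power_mult_distrib)
    qed
    then have "M * (cmod (sgn z - sgn w))\<^sup>2 \<le> M * (4 / R\<^sup>2 * (cmod (z - w))\<^sup>2 + 4 * \<iota> z)"
      using \<open>M \<ge> 0\<close> by (rule mult_left_mono)
    then have "(q z - q w)\<^sup>2 \<le> e + 4 * M / R\<^sup>2 * (cmod (z - w))\<^sup>2 + 4 * M * \<iota> z"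
      using osc[of z w] by (simp add: algebra_simps)
    then have "3 * ((q z - q w)\<^sup>2 + d z + d w)
        \<le> 3 * (e + 4 * M / R\<^sup>2 * (cmod (z - w))\<^sup>2 + 4 * M * \<iota> z + d z + d w)" by simp
    ultimately show ?thesis by (rule order_trans)
  qed
  have "(LINT p|gauss2. (\<sigma> (fst p) - \<sigma> (snd p))\<^sup>2 * kernel_weight N p)
      \<le> (LINT p|gauss2. 3 * (e * kernel_weight N p + 4 * M / R\<^sup>2 * ((cmod (fst p - snd p))\<^sup>2 * kernel_weight N p)
          + 4 * M * (\<iota> (fst p) * kernel_weight N p) + d (fst p) * kernel_weight N p + d (snd p) * kernel_weight N p))"
  proof (rule integral_mono)
    have "(\<lambda>p. (\<sigma> (fst p) - \<sigma> (snd p))\<^sup>2) \<in> borel_measurable gauss2"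
      using measurable_compose[OF measurable_fst \<sigma>(1), of gauss] measurable_compose[OF measurable_snd \<sigma>(1), of gauss]
      by measurable
    then show "integrable gauss2 (\<lambda>p. (\<sigma> (fst p) - \<sigma> (snd p))\<^sup>2 * kernel_weight N p)"
      by (rule integrable_kernel_bounded[where C="(2 * B)\<^sup>2"]) (simp only: abs_power2 sqb \<sigma>(2))
    show "integrable gauss2 (\<lambda>p. 3 * (e * kernel_weight N p + 4 * M / R\<^sup>2 * ((cmod (fst p - snd p))\<^sup>2 * kernel_weight N p)
          + 4 * M * (\<iota> (fst p) * kernel_weight N p) + d (fst p) * kernel_weight N p + d (snd p) * kernel_weight N p))"
      by (intro integrable_mult_right Bochner_Integration.integrable_add I')
    fix p
    have "kernel_weight N p \<ge> 0" by (simp add: kernel_weight_def)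
    from mult_right_mono[OF pw[of "fst p" "snd p"] this]
    show "(\<sigma> (fst p) - \<sigma> (snd p))\<^sup>2 * kernel_weight N p \<le> 3 * (e * kernel_weight N p + 4 * M / R\<^sup>2 * ((cmod (fst p - snd p))\<^sup>2 * kernel_weight N p)
          + 4 * M * (\<iota> (fst p) * kernel_weight N p) + d (fst p) * kernel_weight N p + d (snd p) * kernel_weight N p)"
      by (simp add: algebra_simps)
  qed
  also have "\<dots> = 3 * (e * (LINT p|gauss2. kernel_weight N p) + 4 * M / R\<^sup>2 * (LINT p|gauss2. (cmod (fst p - snd p))\<^sup>2 * kernel_weight N p)
          + 4 * M * (LINT p|gauss2. \<iota> (fst p) * kernel_weight N p) + (LINT p|gauss2. d (fst p) * kernel_weight N p) + (LINT p|gauss2. d (snd p) * kernel_weight N p))"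
    by (simp only: Bochner_Integration.integral_add integral_mult_right_zero
        Bochner_Integration.integrable_add integrable_mult_right I')
  also have "(LINT p|gauss2. kernel_weight N p) = real (N + 1)"
    using integral_kernel_fst[of "\<lambda>_. 1" 1 N] by (simp add: integral_fock_density)
  also have "(LINT p|gauss2. (cmod (fst p - snd p))\<^sup>2 * kernel_weight N p) = 2 * real (N + 1)"
    by (rule integral_kernel_dist)
  also have "(LINT p|gauss2. \<iota> (fst p) * kernel_weight N p) = (LINT z|gauss. \<iota> z * fock_density N z)"
    by (rule integral_kernel_fst[OF \<iota>m \<iota>b])
  also have "(LINT p|gauss2. d (fst p) * kernel_weight N p) = (LINT z|gauss. d z * fock_density N z)"
    by (rule integral_kernel_fst[OF dm db])
  also have "(LINT p|gauss2. d (snd p) * kernel_weight N p) = (LINT z|gauss. d z * fock_density N z)"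
    by (rule integral_kernel_snd[OF dm db])
  finally have "(LINT p|gauss2. (\<sigma> (fst p) - \<sigma> (snd p))\<^sup>2 * kernel_weight N p)
      \<le> 3 * ((e + 8 * M / R\<^sup>2) * real (N + 1) + 4 * M * (LINT z|gauss. \<iota> z * fock_density N z)
        + 2 * (LINT z|gauss. d z * fock_density N z))"
    by (simp add: algebra_simps)
  moreover have "4 * M * (LINT z|gauss. \<iota> z * fock_density N z) \<le> 4 * M * exp (R\<^sup>2)"
    unfolding \<iota>_def using \<open>M \<ge> 0\<close> by (intro mult_left_mono integral_fock_density_ball_le) auto
  then have "3 * ((e + 8 * M / R\<^sup>2) * real (N + 1) + 4 * M * (LINT z|gauss. \<iota> z * fock_density N z)
        + 2 * (LINT z|gauss. d z * fock_density N z))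
      \<le> 3 * ((e + 8 * M / R\<^sup>2) * real (N + 1) + 4 * M * exp (R\<^sup>2)
        + 2 * (LINT z|gauss. d z * fock_density N z))" by simp
  ultimately show ?thesis unfolding d_def by (rule order_trans)
qed

lemma AE_radial_limit_compose:
  assumes "has_radial_limit \<sigma> \<sigma>'"
    and "\<And>\<theta>. ((\<lambda>r. \<sigma> (complex_of_real r * cis \<theta>)) \<longlongrightarrow> \<sigma>' \<theta>) at_top \<Longrightarrow> P \<theta>"
  shows "AE \<theta> in lebesgue_on {0..<2*pi}. P \<theta>"
  using assms(1) unfolding has_radial_limit_def by eventually_elim (rule assms(2))

text \<open>
  The approximating function is \<open>q z = h (sgn z)\<close> with \<open>h\<close> continuous on the circle and close to the radial
  limit in \<open>L\<^sup>2\<close>. In \<open>oscillation_estimate\<close>, divided by \<open>N + 1\<close>, each of the five contributions is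
  eventually at most \<open>\<eta>\<close>: the two from the variation of \<open>q\<close> by the choice of \<open>h\<close> and \<open>R\<close>, that of the disc because it is
  bounded in \<open>N\<close>, and the two copies of the approximation error by \<open>radial_limit_average\<close>.
\<close>

theorem kernel_oscillation_tendsto_0:
  fixes \<sigma> :: "complex \<Rightarrow> real"
  assumes \<sigma>: "\<sigma> \<in> borel_measurable gauss" "\<And>z. \<bar>\<sigma> z\<bar> \<le> B" and lim: "has_radial_limit \<sigma> \<sigma>'"
  shows "(\<lambda>N. (LINT p|gauss2. (\<sigma> (fst p) - \<sigma> (snd p))\<^sup>2 * kernel_weight N p) / real (N + 1))
    \<longlonglongrightarrow> 0"
proof (rule tendstoI)
  let ?L = "lebesgue_on {0..<2*pi}"
  let ?V = "\<lambda>N. (LINT p|gauss2. (\<sigma> (fst p) - \<sigma> (snd p))\<^sup>2 * kernel_weight N p)"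
  fix \<epsilon> :: real assume "\<epsilon> > 0"
  define \<eta> where "\<eta> = \<epsilon> / 15"
  have "\<eta> > 0" using \<open>\<epsilon> > 0\<close> by (simp add: \<eta>_def)
  have "B \<ge> 0" using order_trans[OF abs_ge_zero \<sigma>(2)] .
  have cl: "AE \<theta> in ?L. ((\<lambda>r. complex_of_real (\<sigma> (complex_of_real r * cis \<theta>))) \<longlongrightarrow> complex_of_real (\<sigma>' \<theta>)) at_top"
    by (rule AE_radial_limit_compose[OF lim]) (rule tendsto_of_real)
  have cm: "(\<lambda>z. complex_of_real (\<sigma> z)) \<in> borel_measurable gauss" using \<sigma>(1) by measurable
  have cb: "cmod (complex_of_real (\<sigma> z)) \<le> B" for z using \<sigma>(2) by simp
  have "(\<lambda>\<theta>. Re (complex_of_real (\<sigma>' \<theta>))) \<in> borel_measurable ?L"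
    by (rule measurable_compose[OF radial_limit_measurable[OF cm cb cl]]) measurable
  then have \<sigma>'m: "\<sigma>' \<in> borel_measurable ?L" by simp
  have \<sigma>'b: "AE \<theta> in ?L. \<bar>\<sigma>' \<theta>\<bar> \<le> B" using radial_limit_bound[OF cm cb cl] by simp
  obtain h where hc: "continuous_on (sphere 0 1) h" and hb: "\<And>z. \<bar>h z\<bar> \<le> B"
    and happ: "(LINT \<theta>|?L. (\<sigma>' \<theta> - h (cis \<theta>))\<^sup>2) < \<eta>"
    using L2_approximation_on_circle[OF \<sigma>'m \<sigma>'b \<open>B \<ge> 0\<close> \<open>\<eta> > 0\<close>] by blast
  \<comment> \<open>The origin is adjoined because \<open>sgn 0 = 0\<close>; being isolated, it does not affect continuity.\<close>
  have hc': "continuous_on (insert 0 (sphere 0 1)) h"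
  proof -
    have "continuous_on ({0} \<union> sphere 0 1) h"
      by (intro continuous_on_closed_Un hc) auto
    then show ?thesis by simp
  qed
  have "compact (insert 0 (sphere 0 1 :: complex set))" by simp
  then obtain M where "M \<ge> 0"
    and M: "\<And>u v. u \<in> insert 0 (sphere 0 1) \<Longrightarrow> v \<in> insert 0 (sphere 0 1)
        \<Longrightarrow> norm (h u - h v) \<le> \<eta> / (2 * B + 1) + M * (dist u v)\<^sup>2"
    using compact_quadratic_modulus[OF _ hc', of "\<eta> / (2 * B + 1)"] \<open>\<eta> > 0\<close> \<open>B \<ge> 0\<close> by auto
  define q where "q z = h (sgn z)" for z
  have qb: "\<bar>q z\<bar> \<le> B" for z by (simp add: q_def hb)
  \<comment> \<open>The modulus bounds \<open>|q z - q w|\<close>; the second factor of the square is at most \<open>2 * B\<close>.\<close>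
  have osc: "(q z - q w)\<^sup>2 \<le> \<eta> + (2 * B * M) * (cmod (sgn z - sgn w))\<^sup>2" for z w
  proof -
    have "sgn x \<in> insert 0 (sphere 0 1)" for x :: complex by (simp add: norm_sgn)
    then have le: "\<bar>q z - q w\<bar> \<le> \<eta> / (2 * B + 1) + M * (cmod (sgn z - sgn w))\<^sup>2"
      using M[of "sgn z" "sgn w"] by (simp add: q_def dist_norm)
    have "\<bar>q z - q w\<bar> \<le> 2 * B" using qb[of z] qb[of w] by linarith
    then have "\<bar>q z - q w\<bar> * \<bar>q z - q w\<bar> \<le> (2 * B) * (\<eta> / (2 * B + 1) + M * (cmod (sgn z - sgn w))\<^sup>2)"
      using le \<open>B \<ge> 0\<close> by (intro mult_mono) auto
    also have "\<dots> = (2 * B) * \<eta> / (2 * B + 1) + (2 * B * M) * (cmod (sgn z - sgn w))\<^sup>2"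
      by (simp add: algebra_simps)
    also have "(2 * B) * \<eta> / (2 * B + 1) \<le> \<eta>" using \<open>B \<ge> 0\<close> \<open>\<eta> > 0\<close> by (simp add: field_simps)
    finally show ?thesis by (simp add: power2_eq_square)
  qed
  have qm: "q \<in> borel_measurable gauss"
  proof (rule borel_imp_gauss_measurable)
    have "continuous_on (- {0}) (\<lambda>z::complex. h (sgn z))"
      by (rule continuous_on_compose2[OF hc]) (auto intro!: continuous_intros simp: norm_sgn split: if_splits)
    then have "(\<lambda>z. if z \<in> {0} then h 0 else h (sgn z)) \<in> borel_measurable borel"
      by (intro borel_measurable_continuous_on_if) auto
    also have "(\<lambda>z. if z \<in> {0} then h 0 else h (sgn z)) = q" by (auto simp: q_def fun_eq_iff)
    finally show "q \<in> borel_measurable borel" .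
  qed
  define M' where "M' = 2 * B * M"
  have "M' \<ge> 0" using \<open>M \<ge> 0\<close> \<open>B \<ge> 0\<close> by (simp add: M'_def)
  define R where "R = sqrt (8 * (M' + 1) / \<eta>)"
  have "R > 0" using \<open>M' \<ge> 0\<close> \<open>\<eta> > 0\<close> by (simp add: R_def)
  have R2: "8 * M' / R\<^sup>2 \<le> \<eta>" using \<open>M' \<ge> 0\<close> \<open>\<eta> > 0\<close> by (simp add: R_def field_simps)
  let ?A = "\<lambda>N. (LINT z|gauss. (\<sigma> z - q z)\<^sup>2 * fock_density N z)"
  define a where "a = (LINT \<theta>|?L. (\<sigma>' \<theta> - h (cis \<theta>))\<^sup>2 / (2 * pi))"
  have Alim: "(\<lambda>N. ?A N / real (N + 1)) \<longlonglongrightarrow> a"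
  proof -
    have 1: "(\<lambda>z. complex_of_real ((\<sigma> z - q z)\<^sup>2)) \<in> borel_measurable gauss" using \<sigma>(1) qm by measurable
    have 2: "cmod (complex_of_real ((\<sigma> z - q z)\<^sup>2)) \<le> (2 * B)\<^sup>2" for z
    proof -
      have "\<bar>\<sigma> z - q z\<bar> \<le> 2 * B" using \<sigma>(2)[of z] qb[of z] by linarith
      then have "\<bar>\<sigma> z - q z\<bar>\<^sup>2 \<le> (2 * B)\<^sup>2" by (intro power_mono) auto
      then show ?thesis by (simp only: norm_of_real abs_power2 power2_abs)
    qed
    have 3: "AE \<theta> in ?L. ((\<lambda>r. complex_of_real ((\<sigma> (complex_of_real r * cis \<theta>) - q (complex_of_real r * cis \<theta>))\<^sup>2))
        \<longlongrightarrow> complex_of_real ((\<sigma>' \<theta> - h (cis \<theta>))\<^sup>2)) at_top"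
    proof (rule AE_radial_limit_compose[OF lim])
      fix \<theta> assume l: "((\<lambda>r. \<sigma> (complex_of_real r * cis \<theta>)) \<longlongrightarrow> \<sigma>' \<theta>) at_top"
      have "\<forall>\<^sub>F r in at_top. q (complex_of_real r * cis \<theta>) = h (cis \<theta>)"
        using eventually_gt_at_top[of 0]
        by eventually_elim (simp add: q_def sgn_div_norm norm_mult scaleR_conv_of_real flip: mult.assoc)
      then have "((\<lambda>r. q (complex_of_real r * cis \<theta>)) \<longlongrightarrow> h (cis \<theta>)) at_top"
        by (rule tendsto_eventually)
      with l show "((\<lambda>r. complex_of_real ((\<sigma> (complex_of_real r * cis \<theta>) - q (complex_of_real r * cis \<theta>))\<^sup>2))
        \<longlongrightarrow> complex_of_real ((\<sigma>' \<theta> - h (cis \<theta>))\<^sup>2)) at_top"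
        by (intro tendsto_intros)
    qed
    have "(LINT z|gauss. complex_of_real ((\<sigma> z - q z)\<^sup>2) * complex_of_real (fock_density N z)) / of_nat (N + 1)
        = complex_of_real (?A N / real (N + 1))" for N
      by (simp only: of_real_mult[symmetric] integral_complex_of_real of_real_divide of_real_of_nat_eq)
    moreover have "(LINT \<theta>|?L. complex_of_real ((\<sigma>' \<theta> - h (cis \<theta>))\<^sup>2) / complex_of_real (2 * pi)) = complex_of_real a"
      by (simp only: a_def of_real_divide[symmetric] integral_complex_of_real)
    ultimately have "(\<lambda>N. complex_of_real (?A N / real (N + 1))) \<longlonglongrightarrow> complex_of_real a"
      using radial_limit_average[OF 1 2 3] by (simp only:)
    then show ?thesis by (simp only: tendsto_of_real_iff)
  qed
  have "a = (LINT \<theta>|?L. (\<sigma>' \<theta> - h (cis \<theta>))\<^sup>2) / (2 * pi)" unfolding a_def by simp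
  also have "\<dots> < \<eta>"
  proof -
    have "1 \<le> 2 * pi" using pi_ge_two by linarith
    then have "(LINT \<theta>|?L. (\<sigma>' \<theta> - h (cis \<theta>))\<^sup>2) / (2 * pi) \<le> (LINT \<theta>|?L. (\<sigma>' \<theta> - h (cis \<theta>))\<^sup>2) / 1"
      by (intro divide_left_mono) auto
    then show ?thesis using happ by simp
  qed
  finally have "\<forall>\<^sub>F N in sequentially. ?A N / real (N + 1) < \<eta>" by (rule order_tendstoD(2)[OF Alim])
  moreover have "(\<lambda>N. 4 * M' * exp (R\<^sup>2) / real (N + 1)) \<longlonglongrightarrow> 0"
    using LIMSEQ_ignore_initial_segment[OF lim_const_over_n[of "4 * M' * exp (R\<^sup>2)"], of 1] by simp
  then have "\<forall>\<^sub>F N in sequentially. 4 * M' * exp (R\<^sup>2) / real (N + 1) < \<eta>"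
    using \<open>\<eta> > 0\<close> by (rule order_tendstoD(2))
  ultimately show "\<forall>\<^sub>F N in sequentially. dist (?V N / real (N + 1)) 0 < \<epsilon>"
  proof eventually_elim
    case (elim N)
    have "?V N \<le> 3 * ((\<eta> + 8 * M' / R\<^sup>2) * real (N + 1) + 4 * M' * exp (R\<^sup>2) + 2 * ?A N)"
      by (rule oscillation_estimate[OF \<sigma> qm qb osc[folded M'_def] \<open>M' \<ge> 0\<close> \<open>R > 0\<close>])
    then have "?V N / real (N + 1) \<le> 3 * ((\<eta> + 8 * M' / R\<^sup>2) * real (N + 1) + 4 * M' * exp (R\<^sup>2) + 2 * ?A N) / real (N + 1)"
      by (rule divide_right_mono) simp
    also have "\<dots> = 3 * ((\<eta> + 8 * M' / R\<^sup>2) + 4 * M' * exp (R\<^sup>2) / real (N + 1) + 2 * (?A N / real (N + 1)))"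
    proof -
      have alg: "3 * (x * y + u + 2 * v) / y = 3 * (x + u / y + 2 * (v / y))" if "y \<noteq> 0" for x y u v :: real
        using that by (simp add: field_simps)
      show ?thesis by (rule alg) simp
    qed
    also have "\<dots> < 3 * ((\<eta> + \<eta>) + \<eta> + 2 * \<eta>)"
    proof -
      have "3 * ((\<eta> + x) + y + 2 * v) < 3 * ((\<eta> + \<eta>) + \<eta> + 2 * \<eta>)" if "x \<le> \<eta>" "y < \<eta>" "v < \<eta>" for x y v
        using that by simp
      from this[OF R2 elim(2,1)] show ?thesis .
    qed
    also have "\<dots> = \<epsilon>" by (simp add: \<eta>_def)
    finally have "?V N / real (N + 1) < \<epsilon>" .
    moreover have "?V N / real (N + 1) \<ge> 0" by (simp add: kernel_weight_def)
    ultimately show ?case by simp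
  qed
qed

section \<open>The limit of the eigenvalue distribution\<close>

theorem corollary4p3:
  fixes \<sigma> :: "complex \<Rightarrow> real" and \<sigma>' :: "real \<Rightarrow> real" and \<psi> :: "real \<Rightarrow> complex"
  assumes "\<sigma> \<in> borel_measurable gauss"
    and "bounded (range \<sigma>)"
    and "has_radial_limit \<sigma> \<sigma>'"
    and "continuous_on {(INF z. \<sigma> z)..(SUP z. \<sigma> z)} \<psi>"
  shows "(\<lambda>N. trace_on_poly_space N
                (fun_calc_on (poly_space N) \<psi>
                  (compression N (toeplitz (\<lambda>z. complex_of_real (\<sigma> z))))) / of_nat (N + 1))
           \<longlonglongrightarrow> (LINT \<theta>|lebesgue_on {0..<2*pi}. \<psi> (\<sigma>' \<theta>) / complex_of_real (2 * pi))"
proof -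
  let ?L = "lebesgue_on {0..<2*pi}"
  define a b where "a = (INF z. \<sigma> z)" and "b = (SUP z. \<sigma> z)"
  obtain B where B: "\<And>z. \<bar>\<sigma> z\<bar> \<le> B" using assms(2) by (auto simp: bounded_iff)
  have \<sigma>ab: "\<sigma> z \<in> {a..b}" for z
    using bounded_imp_bdd_below[OF assms(2)] bounded_imp_bdd_above[OF assms(2)]
    by (auto simp: a_def b_def intro: cINF_lower cSUP_upper)
  then have "a \<le> b" using atLeastatMost_empty_iff2 by fastforce
  \<comment> \<open>Composition with \<open>clamp'\<close> extends \<open>\<psi>\<close> continuously to the line, which makes \<open>\<psi> \<circ> \<sigma>\<close> measurable.\<close>
  define clamp' where "clamp' x = max a (min b x)" for x
  have clamp: "clamp' x \<in> {a..b}" "x \<in> {a..b} \<Longrightarrow> clamp' x = x" for x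
    using \<open>a \<le> b\<close> by (auto simp: clamp'_def)
  define \<phi> where "\<phi> x = \<psi> (clamp' x)" for x
  have \<psi>c: "continuous_on {a..b} \<psi>" using assms(4) by (simp add: a_def b_def)
  have \<phi>c: "continuous_on UNIV \<phi>"
    unfolding \<phi>_def
    by (rule continuous_on_compose2[OF \<psi>c]) (use clamp in \<open>auto simp: clamp'_def intro!: continuous_intros\<close>)
  have "bounded (\<psi> ` {a..b})" using \<psi>c by (intro compact_imp_bounded compact_continuous_image) auto
  then obtain C where "\<forall>y\<in>\<psi> ` {a..b}. cmod y \<le> C" unfolding bounded_iff by blast
  then have C: "\<And>x. x \<in> {a..b} \<Longrightarrow> cmod (\<psi> x) \<le> C" by blast
  define s where "s z = \<psi> (\<sigma> z)" for z
  have s\<phi>: "s z = \<phi> (\<sigma> z)" for z using clamp(2)[OF \<sigma>ab] by (simp add: s_def \<phi>_def)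
  have sm: "s \<in> borel_measurable gauss"
    unfolding s\<phi>[abs_def] by (rule measurable_compose[OF assms(1) borel_measurable_continuous_onI[OF \<phi>c]])
  have sb: "cmod (s z) \<le> C" for z unfolding s_def by (rule C[OF \<sigma>ab])
  have slim: "AE \<theta> in ?L. ((\<lambda>r. s (complex_of_real r * cis \<theta>)) \<longlongrightarrow> \<psi> (\<sigma>' \<theta>)) at_top"
  proof (rule AE_radial_limit_compose[OF assms(3)])
    fix \<theta> assume l: "((\<lambda>r. \<sigma> (complex_of_real r * cis \<theta>)) \<longlongrightarrow> \<sigma>' \<theta>) at_top"
    have "\<sigma>' \<theta> \<in> {a..b}"
      by (rule Lim_in_closed_set[OF _ _ _ l]) (use \<sigma>ab in auto)
    moreover have "((\<lambda>r. \<phi> (\<sigma> (complex_of_real r * cis \<theta>))) \<longlongrightarrow> \<phi> (\<sigma>' \<theta>)) at_top"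
      by (rule continuous_on_tendsto_compose[OF \<phi>c l]) auto
    ultimately show "((\<lambda>r. s (complex_of_real r * cis \<theta>)) \<longlongrightarrow> \<psi> (\<sigma>' \<theta>)) at_top"
      unfolding s\<phi> by (simp add: \<phi>_def clamp)
  qed
  define D where "D N = (LINT z|gauss. s z * complex_of_real (fock_density N z))" for N
  define V where "V N = (LINT p|gauss2. (\<sigma> (fst p) - \<sigma> (snd p))\<^sup>2 * kernel_weight N p)" for N
  define t where "t N = trace_on_poly_space N (fun_calc_on (poly_space N) \<psi>
                  (compression N (toeplitz (\<lambda>z. complex_of_real (\<sigma> z)))))" for N
  have Dlim: "(\<lambda>N. D N / of_nat (N + 1)) \<longlonglongrightarrow> (LINT \<theta>|?L. \<psi> (\<sigma>' \<theta>) / complex_of_real (2 * pi))"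
    unfolding D_def by (rule radial_limit_average[OF sm sb slim])
  have Vlim: "(\<lambda>N. V N / real (N + 1)) \<longlonglongrightarrow> 0"
    unfolding V_def by (rule kernel_oscillation_tendsto_0[OF assms(1) B assms(3)])
  \<comment> \<open>Eigenvalue by eigenvalue, \<open>\<psi> (l j)\<close> is compared with the mean of \<open>\<psi> \<circ> \<sigma>\<close> for the density \<open>|F j|\<^sup>2\<close>.\<close>
  have est: "cmod (t N - D N) \<le> e * real (N + 1) + M / 2 * V N"
    if "M \<ge> 0" "e > 0" and M: "\<And>x y. x \<in> {a..b} \<Longrightarrow> y \<in> {a..b} \<Longrightarrow> cmod (\<psi> x - \<psi> y) \<le> e + M * (dist x y)\<^sup>2"
    for N e M
  proof -
    obtain F l where F: "orthonormal_on {..N} F"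
      and eig: "\<And>j k. j \<le> N \<Longrightarrow> k \<le> N \<Longrightarrow>
        inner_gauss (\<lambda>z. complex_of_real (\<sigma> z) * F j z) (F k) = (if j = k then complex_of_real (l j) else 0)"
      and K: "\<And>z w. (\<Sum>j\<le>N. F j z * cnj (F j w)) = (\<Sum>n\<le>N. fock_basis n z * cnj (fock_basis n w))"
      and trace: "\<And>f. trace_on_poly_space N (fun_calc_on (poly_space N) f
        (compression N (toeplitz (\<lambda>z. complex_of_real (\<sigma> z))))) = (\<Sum>j\<le>N. f (l j))"
      by (rule toeplitz_compression_eigenbasis[OF assms(1) B, where N=N]) (rule that)
    have tr: "t N = (\<Sum>j\<le>N. \<psi> (l j))" unfolding t_def by (rule trace)
    have FL2: "F j \<in> L2_gauss" if "j \<le> N" for j using orthonormal_onD(1)[OF F] that by simp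
    have i0: "integrable gauss (\<lambda>z. (cmod (F j z))\<^sup>2)" if "j \<le> N" for j using L2_gaussD(2)[OF FL2[OF that]] .
    have F1: "(LINT z|gauss. (cmod (F j z))\<^sup>2) = 1" if "j \<le> N" for j
      using orthonormal_on_l2sq[OF F] that by (simp add: l2sq_def)
    have lval: "(LINT z|gauss. \<sigma> z * (cmod (F j z))\<^sup>2) = l j" if "j \<le> N" for j
      using eig[OF that that] by (simp add: inner_gauss_weighted_self)
    have lab: "l j \<in> {a..b}" if "j \<le> N" for j
    proof -
      have "(LINT z|gauss. a * (cmod (F j z))\<^sup>2) \<le> (LINT z|gauss. \<sigma> z * (cmod (F j z))\<^sup>2)"
        "(LINT z|gauss. \<sigma> z * (cmod (F j z))\<^sup>2) \<le> (LINT z|gauss. b * (cmod (F j z))\<^sup>2)"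
        by (rule integral_mono; use \<sigma>ab i0[OF that] integrable_bounded_norm_square[OF assms(1) B FL2[OF that]] in \<open>auto intro: mult_right_mono\<close>)+
      then show ?thesis by (simp add: lval that F1)
    qed
    have dens: "complex_of_real (fock_density N z) = (\<Sum>j\<le>N. complex_of_real ((cmod (F j z))\<^sup>2))" for z
      unfolding fock_density_eq K[symmetric] complex_norm_square ..
    have iS: "integrable gauss (\<lambda>z. s z * complex_of_real ((cmod (F j z))\<^sup>2))" if "j \<le> N" for j
      using integrable_bounded_mult_L2[OF sm sb FL2[OF that] FL2[OF that]]
      by (simp only: complex_norm_square mult.assoc)
    have ic: "integrable gauss (\<lambda>z. \<psi> (l j) * complex_of_real ((cmod (F j z))\<^sup>2))" if "j \<le> N" for j
      using i0[OF that] by (intro integrable_mult_right) (simp only: complex_of_real_integrable_eq)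
    have D: "D N = (\<Sum>j\<le>N. LINT z|gauss. s z * complex_of_real ((cmod (F j z))\<^sup>2))"
      unfolding D_def dens sum_distrib_left using iS by (intro Bochner_Integration.integral_sum) auto
    have iv: "integrable gauss (\<lambda>z. (\<sigma> z - l j)\<^sup>2 * (cmod (F j z))\<^sup>2)" if "j \<le> N" for j
    proof (rule integrable_bounded_norm_square[OF _ _ FL2[OF that]])
      show "(\<lambda>z. (\<sigma> z - l j)\<^sup>2) \<in> borel_measurable gauss" using assms(1) by measurable
      show "\<bar>(\<sigma> z - l j)\<^sup>2\<bar> \<le> (b - a)\<^sup>2" for z
        using \<sigma>ab[of z] lab[OF that] by (auto simp: abs_le_square_iff[symmetric])
    qed
    have eig_diff: "cmod (\<psi> (l j) - (LINT z|gauss. s z * complex_of_real ((cmod (F j z))\<^sup>2)))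
        \<le> e + M * (LINT z|gauss. (\<sigma> z - l j)\<^sup>2 * (cmod (F j z))\<^sup>2)" if j: "j \<le> N" for j
    proof -
      have "(LINT z|gauss. \<psi> (l j) * complex_of_real ((cmod (F j z))\<^sup>2)) = \<psi> (l j)"
        by (simp only: integral_mult_right_zero integral_complex_of_real F1[OF j]) simp
      then have "\<psi> (l j) - (LINT z|gauss. s z * complex_of_real ((cmod (F j z))\<^sup>2))
          = (LINT z|gauss. \<psi> (l j) * complex_of_real ((cmod (F j z))\<^sup>2) - s z * complex_of_real ((cmod (F j z))\<^sup>2))"
        using ic[OF j] iS[OF j] by (simp add: Bochner_Integration.integral_diff)
      also have "cmod \<dots> \<le> (LINT z|gauss. cmod (\<psi> (l j) * complex_of_real ((cmod (F j z))\<^sup>2) - s z * complex_of_real ((cmod (F j z))\<^sup>2)))"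
        by (rule integral_norm_bound)
      also have "\<dots> \<le> (LINT z|gauss. e * (cmod (F j z))\<^sup>2 + M * ((\<sigma> z - l j)\<^sup>2 * (cmod (F j z))\<^sup>2))"
      proof (rule integral_mono)
        show "integrable gauss (\<lambda>z. cmod (\<psi> (l j) * complex_of_real ((cmod (F j z))\<^sup>2) - s z * complex_of_real ((cmod (F j z))\<^sup>2)))"
          using ic[OF j] iS[OF j] by (intro integrable_norm Bochner_Integration.integrable_diff)
        show "integrable gauss (\<lambda>z. e * (cmod (F j z))\<^sup>2 + M * ((\<sigma> z - l j)\<^sup>2 * (cmod (F j z))\<^sup>2))"
          using i0[OF j] iv[OF j] by (intro Bochner_Integration.integrable_add integrable_mult_right)
        fix z
        have "cmod (\<psi> (l j) - s z) \<le> e + M * (\<sigma> z - l j)\<^sup>2"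
          using M[OF lab[OF j] \<sigma>ab[of z]] by (simp add: s_def dist_real_def power2_commute)
        then have "cmod (\<psi> (l j) - s z) * (cmod (F j z))\<^sup>2 \<le> (e + M * (\<sigma> z - l j)\<^sup>2) * (cmod (F j z))\<^sup>2"
          by (rule mult_right_mono) simp
        moreover have "\<psi> (l j) * complex_of_real ((cmod (F j z))\<^sup>2) - s z * complex_of_real ((cmod (F j z))\<^sup>2)
            = (\<psi> (l j) - s z) * complex_of_real ((cmod (F j z))\<^sup>2)" by (rule left_diff_distrib[symmetric])
        ultimately show "cmod (\<psi> (l j) * complex_of_real ((cmod (F j z))\<^sup>2) - s z * complex_of_real ((cmod (F j z))\<^sup>2))
            \<le> e * (cmod (F j z))\<^sup>2 + M * ((\<sigma> z - l j)\<^sup>2 * (cmod (F j z))\<^sup>2)"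
          by (simp only: norm_mult norm_of_real abs_power2) (simp add: algebra_simps)
      qed
      also have "\<dots> = e + M * (LINT z|gauss. (\<sigma> z - l j)\<^sup>2 * (cmod (F j z))\<^sup>2)"
        using i0[OF j] iv[OF j]
        by (simp add: F1[OF j])
      finally show ?thesis .
    qed
    have "cmod (t N - D N) \<le> (\<Sum>j\<le>N. cmod (\<psi> (l j) - (LINT z|gauss. s z * complex_of_real ((cmod (F j z))\<^sup>2))))"
      unfolding tr D sum_subtractf[symmetric] by (rule norm_sum)
    also have "\<dots> \<le> (\<Sum>j\<le>N. e + M * (LINT z|gauss. (\<sigma> z - l j)\<^sup>2 * (cmod (F j z))\<^sup>2))"
      by (intro sum_mono eig_diff) simp
    also have "\<dots> = e * real (N + 1) + M * (\<Sum>j\<le>N. LINT z|gauss. (\<sigma> z - l j)\<^sup>2 * (cmod (F j z))\<^sup>2)"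
      by (simp add: sum.distrib sum_distrib_left mult.commute)
    also have "(\<Sum>j\<le>N. LINT z|gauss. (\<sigma> z - l j)\<^sup>2 * (cmod (F j z))\<^sup>2) = V N / 2"
      using eigenvalue_variance[OF assms(1) B F eig K] unfolding V_def by simp
    finally show ?thesis by simp
  qed
  have "(\<lambda>N. t N / of_nat (N + 1) - D N / of_nat (N + 1)) \<longlonglongrightarrow> 0"
  proof (rule tendstoI)
    fix \<epsilon> :: real assume "\<epsilon> > 0"
    then have e: "\<epsilon> / 2 > 0" by simp
    obtain M where "M \<ge> 0" and M: "\<And>x y. x \<in> {a..b} \<Longrightarrow> y \<in> {a..b} \<Longrightarrow> cmod (\<psi> x - \<psi> y) \<le> \<epsilon> / 2 + M * (dist x y)\<^sup>2"
      using compact_quadratic_modulus[OF _ \<psi>c e] by auto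
    have "(\<lambda>N. M / 2 * (V N / real (N + 1))) \<longlonglongrightarrow> M / 2 * 0" by (intro tendsto_mult tendsto_const Vlim)
    then have "\<forall>\<^sub>F N in sequentially. M / 2 * (V N / real (N + 1)) < \<epsilon> / 2"
      using e by (intro order_tendstoD(2)) auto
    then show "\<forall>\<^sub>F N in sequentially. dist (t N / of_nat (N + 1) - D N / of_nat (N + 1)) 0 < \<epsilon>"
    proof eventually_elim
      case (elim N)
      have "cmod (t N / of_nat (N + 1) - D N / of_nat (N + 1)) = cmod (t N - D N) / real (N + 1)"
        by (simp only: diff_divide_distrib[symmetric] norm_divide norm_of_nat)
      also have "\<dots> \<le> (\<epsilon> / 2 * real (N + 1) + M / 2 * V N) / real (N + 1)"
        by (intro divide_right_mono est[OF \<open>M \<ge> 0\<close> e M]) auto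
      also have "\<dots> = \<epsilon> / 2 + M / 2 * (V N / real (N + 1))"
        unfolding add_divide_distrib by (subst nonzero_mult_div_cancel_right) auto
      also have "\<dots> < \<epsilon>" using elim by linarith
      finally show ?case by (simp only: dist_norm diff_zero)
    qed
  qed
  from tendsto_add[OF this Dlim]
  show ?thesis unfolding t_def by simp
qed

end
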